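(* Let $\Delta$ be a $1$-dimensional forest (all of whose facets are edges) with vertices $x_1,\dots,x_n$ and edge ideal $I\subset R=K[x_1,\dots,x_n]$. Then: (i) the Castelnuovo–Mumford regularity $\operatorname{reg}(R/I)$ is the maximal number $j$ for which there exist linear monomial cycles $z_1,\dots,z_j$ of $K_\bullet(R/I)$ such that $[z_1]\cdots[z_j]\neq 0$ in $H_\bullet(R/I)$; (ii) the projective dimension $\operatorname{pd}(R/I)$ is the maximum among the sums $\sum_{i=1}^j k_i$ for which there exist linear cycles $z_i\in Z_{k_i}(R/I)$, $i=1,\dots,j$, such that $[z_1]\cdots[z_j]\neq 0$ in $H_\bullet(R/I)$.
   Context: $K$ is a field. A $1$-dimensional forest (all of whose facets are edges) is a finite simple graph without cycles and without isolated vertices. The vertices are identified with the variables of $R=K[x_1,\dots,x_n]$, and the edge ideal $I$ is generated by the monomials $x_ix_j$ with $\{x_i,x_j\}$ an edge. $K_\bullet(R/I)$ is the Koszul complex of $R/I$ with respect to $x_1,\dots,x_n$, with exterior basis elements $e_1,\dots,e_n$ and $d(e_i)=x_i$; $Z_k(R/I)$ is its module of $k$-cycles and $H_\bullet(R/I)$ its homology, a graded $K$-algebra with multiplication induced by $\wedge$. For a monomial ideal $I$, a cycle of $K_\bullet(R/I)$ is a monomial cycle if it is of the form $fe_L$ with $f$ a monomial and $e_L=e_{i_1}\wedge\cdots\wedge e_{i_r}$ for $L=\{i_1<\dots<i_r\}\subseteq\{1,\dots,n\}$. If $d$ is the least degree of the generators of $I$, a monomial cycle $fe_L$ is called linear (a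 linear cycle, or linear monomial cycle) if $f$ is a monomial of degree $d-1$ (here $d=2$, so $f$ is a variable). *)

theory Defs
  imports "HOL-Library.Poly_Mapping" "HOL.Modules"
begin

section \<open>Polynomials and monomial ideals\<close>

text \<open>
  The variables are the elements of a finite linearly ordered type \<open>'v\<close>; the order plays the role
  of the numbering \<open>x\<^sub>1, \<dots>, x\<^sub>n\<close>, and \<open>n\<close> is the cardinality of \<open>'v\<close>. A monomial is identified with
  its exponent function, and the library turns finitely supported coefficient functions into the
  polynomial ring \<open>R\<close>.
\<close>

type_synonym 'v monom = "'v \<Rightarrow>\<^sub>0 nat"
type_synonym ('v, 'k) mpoly = "('v \<Rightarrow>\<^sub>0 nat) \<Rightarrow>\<^sub>0 'k"

abbreviation mono_var :: "'v \<Rightarrow> 'v monom" where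
  "mono_var v \<equiv> Poly_Mapping.single v 1"

abbreviation monomial :: "'v monom \<Rightarrow> ('v, 'k::comm_ring_1) mpoly" where
  "monomial m \<equiv> Poly_Mapping.single m 1"

definition mdeg :: "'v monom \<Rightarrow> nat" where
  "mdeg m = (\<Sum>v\<in>Poly_Mapping.keys m. Poly_Mapping.lookup m v)"

lemma module_mpoly: "module ((*) :: ('v, 'k::comm_ring_1) mpoly \<Rightarrow> _ \<Rightarrow> _)"
  by unfold_locales (simp_all add: algebra_simps)

definition monomial_ideal :: "'v monom set \<Rightarrow> ('v, 'k::comm_ring_1) mpoly set" where
  "monomial_ideal G = module.span (*) (monomial ` G)"

section \<open>Forests and edge ideals\<close>

definition simple_graph :: "'v set set \<Rightarrow> bool" where
  "simple_graph E \<longleftrightarrow> (\<forall>e\<in>E. card e = 2)"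

definition graph_cycle :: "'v set set \<Rightarrow> 'v list \<Rightarrow> bool" where
  "graph_cycle E vs \<longleftrightarrow> 3 \<le> length vs \<and> distinct vs \<and>
     (\<forall>i<length vs. {vs ! i, vs ! (Suc i mod length vs)} \<in> E)"

text \<open>All of \<open>'v\<close> is the vertex set; since all facets are edges, no vertex is isolated.\<close>

definition forest_1dim :: "'v set set \<Rightarrow> bool" where
  "forest_1dim E \<longleftrightarrow> simple_graph E \<and> (\<forall>v. \<exists>e\<in>E. v \<in> e) \<and> \<not> (\<exists>vs. graph_cycle E vs)"

definition edge_monomials :: "'v set set \<Rightarrow> 'v monom set" where
  "edge_monomials E = {mono_var u + mono_var v | u v. u \<noteq> v \<and> {u, v} \<in> E}"

abbreviation edge_ideal :: "'v set set \<Rightarrow> ('v, 'k::comm_ring_1) mpoly set" where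
  "edge_ideal E \<equiv> monomial_ideal (edge_monomials E)"

section \<open>The Koszul complex of \<open>R/I\<close>\<close>

text \<open>
  A chain \<open>c\<close> stands for the element \<open>\<Sum>\<^sub>L c\<^sub>L e\<^sub>L\<close> of \<open>K(R)\<close>, so that \<open>single L f\<close> is \<open>f e\<^sub>L\<close>.
  Since \<open>K(R/I) = K(R)/I K(R)\<close>, elements of \<open>K(R/I)\<close> are handled through representatives in
  \<open>K(R)\<close>: a cycle is a chain with differential in \<open>I K(R)\<close>, and the boundaries (as a submodule
  of \<open>K(R)\<close>) are \<open>d K(R) + I K(R)\<close>.
\<close>

type_synonym ('v, 'k) kchain = "'v set \<Rightarrow>\<^sub>0 ('v, 'k) mpoly"

text \<open>The signs are those forced by \<open>d(e\<^sub>i) = x\<^sub>i\<close> and the Leibniz rule, respectively by sorting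
  \<open>e\<^sub>L \<and> e\<^sub>M\<close> into increasing order.\<close>

definition koszul_d ::
  "('v::{finite,linorder}, 'k::comm_ring_1) kchain \<Rightarrow> ('v, 'k) kchain" where
  "koszul_d c = (\<Sum>L\<in>UNIV. \<Sum>i\<in>L. Poly_Mapping.single (L - {i})
     ((-1) ^ card {l\<in>L. l < i} * monomial (mono_var i) * Poly_Mapping.lookup c L))"

definition koszul_wedge ::
  "('v::{finite,linorder}, 'k::comm_ring_1) kchain \<Rightarrow> ('v, 'k) kchain \<Rightarrow> ('v, 'k) kchain" where
  "koszul_wedge a b = (\<Sum>L\<in>UNIV. \<Sum>M\<in>UNIV. if L \<inter> M \<noteq> {} then 0 else
     Poly_Mapping.single (L \<union> M) ((-1) ^ card {(i, j). i \<in> L \<and> j \<in> M \<and> j < i} *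
       Poly_Mapping.lookup a L * Poly_Mapping.lookup b M))"

definition ideal_chains :: "('v, 'k::comm_ring_1) mpoly set \<Rightarrow> ('v, 'k) kchain set" where
  "ideal_chains I = {c. \<forall>L. Poly_Mapping.lookup c L \<in> I}"

definition koszul_cycles ::
  "('v::{finite,linorder}, 'k::comm_ring_1) mpoly set \<Rightarrow> nat \<Rightarrow> ('v, 'k) kchain set" where
  "koszul_cycles I k =
     {z. (\<forall>L\<in>Poly_Mapping.keys z. card L = k) \<and> koszul_d z \<in> ideal_chains I}"

definition koszul_boundaries ::
  "('v::{finite,linorder}, 'k::comm_ring_1) mpoly set \<Rightarrow> ('v, 'k) kchain set" where
  "koszul_boundaries I = {koszul_d b + y | b y. y \<in> ideal_chains I}"

text \<open>Homology classes are cosets, and the product of two classes is the union of the classes of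
  all products of representatives (which for classes of cycles is a single class).\<close>

definition koszul_class ::
  "('v::{finite,linorder}, 'k::comm_ring_1) mpoly set \<Rightarrow> ('v, 'k) kchain \<Rightarrow> ('v, 'k) kchain set"
  where "koszul_class I z = {w. w - z \<in> koszul_boundaries I}"

definition homology_mult ::
  "('v::{finite,linorder}, 'k::comm_ring_1) mpoly set \<Rightarrow>
     ('v, 'k) kchain set \<Rightarrow> ('v, 'k) kchain set \<Rightarrow> ('v, 'k) kchain set" where
  "homology_mult I A B = (\<Union>a\<in>A. \<Union>b\<in>B. koszul_class I (koszul_wedge a b))"

definition homology_prod ::
  "('v::{finite,linorder}, 'k::comm_ring_1) mpoly set \<Rightarrow>
     ('v, 'k) kchain list \<Rightarrow> ('v, 'k) kchain set" where
  "homology_prod I zs =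
     foldr (homology_mult I) (map (koszul_class I) zs) (koszul_class I (Poly_Mapping.single {} 1))"

text \<open>Linear monomial cycles of homological degree \<open>k\<close> for the monomial ideal generated by \<open>G\<close>.\<close>

definition linear_cycle ::
  "'v monom set \<Rightarrow> nat \<Rightarrow> ('v::{finite,linorder}, 'k::comm_ring_1) kchain \<Rightarrow> bool" where
  "linear_cycle G k z \<longleftrightarrow> z \<in> koszul_cycles (monomial_ideal G) k \<and>
     (\<exists>m L. z = Poly_Mapping.single L (monomial m) \<and>
        mdeg m = (LEAST d. \<exists>g\<in>G. mdeg g = d) - 1)"

section \<open>Resolutions of \<open>R/I\<close>\<close>

text \<open>\<open>R\<^sup>(\<nat>\<^sup>)\<close>, the free module of countable rank. All modules in the resolutions below are direct
  summands of it; this covers all countably generated projective modules.\<close>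

type_synonym ('v, 'k) fmod = "nat \<Rightarrow>\<^sub>0 ('v, 'k) mpoly"

definition fscale :: "('v, 'k::comm_ring_1) mpoly \<Rightarrow> ('v, 'k) fmod \<Rightarrow> ('v, 'k) fmod" where
  "fscale r x = Poly_Mapping.map ((*) r) x"

lemma lookup_fscale [simp]: "Poly_Mapping.lookup (fscale r x) k = r * Poly_Mapping.lookup x k"
  by (simp add: fscale_def Poly_Mapping.map.rep_eq when_def)

lemma module_fscale: "module fscale"
  by unfold_locales (auto intro!: poly_mapping_eqI simp: lookup_add algebra_simps)

text \<open>
  An exact sequence \<open>\<dots> \<rightarrow> P\<^sub>2 \<rightarrow> P\<^sub>1 \<rightarrow> P\<^sub>0 \<rightarrow> R/I \<rightarrow> 0\<close>, where \<open>d i\<close> maps \<open>P\<^sub>i\<^sub>+\<^sub>1\<close> to \<open>P\<^sub>i\<close>. As the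
  \<open>P\<^sub>i\<close> are direct summands of \<open>R\<^sup>(\<nat>\<^sup>)\<close>, there is no loss in taking the \<open>d i\<close> defined on all of
  \<open>R\<^sup>(\<nat>\<^sup>)\<close>, nor in lifting the augmentation to a linear map \<open>\<epsilon>\<close> into \<open>R\<close>, read modulo \<open>I\<close>.
\<close>

definition resolution ::
  "('v, 'k::comm_ring_1) mpoly set \<Rightarrow> (nat \<Rightarrow> ('v, 'k) fmod set) \<Rightarrow>
     (nat \<Rightarrow> ('v, 'k) fmod \<Rightarrow> ('v, 'k) fmod) \<Rightarrow> (('v, 'k) fmod \<Rightarrow> ('v, 'k) mpoly) \<Rightarrow> bool" where
  "resolution I P d \<epsilon> \<longleftrightarrow>
     (\<forall>i. module_hom fscale fscale (d i)) \<and> module_hom fscale (*) \<epsilon> \<and>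
     (\<forall>r. \<exists>x\<in>P 0. r - \<epsilon> x \<in> I) \<and>
     d 0 ` P 1 = {x\<in>P 0. \<epsilon> x \<in> I} \<and>
     (\<forall>i. d (Suc i) ` P (Suc (Suc i)) = {x\<in>P (Suc i). d i x = 0})"

definition direct_summand :: "('v, 'k::comm_ring_1) fmod set \<Rightarrow> bool" where
  "direct_summand P \<longleftrightarrow> module.subspace fscale P \<and>
     (\<exists>Q. module.subspace fscale Q \<and> P \<inter> Q = {0} \<and> (\<forall>x. \<exists>p\<in>P. \<exists>q\<in>Q. x = p + q))"

definition has_projective_resolution :: "('v, 'k::comm_ring_1) mpoly set \<Rightarrow> nat \<Rightarrow> bool" where
  "has_projective_resolution I p \<longleftrightarrow> (\<exists>P d \<epsilon>. resolution I P d \<epsilon> \<and>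
     (\<forall>i. direct_summand (P i)) \<and> (\<forall>i>p. P i = {0}))"

definition projective_dimension :: "('v, 'k::comm_ring_1) mpoly set \<Rightarrow> nat" where
  "projective_dimension I = (LEAST p. has_projective_resolution I p)"

text \<open>
  In a graded free resolution, \<open>F\<^sub>i\<close> is the free module on finitely many of the standard basis
  vectors, those with index in \<open>B i\<close>, and the basis vector with index \<open>k\<close> has degree \<open>s i k\<close>.
  The maps are homogeneous of degree 0, and minimality means \<open>d(F\<^sub>i\<^sub>+\<^sub>1) \<subseteq> (x\<^sub>1, \<dots>, x\<^sub>n) F\<^sub>i\<close>. As
  \<open>R/I\<close> lives in nonnegative degrees, so do all basis elements of its minimal resolution;
  therefore natural numbers suffice for the degrees.
\<close>

definition free_on :: "nat set \<Rightarrow> ('v, 'k::comm_ring_1) fmod set" where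
  "free_on B = {x. Poly_Mapping.keys x \<subseteq> B}"

definition minimal_graded_free_resolution ::
  "('v, 'k::comm_ring_1) mpoly set \<Rightarrow> (nat \<Rightarrow> nat set) \<Rightarrow> (nat \<Rightarrow> nat \<Rightarrow> nat) \<Rightarrow>
     (nat \<Rightarrow> ('v, 'k) fmod \<Rightarrow> ('v, 'k) fmod) \<Rightarrow> (('v, 'k) fmod \<Rightarrow> ('v, 'k) mpoly) \<Rightarrow> bool" where
  "minimal_graded_free_resolution I B s d \<epsilon> \<longleftrightarrow>
     (\<forall>i. finite (B i)) \<and> resolution I (\<lambda>i. free_on (B i)) d \<epsilon> \<and>
     (\<forall>k\<in>B 0. \<forall>m\<in>Poly_Mapping.keys (\<epsilon> (Poly_Mapping.single k 1)). mdeg m = s 0 k) \<and>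
     (\<forall>i. \<forall>k\<in>B (Suc i). \<forall>l\<in>B i.
        (\<forall>m\<in>Poly_Mapping.keys (Poly_Mapping.lookup (d i (Poly_Mapping.single k 1)) l).
           mdeg m + s i l = s (Suc i) k) \<and>
        Poly_Mapping.lookup (Poly_Mapping.lookup (d i (Poly_Mapping.single k 1)) l) 0 = 0)"

text \<open>Graded Betti numbers: the multiplicity of \<open>R(-j)\<close> in \<open>F\<^sub>i\<close>, for any minimal graded free
  resolution \<open>F\<close> of \<open>R/I\<close>.\<close>

definition graded_betti :: "('v, 'k::comm_ring_1) mpoly set \<Rightarrow> nat \<Rightarrow> nat \<Rightarrow> nat" where
  "graded_betti I i j = (THE b. \<exists>B s d \<epsilon>.
     minimal_graded_free_resolution I B s d \<epsilon> \<and> b = card {k\<in>B i. s i k = j})"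

definition regularity :: "('v, 'k::comm_ring_1) mpoly set \<Rightarrow> nat" where
  "regularity I = Max {j. \<exists>i. graded_betti I i (i + j) \<noteq> 0}"

definition is_maximum :: "nat set \<Rightarrow> nat \<Rightarrow> bool" where
  "is_maximum S m \<longleftrightarrow> m \<in> S \<and> (\<forall>s\<in>S. s \<le> m)"

end

theory Submission
  imports Defs
begin

text \<open>  Both invariants are determined by the pairs \<open>(i, j)\<close> with a nonzero graded Betti number
  \<open>\<beta>\<^sub>i\<^sub>,\<^sub>i\<^sub>+\<^sub>j\<close> of \<open>R/I\<close>, and these turn out to be exactly the pairs (sum of the homological degrees,
  number of factors) of the nonzero products of linear cycles.

  The Betti numbers come from an explicit minimal resolution. Let \<open>x\<close> be a leaf of the forest with
  neighbour \<open>y\<close>, let \<open>E\<^sub>0\<close> be the forest without the edge \<open>xy\<close>, let \<open>N\<close> be the set of the other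
  neighbours of \<open>y\<close>, and let \<open>E\<^sub>1\<close> consist of the edges that avoid \<open>x\<close>, \<open>y\<close> and \<open>N\<close>. Then
  \<open>I(E) = I(E\<^sub>0) + (xy)\<close> and \<open>I(E\<^sub>0) : xy = I(E\<^sub>1) + (N)\<close>. As \<open>x\<close> divides no generator of \<open>I(E\<^sub>0)\<close>,
  multiplication by \<open>xy\<close> lifts to \<open>x\<close> times a lift of multiplication by \<open>y\<close>. All entries of such a
  map of complexes lie in the maximal ideal, so its mapping cone is not only a resolution of
  \<open>R/I(E)\<close> but a minimal one (\<open>cone_minimal\<close>). Unwinding the recursion, each basis element of
  homological degree \<open>i\<close> and degree \<open>i + j\<close> comes from a family of \<open>j\<close> bouquets: centres \<open>y\<^sub>k\<close> with
  pairwise disjoint sets \<open>L\<^sub>k\<close> of neighbours, \<open>i\<close> neighbours altogether, and vertices \<open>x\<^sub>k \<in> L\<^sub>k\<close> such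
  that the edges \<open>x\<^sub>k y\<^sub>k\<close> form an induced matching (\<open>resolved_within_forest\<close>).

  Such a family gives linear cycles \<open>y\<^sub>k e\<^bsub>L\<^sub>k\<^esub>\<close>. Their product is, up to sign, the product of the
  \<open>y\<^sub>k\<close> times \<open>e\<^sub>L\<close> for the union \<open>L\<close> of the \<open>L\<^sub>k\<close>. A linear functional that kills all boundaries and
  all chains with coefficients in \<open>I\<close>, but not this chain, shows that its class is not zero
  (\<open>bouquet_class_nonzero\<close>).

  Conversely, a nonzero product of \<open>j\<close> linear cycles of total homological degree \<open>i\<close> is a nonzero
  class in \<open>H\<^sub>i(R/I)\<close> of degree \<open>i + j\<close>. Pushing it through the double complex formed by the Koszul
  complex and a resolution \<open>F\<close> shows that \<open>F\<^sub>i\<close> has a generator of degree \<open>i + j\<close> if \<open>F\<close> is minimal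
  (\<open>koszul_boundary_of_betti_zero\<close>), and that \<open>F\<close> has length at least \<open>i\<close> if it is any projective
  resolution (\<open>koszul_boundary_of_projective_resolution\<close>). The latter gives the lower bound for the
  projective dimension, the resolution above the upper bound. That Betti numbers do not depend on
  the minimal resolution is \<open>graded_betti_eq\<close>, proved by comparing two of them.\<close>

section \<open>Contractions and the Koszul differential\<close>

text \<open>Signs are applied in arbitrary abelian groups because the chains below have coefficients in
  polynomial rings as well as in free modules.\<close>

definition signed :: "nat \<Rightarrow> 'a::ab_group_add \<Rightarrow> 'a" where
  "signed n a = (if even n then a else - a)"

lemma signed_zero [simp]: "signed n 0 = 0"
  and signed_add: "signed n (a + b) = signed n a + signed n b"
  and signed_uminus: "signed n (- a) = - signed n a"
  and signed_signed: "signed m (signed n a) = signed (m + n) a"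
  and signed_Suc [simp]: "signed (Suc n) a = - signed n a"
  and signed_0 [simp]: "signed 0 a = a"
  by (auto simp: signed_def)

lemma signed_twice [simp]: "signed n (signed n a) = a"
  by (simp add: signed_def)

lemma additive_signed: "Modules.additive f \<Longrightarrow> f (signed n a) = signed n (f a)"
  by (simp add: signed_def additive.minus)

definition below :: "'v::linorder \<Rightarrow> 'v set \<Rightarrow> nat" where
  "below i M = card {l\<in>M. l < i}"

lemma below_insert:
  fixes M :: "'v::{finite,linorder} set"
  assumes "j \<notin> M"
  shows "below i (insert j M) = below i M + (if j < i then 1 else 0)"
proof -
  have "{l \<in> insert j M. l < i} = (if j < i then insert j {l\<in>M. l < i} else {l\<in>M. l < i})"
    by auto
  then show ?thesis
    using assms by (simp add: below_def)
qed

text \<open>The interior product with the dual of \<open>e\<^sub>i\<close>, and the exterior product with \<open>e\<^sub>i\<close> from the left.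
  The relations between them (\<open>contract_anticommute\<close>, \<open>contract_extend\<close>) hold all the signs that the
  Koszul differential \<open>\<Sum>\<^sub>i x\<^sub>i contract i\<close> needs.\<close>

definition contract ::
  "'v::{finite,linorder} \<Rightarrow> ('v set \<Rightarrow> 'a::ab_group_add) \<Rightarrow> 'v set \<Rightarrow> 'a" where
  "contract i c M = (if i \<in> M then 0 else signed (below i M) (c (insert i M)))"

definition extend ::
  "'v::{finite,linorder} \<Rightarrow> ('v set \<Rightarrow> 'a::ab_group_add) \<Rightarrow> 'v set \<Rightarrow> 'a" where
  "extend i c M = (if i \<in> M then signed (below i M) (c (M - {i})) else 0)"

lemma contract_self [simp]: "contract i (contract i c) M = 0"
  by (simp add: contract_def)

lemma contract_anticommute: "contract i (contract j c) M = - contract j (contract i c) M"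
proof -
  have *: "contract i (contract j c) M = - contract j (contract i c) M"
    if "i < j" "i \<notin> M" "j \<notin> M" for i j
    using that by (auto simp: contract_def below_insert signed_signed signed_uminus insert_commute add.commute)
  show ?thesis
  proof (cases "i \<in> M \<or> j \<in> M \<or> i = j")
    case True
    then show ?thesis by (auto simp: contract_def)
  next
    case False
    then consider "i < j" | "j < i" by force
    then show ?thesis using False *[of i j] *[of j i] by cases auto
  qed
qed

lemma contract_extend:
  "contract i (extend j c) M = (if i = j then c M else 0) - extend j (contract i c) M"
proof (cases "i = j")
  case True
  show ?thesis
  proof (cases "j \<in> M")
    case True
    then show ?thesis
      using \<open>i = j\<close> below_insert[of j "M - {j}" j]
      by (simp add: contract_def extend_def insert_absorb)
  next
    case False
    then show ?thesis
      using \<open>i = j\<close> below_insert[of j M j]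
      by (simp add: contract_def extend_def)
  qed
next
  case False
  show ?thesis
  proof (cases "i \<in> M \<or> j \<notin> M")
    case True
    then show ?thesis using False by (auto simp: contract_def extend_def)
  next
    case F: False
    define N where "N = M - {j}"
    have M: "M = insert j N" and N: "j \<notin> N" "i \<notin> N"
      using F by (auto simp: N_def)
    have eq: "insert i (insert j N) - {j} = insert i N"
      using False N by auto
    have 1: "contract i (extend j c) M =
        signed (below i M) (signed (below j (insert i M)) (c (insert i N)))"
      using False N eq by (simp add: contract_def extend_def M)
    have 2: "extend j (contract i c) M = signed (below j M) (signed (below i N) (c (insert i N)))"
      using N by (simp add: contract_def extend_def M)
    have 3: "below i M = below i N + (if j < i then 1 else 0)"
      "below j (insert i M) = below j M + (if i < j then 1 else 0)"
      using False N by (simp_all add: M below_insert)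
    from False consider "i < j" "\<not> j < i" | "j < i" "\<not> i < j" by force
    then show ?thesis
      using False unfolding 1 2 3
      by cases (simp_all add: signed_signed signed_uminus add.commute)
  qed
qed

lemma contract_additive:
  "Modules.additive f \<Longrightarrow> contract i (\<lambda>M. f (c M)) M = f (contract i c M)"
  by (simp add: contract_def additive_signed additive.zero)

lemma extend_additive:
  "Modules.additive f \<Longrightarrow> extend i (\<lambda>M. f (c M)) M = f (extend i c M)"
  by (simp add: extend_def additive_signed additive.zero)

lemma contract_add: "contract i (\<lambda>M. c M + c' M) M = contract i c M + contract i c' M"
  by (simp add: contract_def signed_add)

lemma contract_diff: "contract i (\<lambda>M. c M - c' M) M = contract i c M - contract i c' M"
  by (simp add: contract_def signed_def)

lemma contract_sum:
  "contract i (\<lambda>M. \<Sum>j\<in>A. c j M) M = (\<Sum>j\<in>A. contract i (c j) M)"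
proof (induction A rule: infinite_finite_induct)
  case (insert x F)
  then show ?case
    by (auto simp: contract_def signed_add)
qed (simp_all add: contract_def)

lemma extend_sum:
  "extend i (\<lambda>M. \<Sum>j\<in>A. c j M) M = (\<Sum>j\<in>A. extend i (c j) M)"
proof (induction A rule: infinite_finite_induct)
  case (insert x F)
  then show ?case
    by (auto simp: extend_def signed_add)
qed (simp_all add: extend_def)

text \<open>The diagonal has to vanish separately, because in characteristic two antisymmetry does not force
  it to.\<close>

lemma alternating_double_sum:
  fixes t :: "'i \<Rightarrow> 'i \<Rightarrow> 'a::ab_group_add"
  assumes "finite A" "\<And>i. t i i = 0" "\<And>i j. t i j = - t j i"
  shows "(\<Sum>i\<in>A. \<Sum>j\<in>A. t i j) = 0"
  using assms(1)
proof induction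
  case (insert x F)
  have "(\<Sum>i\<in>insert x F. \<Sum>j\<in>insert x F. t i j) =
        (\<Sum>i\<in>F. t i x) + (\<Sum>j\<in>F. t x j)"
    using insert by (simp add: sum.distrib assms(2))
  also have "(\<Sum>j\<in>F. t x j) = - (\<Sum>i\<in>F. t i x)"
    unfolding sum_negf[symmetric] by (rule sum.cong[OF refl]) (rule assms(3))
  finally show ?case by simp
qed simp

definition kdiff ::
  "('v::{finite,linorder} \<Rightarrow> 'a \<Rightarrow> 'a::ab_group_add) \<Rightarrow> ('v set \<Rightarrow> 'a) \<Rightarrow> 'v set \<Rightarrow> 'a" where
  "kdiff X c M = (\<Sum>i\<in>UNIV. X i (contract i c M))"

locale commuting_actions =
  fixes X :: "'v::{finite,linorder} \<Rightarrow> 'a \<Rightarrow> 'a::ab_group_add"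
  assumes action_add: "X i (a + b) = X i a + X i b"
    and action_commute: "X i (X j a) = X j (X i a)"
begin

lemma action_additive: "Modules.additive (X i)"
  by (simp add: Modules.additive_def action_add)

lemma action_sum: "X i (sum f A) = (\<Sum>a\<in>A. X i (f a))"
  using additive.sum[OF action_additive, of i f A] .

lemma action_diff: "X i (a - b) = X i a - X i b"
  using additive.diff[OF action_additive] .

lemma action_minus: "X i (- a) = - X i a"
  using additive.minus[OF action_additive] .

lemma action_zero [simp]: "X i 0 = 0"
  using additive.zero[OF action_additive] .

lemma contract_action: "contract i (\<lambda>M. X j (c M)) M = X j (contract i c M)"
  by (rule contract_additive[OF action_additive])

lemma extend_action: "extend i (\<lambda>M. X j (c M)) M = X j (extend i c M)"
  by (rule extend_additive[OF action_additive])

lemma kdiff_add: "kdiff X (\<lambda>M. c M + c' M) M = kdiff X c M + kdiff X c' M"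
  by (simp add: kdiff_def contract_add action_add sum.distrib)

lemma kdiff_diff: "kdiff X (\<lambda>M. c M - c' M) M = kdiff X c M - kdiff X c' M"
  by (simp add: kdiff_def contract_diff action_diff sum_subtractf)

lemma kdiff_zero [simp]: "kdiff X (\<lambda>M. 0) M = 0"
  using kdiff_diff[of "\<lambda>M. 0" "\<lambda>M. 0" M] by simp

lemma kdiff_kdiff: "kdiff X (kdiff X c) M = 0"
proof -
  have "kdiff X (kdiff X c) M = (\<Sum>i\<in>UNIV. \<Sum>j\<in>UNIV. X i (X j (contract i (contract j c) M)))"
    unfolding kdiff_def [of X "kdiff X c"]
    by (rule sum.cong[OF refl])
      (simp add: kdiff_def[abs_def] contract_sum action_sum contract_action)
  also have "\<dots> = 0"
  proof (rule alternating_double_sum)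
    fix i j
    show "X i (X j (contract i (contract j c) M)) = - X j (X i (contract j (contract i c) M))"
      by (subst contract_anticommute) (simp add: action_commute action_minus)
  qed simp_all
  finally show ?thesis .
qed

end

lemma kdiff_intertwine:
  assumes "Modules.additive f" "\<And>i a. f (X i a) = Y i (f a)"
  shows "kdiff Y (\<lambda>M. f (c M)) M = f (kdiff X c M)"
  unfolding kdiff_def contract_additive[OF assms(1)] additive.sum[OF assms(1)] assms(2) ..

text \<open>\<open>Q p\<close> is meant to divide the part divisible by \<open>x\<^sub>p\<close> by \<open>x\<^sub>p\<close> and to discard the rest.\<close>

locale divisible_actions = commuting_actions +
  fixes Q :: "'v::{finite,linorder} \<Rightarrow> 'a \<Rightarrow> 'a::ab_group_add"
  assumes quotient_add: "Q p (a + b) = Q p a + Q p b"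
    and quotient_commute: "Q p (Q q a) = Q q (Q p a)"
    and quotient_action: "Q p (X p a) = a"
    and quotient_action_commute: "i \<noteq> p \<Longrightarrow> Q p (X i a) = X i (Q p a)"
begin

lemma quotient_additive: "Modules.additive (Q i)"
  by (simp add: Modules.additive_def quotient_add)

lemma quotient_sum: "Q i (sum f A) = (\<Sum>a\<in>A. Q i (f a))"
  using additive.sum[OF quotient_additive, of i f A] .

lemma quotient_diff: "Q i (a - b) = Q i a - Q i b"
  using additive.diff[OF quotient_additive] .

lemma quotient_zero [simp]: "Q i 0 = 0"
  using additive.zero[OF quotient_additive] .

lemma contract_quotient: "contract i (\<lambda>M. Q j (c M)) M = Q j (contract i c M)"
  by (rule contract_additive[OF quotient_additive])

text \<open>With \<open>H = Q p \<circ> extend p\<close>, the terms of \<open>d H + H d\<close> for \<open>i \<noteq> p\<close> cancel because \<open>x\<^sub>i\<close> commutes with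
  \<open>Q p\<close>. What the term for \<open>i = p\<close> leaves is the identity minus the projection to the part in which
  neither \<open>x\<^sub>p\<close> nor \<open>e\<^sub>p\<close> occurs. No division by integers takes place, so this works in every
  characteristic.\<close>

lemma koszul_homotopy:
  assumes "\<And>M. kdiff X c M = 0"
  shows "c M = kdiff X (\<lambda>M. Q p (extend p c M)) M + (if p \<in> M then 0 else c M - X p (Q p (c M)))"
proof -
  define S where "S = (\<Sum>i\<in>UNIV. X i (Q p (extend p (contract i c) M)))"
  define y where "y = extend p (contract p c) M"
  have y: "y = (if p \<in> M then c M else 0)"
    using below_insert[of p "M - {p}" p]
    by (auto simp: y_def extend_def contract_def insert_absorb)
  have "kdiff X (\<lambda>M. Q p (extend p c M)) M =
      (\<Sum>i\<in>UNIV. X i (Q p (contract i (extend p c) M)))"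
    by (simp add: kdiff_def contract_quotient)
  also have "\<dots> = (\<Sum>i\<in>UNIV. (if i = p then X p (Q p (c M)) else 0)
        - X i (Q p (extend p (contract i c) M)))"
    by (rule sum.cong) (auto simp: contract_extend quotient_diff action_diff)
  also have "\<dots> = X p (Q p (c M)) - S"
    by (simp add: sum_subtractf S_def)
  finally have 1: "kdiff X (\<lambda>M. Q p (extend p c M)) M = X p (Q p (c M)) - S" .
  have "kdiff X c = (\<lambda>M. 0)"
    by (rule ext) (rule assms)
  then have "0 = Q p (extend p (kdiff X c) M)"
    by (simp add: extend_def)
  also have "\<dots> = (\<Sum>i\<in>UNIV. Q p (X i (extend p (contract i c) M)))"
    by (simp add: kdiff_def[abs_def] extend_sum extend_action quotient_sum)
  also have "\<dots> = (\<Sum>i\<in>UNIV. X i (Q p (extend p (contract i c) M)) +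
      (if i = p then y - X p (Q p y) else 0))"
    by (rule sum.cong) (auto simp: y_def quotient_action quotient_action_commute)
  also have "\<dots> = S + (y - X p (Q p y))"
    by (simp add: sum.distrib S_def)
  finally have "S + (y - X p (Q p y)) = 0" ..
  then have "S = X p (Q p y) - y"
    by (simp only: add_eq_0_iff2 minus_diff_eq)
  then show ?thesis
    unfolding 1 y by (cases "p \<in> M") (simp_all only: if_True if_False action_zero quotient_zero, simp_all)
qed

text \<open>The homotopy is applied for one variable after the other. The projections for different variables
  commute, so a variable that has been removed does not come back.\<close>

lemma cycle_reduction:
  assumes "\<And>M. kdiff X c M = 0"
  shows "\<exists>v c'. (\<forall>M. c M = kdiff X v M + c' M) \<and>
           (\<forall>p\<in>S. \<forall>M. (p \<in> M \<longrightarrow> c' M = 0) \<and> Q p (c' M) = 0)"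
  using finite[of S]
proof induction
  case empty
  show ?case
    by (rule exI[of _ "\<lambda>M. 0"], rule exI[of _ c]) simp
next
  case (insert p S)
  then obtain v c' where c: "\<And>M. c M = kdiff X v M + c' M"
    and c': "\<And>q M. q \<in> S \<Longrightarrow> (q \<in> M \<longrightarrow> c' M = 0) \<and> Q q (c' M) = 0"
    by blast
  have "c' = (\<lambda>M. c M - kdiff X v M)"
    using c by (intro ext) (simp add: algebra_simps)
  then have cyc: "kdiff X c' M = 0" for M
    by (simp add: kdiff_diff kdiff_kdiff assms)
  define w where "w M = Q p (extend p c' M)" for M
  define c'' where "c'' M = (if p \<in> M then 0 else c' M - X p (Q p (c' M)))" for M
  have w: "c' M = kdiff X w M + c'' M" for M
    unfolding w_def[abs_def] c''_def by (rule koszul_homotopy[of c' M p, OF cyc])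
  have 1: "c M = kdiff X (\<lambda>M. v M + w M) M + c'' M" for M
    unfolding kdiff_add c[of M] w[of M] by (rule add.assoc[symmetric])
  have 2: "(q \<in> M \<longrightarrow> c'' M = 0) \<and> Q q (c'' M) = 0" if "q \<in> insert p S" for q M
  proof (cases "q = p")
    case True
    then show ?thesis by (simp add: c''_def quotient_diff quotient_action)
  next
    case False
    then have q: "q \<in> S" using that by simp
    have "Q q (X p (Q p (c' M))) = X p (Q p (Q q (c' M)))"
      using False by (simp only: quotient_action_commute quotient_commute[of q p])
    then show ?thesis
      using c'[OF q, of M] by (simp add: c''_def quotient_diff)
  qed
  show ?case
    by (intro exI[of _ "\<lambda>M. v M + w M"] exI[of _ c''] conjI ballI allI 1 2[THEN conjunct1] 2[THEN conjunct2])
qed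

end

section \<open>Polynomials and free modules\<close>

text \<open>Otherwise simplification would turn the exponent in \<open>mono_var v = single v 1\<close> into \<open>Suc 0\<close>,
  and rules about \<open>mono_var\<close> would no longer apply.\<close>

declare One_nat_def [simp del]

abbreviation (input) lookup :: "('a \<Rightarrow>\<^sub>0 'b::zero) \<Rightarrow> 'a \<Rightarrow> 'b" where
  "lookup \<equiv> Poly_Mapping.lookup"

abbreviation (input) single :: "'a \<Rightarrow> 'b \<Rightarrow> 'a \<Rightarrow>\<^sub>0 'b::zero" where
  "single \<equiv> Poly_Mapping.single"

abbreviation (input) keys :: "('a \<Rightarrow>\<^sub>0 'b::zero) \<Rightarrow> 'a set" where
  "keys \<equiv> Poly_Mapping.keys"

lemma mdeg_eq_sum: "mdeg (m :: 'v::finite monom) = (\<Sum>v\<in>UNIV. lookup m v)"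
  unfolding mdeg_def by (rule sum.mono_neutral_left) (auto simp: in_keys_iff)

lemma mdeg_plus [simp]: "mdeg (m + n :: 'v::finite monom) = mdeg m + mdeg n"
  by (simp add: mdeg_eq_sum lookup_add sum.distrib)

lemma mdeg_zero [simp]: "mdeg 0 = 0"
  by (simp add: mdeg_def)

lemma mdeg_mono_var [simp]: "mdeg (mono_var v) = 1"
  by (simp add: mdeg_def)

lemma lookup_single_times_plus:
  fixes f :: "'m::cancel_comm_monoid_add \<Rightarrow>\<^sub>0 'k::comm_ring_1"
  shows "lookup (single a c * f) (a + m) = c * lookup f m"
proof -
  have "lookup (single a c * f) (a + m) =
      (\<Sum>l. (c when a = l) * (\<Sum>q. lookup f q when a + m = l + q))"
    by (simp add: lookup_mult lookup_single)
  also have "\<dots> = (\<Sum>l. c * (\<Sum>q. lookup f q when a + m = l + q) when a = l)"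
    by (simp add: when_mult)
  also have "\<dots> = c * lookup f m"
    by simp
  finally show ?thesis .
qed

lemma lookup_single_times_not_plus:
  fixes f :: "'m::cancel_comm_monoid_add \<Rightarrow>\<^sub>0 'k::comm_ring_1"
  assumes "\<nexists>n. m = a + n"
  shows "lookup (single a c * f) m = 0"
proof (rule ccontr)
  assume "\<not> ?thesis"
  then have "m \<in> keys (single a c * f)"
    by (simp add: in_keys_iff)
  with keys_mult[of "single a c" f] show False
    using assms by (auto split: if_splits)
qed

lemma mono_var_plus_iff:
  "(\<exists>n. m = mono_var v + n) \<longleftrightarrow> 0 < lookup (m :: 'v monom) v"
proof
  assume "0 < lookup m v"
  then have "m = mono_var v + (m - mono_var v)"
    by (intro poly_mapping_eqI) (auto simp: lookup_add lookup_minus lookup_single when_def)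
  then show "\<exists>n. m = mono_var v + n" ..
qed (auto simp: lookup_add)

lemma monom_neq_zeroE:
  assumes "(m :: 'v monom) \<noteq> 0"
  obtains v n where "m = mono_var v + n"
proof -
  from assms obtain v where "lookup m v \<noteq> 0"
    by (metis lookup_zero poly_mapping_eqI)
  then show ?thesis
    using mono_var_plus_iff[of m v] that by auto
qed

lemma lookup_mono_var_times_zero [simp]:
  "lookup (monomial (mono_var v) * (f :: ('v, 'k::comm_ring_1) mpoly)) 0 = 0"
proof (rule lookup_single_times_not_plus)
  show "\<nexists>n. 0 = mono_var v + n"
    using mono_var_plus_iff[of 0 v] by simp
qed

definition pquot :: "'v \<Rightarrow> ('v, 'k::comm_ring_1) mpoly \<Rightarrow> ('v, 'k) mpoly" where
  "pquot v = Poly_Mapping.map_key ((+) (mono_var v))"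

lemma lookup_pquot [simp]:
  "lookup (pquot v f) m = lookup f (mono_var v + m)"
  by (simp add: pquot_def map_key.rep_eq)

lemma pquot_zero [simp]: "pquot v 0 = 0"
  by (rule poly_mapping_eqI) simp

lemma pquot_add: "pquot v (f + g) = pquot v f + pquot v g"
  by (rule poly_mapping_eqI) (simp add: lookup_add)

lemma pquot_mono_var: "pquot v (monomial (mono_var v) * f) = f"
  by (rule poly_mapping_eqI) (simp add: lookup_single_times_plus)

lemma pquot_commute: "pquot v (pquot w f) = pquot w (pquot v f)"
  by (rule poly_mapping_eqI) (simp add: add_ac)

lemma pquot_mono_var_other:
  assumes "w \<noteq> v"
  shows "pquot v (monomial (mono_var w) * f) = monomial (mono_var w) * pquot v f"
proof (rule poly_mapping_eqI)
  fix m
  show "lookup (pquot v (monomial (mono_var w) * f)) m =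
    lookup (monomial (mono_var w) * pquot v f) m"
  proof (cases "0 < lookup m w")
    case True
    then obtain n where "m = mono_var w + n"
      using mono_var_plus_iff[of m w] by auto
    then show ?thesis
      using lookup_single_times_plus[of "mono_var w" 1 f "mono_var v + n"]
        lookup_single_times_plus[of "mono_var w" 1 "pquot v f" n]
      by (simp add: add_ac)
  next
    case False
    have "\<nexists>n. m = mono_var w + n" "\<nexists>n. mono_var v + m = mono_var w + n"
      unfolding mono_var_plus_iff using False assms by (simp_all add: lookup_add lookup_single)
    then show ?thesis
      by (simp add: lookup_single_times_not_plus)
  qed
qed

text \<open>The actions of a variable on free modules, and its partial inverse, so that the homotopy above
  applies to Koszul complexes with coefficients in a free module.\<close>

abbreviation fvar :: "'v \<Rightarrow> ('v, 'k::comm_ring_1) fmod \<Rightarrow> ('v, 'k) fmod" where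
  "fvar v \<equiv> fscale (monomial (mono_var v))"

abbreviation fquot :: "'v \<Rightarrow> ('v, 'k::comm_ring_1) fmod \<Rightarrow> ('v, 'k) fmod" where
  "fquot v \<equiv> Poly_Mapping.map (pquot v)"

lemma lookup_fquot [simp]:
  "lookup (fquot v x) k = pquot v (lookup x k)"
  by (simp add: Poly_Mapping.map.rep_eq when_def)

interpretation fmod: module fscale
  by (rule module_fscale)

interpretation fmod: divisible_actions "fvar :: 'v::{finite,linorder} \<Rightarrow> ('v, 'k::comm_ring_1) fmod \<Rightarrow> _" fquot
  by (unfold_locales; rule poly_mapping_eqI)
    (simp_all add: lookup_add pquot_add pquot_mono_var pquot_commute pquot_mono_var_other
      distrib_left mult.left_commute)

interpretation mpoly: commuting_actions
  "\<lambda>v::'v::{finite,linorder}. (*) (monomial (mono_var v) :: ('v, 'k::comm_ring_1) mpoly)"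
  by unfold_locales (auto simp: algebra_simps)

abbreviation fcoeff :: "('v, 'k::comm_ring_1) fmod \<Rightarrow> nat \<Rightarrow> 'v monom \<Rightarrow> 'k" where
  "fcoeff x k m \<equiv> lookup (lookup x k) m"

lemma fmod_eqI: "(\<And>k m. fcoeff x k m = fcoeff y k m) \<Longrightarrow> x = y"
  by (intro poly_mapping_eqI)

lemma fcoeff_sum: "fcoeff (sum f A) k m = (\<Sum>a\<in>A. fcoeff (f a) k m)"
  by (simp add: lookup_sum)

definition in_degree :: "nat \<Rightarrow> ('v set \<Rightarrow> 'a::zero) \<Rightarrow> bool" where
  "in_degree a c \<longleftrightarrow> (\<forall>M. card M \<noteq> a \<longrightarrow> c M = 0)"

lemma kdiff_in_degree:
  fixes c :: "'v::{finite,linorder} set \<Rightarrow> 'a::ab_group_add"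
  assumes "commuting_actions X" "in_degree (Suc a) c"
  shows "in_degree a (kdiff X c)"
proof -
  interpret commuting_actions X by fact
  have "contract i c M = 0" if "card M \<noteq> a" for i M
    using that assms(2) by (simp add: contract_def in_degree_def)
  then show ?thesis
    by (simp add: in_degree_def kdiff_def)
qed

lemma kdiff_restrict:
  fixes c :: "'v::{finite,linorder} set \<Rightarrow> 'a::ab_group_add"
  assumes "card M = a"
  shows "kdiff X (\<lambda>M. if card M = Suc a then c M else 0) M = kdiff X c M"
  using assms by (simp add: kdiff_def contract_def cong: if_cong)

lemma kdiff_const_coeff:
  fixes c :: "'v::{finite,linorder} set \<Rightarrow> ('v, 'k::comm_ring_1) fmod"
  shows "fcoeff (kdiff fvar c M) k 0 = 0"
  by (simp add: kdiff_def fcoeff_sum)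

text \<open>After the reduction by all variables only a constant multiple of \<open>e\<^bsub>{}\<^esub>\<close> is left of a cycle, and
  the condition on constant terms excludes that. Cycles of positive homological degree satisfy it
  trivially.\<close>

lemma koszul_exact:
  fixes c :: "'v::{finite,linorder} set \<Rightarrow> ('v, 'k::comm_ring_1) fmod"
  assumes cycle: "\<And>M. kdiff fvar c M = 0"
    and const: "\<And>k. fcoeff (c {}) k 0 = 0"
    and deg: "in_degree a c"
  shows "\<exists>v. in_degree (Suc a) v \<and> (\<forall>M. c M = kdiff fvar v M)"
proof -
  obtain v c' where c: "\<And>M. c M = kdiff fvar v M + c' M"
    and c': "\<And>p M. (p \<in> M \<longrightarrow> c' M = 0) \<and> fquot p (c' M) = 0"
    using fmod.cycle_reduction[OF cycle, of UNIV] by blast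
  have "c' M = 0" for M
  proof (cases "M = {}")
    case True
    have "fcoeff (c' {}) k m = 0" for k m
    proof (cases "m = 0")
      case True
      then show ?thesis
        using const[of k] by (simp add: c lookup_add kdiff_const_coeff)
    next
      case False
      then obtain p n where m: "m = mono_var p + n"
        by (rule monom_neq_zeroE)
      have "fcoeff (fquot p (c' {})) k n = 0"
        using c' by simp
      then show ?thesis by (simp add: m)
    qed
    then show ?thesis using True by (intro fmod_eqI) simp
  next
    case False
    then show ?thesis using c' by blast
  qed
  then have v: "c M = kdiff fvar v M" for M
    by (simp add: c)
  define w where "w M = (if card M = Suc a then v M else 0)" for M
  have "c M = kdiff fvar w M" for M
  proof (cases "card M = a")
    case True
    then show ?thesis
      using kdiff_restrict[of M a fvar v] by (simp add: w_def[abs_def] v)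
  next
    case False
    have "in_degree a (kdiff fvar w)"
      by (rule kdiff_in_degree) (auto simp: in_degree_def w_def fmod.commuting_actions_axioms)
    then show ?thesis
      using False deg by (simp add: in_degree_def)
  qed
  then show ?thesis
    by (intro exI[of _ w]) (simp add: in_degree_def w_def)
qed

section \<open>Homogeneous elements and graded maps\<close>

interpretation pmod: module "(*) :: ('v, 'k::comm_ring_1) mpoly \<Rightarrow> _"
  by (rule module_mpoly)

lemma fmod_hom_additive: "module_hom fscale S f \<Longrightarrow> Modules.additive f"
  by (simp add: module_hom.add Modules.additive_def)

lemma fmod_expansion:
  assumes "finite A" "keys x \<subseteq> A"
  shows "x = (\<Sum>k\<in>A. fscale (lookup x k) (single k 1))"
proof (rule poly_mapping_eqI)
  fix l
  have "(\<Sum>k\<in>A. lookup x k * (if k = l then 1 else 0)) =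
      (if l \<in> A then lookup x l else 0)"
    using assms(1) by (simp add: if_distrib[of "\<lambda>t. _ * t"] cong: if_cong)
  then show "lookup x l = lookup
      (\<Sum>k\<in>A. fscale (lookup x k) (single k 1)) l"
    using assms(2) by (auto simp: lookup_sum lookup_single when_def in_keys_iff)
qed

lemma fmod_hom_expansion:
  assumes "module_hom fscale S f"
  shows "f x = (\<Sum>k\<in>keys x. S (lookup x k) (f (single k 1)))"
proof -
  have "f x = f (\<Sum>k\<in>keys x. fscale (lookup x k) (single k 1))"
    using fmod_expansion[of "keys x" x] by simp
  also have "\<dots> = (\<Sum>k\<in>keys x. S (lookup x k) (f (single k 1)))"
    by (simp add: additive.sum[OF fmod_hom_additive[OF assms]] module_hom.scale[OF assms])
  finally show ?thesis .
qed

lemma fmod_hom_eq_on_free: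
  assumes "module_hom fscale S f" "module_hom fscale S g" "x \<in> free_on B"
    and "\<And>k. k \<in> B \<Longrightarrow> f (single k 1) = g (single k 1)"
  shows "f x = g x"
  unfolding fmod_hom_expansion[OF assms(1), of x] fmod_hom_expansion[OF assms(2), of x]
  using assms(3,4) by (intro sum.cong) (auto simp: free_on_def)

definition linear_extension ::
  "(nat \<Rightarrow> ('v, 'k::comm_ring_1) fmod) \<Rightarrow> ('v, 'k) fmod \<Rightarrow> ('v, 'k) fmod" where
  "linear_extension g x = (\<Sum>k\<in>keys x. fscale (lookup x k) (g k))"

lemma linear_extension_superset:
  assumes "finite A" "keys x \<subseteq> A"
  shows "linear_extension g x = (\<Sum>k\<in>A. fscale (lookup x k) (g k))"
  unfolding linear_extension_def using assms
  by (intro sum.mono_neutral_left) (auto simp: in_keys_iff)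

lemma linear_extension_hom:
  fixes g :: "nat \<Rightarrow> ('v, 'k::comm_ring_1) fmod"
  shows "module_hom fscale fscale (linear_extension g)"
proof
  fix x y :: "('v, 'k) fmod" and r
  have "linear_extension g (x + y) = (\<Sum>k\<in>keys x \<union> keys y.
      fscale (lookup (x + y) k) (g k))"
    by (intro linear_extension_superset) (auto dest: subsetD[OF Poly_Mapping.keys_add])
  moreover have "linear_extension g x = (\<Sum>k\<in>keys x \<union> keys y.
      fscale (lookup x k) (g k))"
    "linear_extension g y = (\<Sum>k\<in>keys x \<union> keys y.
      fscale (lookup y k) (g k))"
    by (auto intro!: linear_extension_superset)
  ultimately show "linear_extension g (x + y) = linear_extension g x + linear_extension g y"
    by (simp add: lookup_add fmod.scale_left_distrib sum.distrib)
  have "linear_extension g (fscale r x) = (\<Sum>k\<in>keys x.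
      fscale (lookup (fscale r x) k) (g k))"
    by (intro linear_extension_superset) (auto simp: in_keys_iff)
  then show "linear_extension g (fscale r x) = fscale r (linear_extension g x)"
    by (simp add: linear_extension_def fmod.scale_sum_right)
qed

lemma linear_extension_single [simp]: "linear_extension g (single k 1) = g k"
  by (simp add: linear_extension_superset[of "{k}"])

lemma free_on_iff: "x \<in> free_on B \<longleftrightarrow> (\<forall>k. k \<notin> B \<longrightarrow> lookup x k = 0)"
  by (auto simp: free_on_def in_keys_iff)

lemma free_on_empty: "y \<in> free_on {} \<longleftrightarrow> y = 0"
  by (auto simp: free_on_iff intro: poly_mapping_eqI)

lemma subspace_free_on: "fmod.subspace (free_on B)"
  by (rule fmod.subspaceI) (auto simp: free_on_iff lookup_add)

lemma free_on_single [simp]: "k \<in> B \<Longrightarrow> single k r \<in> free_on B"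
  by (auto simp: free_on_def in_keys_iff lookup_single when_def)

lemma fmod_hom_maps_free:
  assumes "module_hom fscale fscale f" "fmod.subspace P"
    and "\<And>k. k \<in> B \<Longrightarrow> f (single k 1) \<in> P" "x \<in> free_on B"
  shows "f x \<in> P"
  unfolding fmod_hom_expansion[OF assms(1), of x]
  using assms by (intro fmod.subspace_sum fmod.subspace_scale) (auto simp: free_on_def)

text \<open>The basis vector with index \<open>k\<close> has degree \<open>s k\<close>.\<close>

definition homogeneous :: "(nat \<Rightarrow> nat) \<Rightarrow> nat \<Rightarrow> ('v, 'k::comm_ring_1) fmod \<Rightarrow> bool" where
  "homogeneous s n x \<longleftrightarrow> (\<forall>k m. fcoeff x k m \<noteq> 0 \<longrightarrow> mdeg m + s k = n)"

lemma homogeneousD: "homogeneous s n x \<Longrightarrow> fcoeff x k m \<noteq> 0 \<Longrightarrow> mdeg m + s k = n"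
  by (simp add: homogeneous_def)

definition component :: "(nat \<Rightarrow> nat) \<Rightarrow> nat \<Rightarrow> ('v, 'k::comm_ring_1) fmod \<Rightarrow> ('v, 'k) fmod" where
  "component s n x = Poly_Mapping.mapp (\<lambda>k. Poly_Mapping.mapp
     (\<lambda>m c. if mdeg m + s k = n then c else 0)) x"

lemma fcoeff_component [simp]:
  "fcoeff (component s n x) k m = (if mdeg m + s k = n then fcoeff x k m else 0)"
  by (auto simp: component_def lookup_mapp when_def in_keys_iff)

lemma homogeneous_component [simp]: "homogeneous s n (component s n x)"
  by (simp add: homogeneous_def)

lemma component_homogeneous: "homogeneous s n x \<Longrightarrow> component s n x = x"
  by (rule fmod_eqI) (auto simp: homogeneous_def)

lemma component_other: "homogeneous s n x \<Longrightarrow> n \<noteq> n' \<Longrightarrow> component s n' x = 0"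
  by (rule fmod_eqI) (auto simp: homogeneous_def)

lemma component_sum: "component s n (sum f A) = (\<Sum>a\<in>A. component s n (f a))"
  by (rule fmod_eqI) (simp add: fcoeff_sum)

lemma component_free_on: "x \<in> free_on B \<Longrightarrow> component s n x \<in> free_on B"
  by (auto simp: free_on_def component_def dest: subsetD[OF keys_mapp_subset])

lemma component_decomposition:
  "\<exists>N. finite N \<and> x = (\<Sum>n\<in>N. component s n x) \<and> (\<forall>n. n \<notin> N \<longrightarrow> component s n x = 0)"
proof -
  define N where "N = (\<Union>k\<in>keys x. (\<lambda>m. mdeg m + s k) ` keys (lookup x k))"
  have fin: "finite N" by (simp add: N_def)
  have N: "mdeg m + s k \<in> N" if "fcoeff x k m \<noteq> 0" for k m
    using that by (force simp: N_def in_keys_iff)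
  have "x = (\<Sum>n\<in>N. component s n x)"
    using fin N by (intro fmod_eqI) (auto simp: fcoeff_sum)
  moreover have "component s n x = 0" if "n \<notin> N" for n
    using N that by (intro fmod_eqI) auto
  ultimately show ?thesis using fin by blast
qed

definition graded_hom ::
  "nat set \<Rightarrow> (nat \<Rightarrow> nat) \<Rightarrow> nat set \<Rightarrow> (nat \<Rightarrow> nat) \<Rightarrow> nat \<Rightarrow>
     (('v, 'k::comm_ring_1) fmod \<Rightarrow> ('v, 'k) fmod) \<Rightarrow> bool" where
  "graded_hom B s B' s' t f \<longleftrightarrow> module_hom fscale fscale f \<and>
     (\<forall>k\<in>B. f (single k 1) \<in> free_on B' \<and>
        homogeneous s' (s k + t) (f (single k 1)))"

lemma graded_hom_maps:
  "graded_hom B s B' s' t f \<Longrightarrow> x \<in> free_on B \<Longrightarrow> f x \<in> free_on B'"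
  using fmod_hom_maps_free[OF _ subspace_free_on] unfolding graded_hom_def by blast

lemma graded_hom_homogeneous:
  fixes f :: "('v::finite, 'k::comm_ring_1) fmod \<Rightarrow> ('v, 'k) fmod"
  assumes f: "graded_hom B s B' s' t f" and x: "x \<in> free_on B" "homogeneous s n x"
  shows "homogeneous s' (n + t) (f x)"
  unfolding homogeneous_def
proof (intro allI impI)
  fix l m
  assume nz: "fcoeff (f x) l m \<noteq> 0"
  have "f x = (\<Sum>k\<in>keys x. fscale (lookup x k) (f (single k 1)))"
    using f fmod_hom_expansion unfolding graded_hom_def by blast
  then have "fcoeff (f x) l m = (\<Sum>k\<in>keys x. lookup
      (lookup x k * lookup (f (single k 1)) l) m)"
    by (simp add: lookup_sum)
  with nz obtain k where k: "k \<in> keys x"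
    and "lookup (lookup x k * lookup (f (single k 1)) l) m \<noteq> 0"
    by (metis (no_types, lifting) sum.neutral)
  then have "m \<in> keys (lookup x k * lookup (f (single k 1)) l)"
    by (simp add: in_keys_iff)
  then obtain m1 m2 where m: "m = m1 + m2" "fcoeff x k m1 \<noteq> 0"
    "fcoeff (f (single k 1)) l m2 \<noteq> 0"
    using keys_mult by (force simp: in_keys_iff)
  have "mdeg m1 + s k = n" "mdeg m2 + s' l = s k + t"
    using f x k m unfolding graded_hom_def homogeneous_def free_on_def by blast+
  then show "mdeg m + s' l = n + t" by (simp add: m)
qed

text \<open>This is how homogeneous preimages are found: a component of a preimage is a preimage of the
  component.\<close>

lemma graded_hom_component:
  fixes f :: "('v::finite, 'k::comm_ring_1) fmod \<Rightarrow> ('v, 'k) fmod"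
  assumes f: "graded_hom B s B' s' t f" and x: "x \<in> free_on B"
  shows "f (component s n x) = component s' (n + t) (f x)"
proof -
  obtain N where N: "finite N" "x = (\<Sum>n\<in>N. component s n x)" "\<And>n. n \<notin> N \<Longrightarrow> component s n x = 0"
    using component_decomposition[of x s] by blast
  have add: "Modules.additive f"
    using f fmod_hom_additive by (auto simp: graded_hom_def)
  have "component s' (n + t) (f x) = component s' (n + t) (\<Sum>n'\<in>N. f (component s n' x))"
    using N(2) additive.sum[OF add] by metis
  also have "\<dots> = (\<Sum>n'\<in>N. component s' (n + t) (f (component s n' x)))"
    by (rule component_sum)
  also have "\<dots> = (\<Sum>n'\<in>N. if n' = n then f (component s n x) else 0)"
  proof (rule sum.cong[OF refl])
    fix n'
    have "homogeneous s' (n' + t) (f (component s n' x))"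
      by (rule graded_hom_homogeneous[OF f]) (simp_all add: component_free_on x)
    then show "component s' (n + t) (f (component s n' x)) = (if n' = n then f (component s n x) else 0)"
      using component_homogeneous component_other by force
  qed
  also have "\<dots> = f (component s n x)"
    using N additive.zero[OF add] by auto
  finally show ?thesis by simp
qed

section \<open>Resolutions\<close>

lemma resolution_hom: "resolution I P d \<epsilon> \<Longrightarrow> module_hom fscale fscale (d i)"
  and resolution_augmentation_hom: "resolution I P d \<epsilon> \<Longrightarrow> module_hom fscale (*) \<epsilon>"
  and resolution_onto: "resolution I P d \<epsilon> \<Longrightarrow> \<exists>x\<in>P 0. r - \<epsilon> x \<in> I"
  and resolution_exact_0: "resolution I P d \<epsilon> \<Longrightarrow> x \<in> d 0 ` P 1 \<longleftrightarrow> x \<in> P 0 \<and> \<epsilon> x \<in> I"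
  and resolution_exact: "resolution I P d \<epsilon> \<Longrightarrow>
    x \<in> d (Suc i) ` P (Suc (Suc i)) \<longleftrightarrow> x \<in> P (Suc i) \<and> d i x = 0"
  by (auto simp: resolution_def)

lemma resolution_maps:
  assumes "resolution I P d \<epsilon>" "x \<in> P (Suc i)"
  shows "d i x \<in> P i"
proof (cases i)
  case 0
  then show ?thesis
    using assms resolution_exact_0[OF assms(1), of "d 0 x"] by (auto simp: One_nat_def)
next
  case (Suc j)
  then show ?thesis
    using assms resolution_exact[OF assms(1), of "d i x" j] by blast
qed

lemma resolution_dd: "resolution I P d \<epsilon> \<Longrightarrow> x \<in> P (Suc (Suc i)) \<Longrightarrow> d i (d (Suc i) x) = 0"
  using resolution_exact[of I P d \<epsilon>] by blast

text \<open>With a projection onto \<open>P\<close>, exactness of the Koszul complex passes from \<open>R\<^sup>(\<nat>\<^sup>)\<close> to its direct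
  summand \<open>P\<close>.\<close>

lemma direct_summand_projection:
  assumes "direct_summand (P :: ('v, 'k::comm_ring_1) fmod set)"
  shows "\<exists>\<pi>. module_hom fscale fscale \<pi> \<and> (\<forall>x. \<pi> x \<in> P) \<and> (\<forall>x\<in>P. \<pi> x = x)"
proof -
  from assms obtain Q where P: "fmod.subspace P" and Q: "fmod.subspace Q" and PQ: "P \<inter> Q = {0}"
    and sum: "\<And>x. \<exists>p\<in>P. \<exists>q\<in>Q. x = p + q"
    by (auto simp: direct_summand_def)
  have "\<forall>x. \<exists>p. p \<in> P \<and> x - p \<in> Q"
    using sum by (metis add_diff_cancel_left')
  then obtain \<pi> where \<pi>: "\<And>x. \<pi> x \<in> P" "\<And>x. x - \<pi> x \<in> Q" by metis
  have uniq: "\<pi> x = p" if "p \<in> P" "x - p \<in> Q" for x p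
  proof -
    have "\<pi> x - p = (x - p) - (x - \<pi> x)" by simp
    then have "\<pi> x - p \<in> P \<inter> Q"
      using that \<pi>[of x] fmod.subspace_diff[OF P, of "\<pi> x" p] fmod.subspace_diff[OF Q, of "x - p" "x - \<pi> x"]
      by auto
    then show ?thesis using PQ by simp
  qed
  have "module_hom fscale fscale \<pi>"
  proof
    fix x y r
    have "x + y - (\<pi> x + \<pi> y) = (x - \<pi> x) + (y - \<pi> y)" by simp
    also have "\<dots> \<in> Q"
      using \<pi> by (intro fmod.subspace_add[OF Q])
    finally show "\<pi> (x + y) = \<pi> x + \<pi> y"
      using \<pi> by (intro uniq fmod.subspace_add[OF P])
    have "fscale r x - fscale r (\<pi> x) = fscale r (x - \<pi> x)"
      by (simp add: fmod.scale_right_diff_distrib)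
    also have "\<dots> \<in> Q"
      using \<pi> by (intro fmod.subspace_scale[OF Q])
    finally show "\<pi> (fscale r x) = fscale r (\<pi> x)"
      using \<pi> by (intro uniq fmod.subspace_scale[OF P])
  qed
  moreover have "\<pi> x = x" if "x \<in> P" for x
    using that fmod.subspace_0[OF Q] by (intro uniq) auto
  ultimately show ?thesis using \<pi> by blast
qed

lemma direct_summand_free_on: "direct_summand (free_on B :: ('v, 'k::comm_ring_1) fmod set)"
  unfolding direct_summand_def
proof (intro conjI exI[of _ "free_on (- B)"] allI)
  show "free_on B \<inter> free_on (- B) = {0 :: ('v, 'k) fmod}"
  proof -
    have "x = 0" if "x \<in> free_on B" "x \<in> free_on (- B)" for x :: "('v, 'k) fmod"
    proof (rule poly_mapping_eqI)
      fix k
      show "lookup x k = lookup 0 k"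
        using that by (cases "k \<in> B") (auto simp: free_on_iff)
    qed
    then show ?thesis by (auto simp: free_on_iff)
  qed
  fix x :: "('v, 'k) fmod"
  define r where "r A = Poly_Mapping.mapp (\<lambda>k p. if k \<in> A then p else 0) x" for A
  have "x = r B + r (- B)"
    by (rule poly_mapping_eqI) (auto simp: r_def lookup_add lookup_mapp when_def in_keys_iff)
  moreover have "r A \<in> free_on A" for A
    by (auto simp: r_def free_on_def in_keys_iff lookup_mapp when_def split: if_splits)
  ultimately show "\<exists>p\<in>free_on B. \<exists>q\<in>free_on (- B). x = p + q" by blast
qed (rule subspace_free_on)+

lemma kdiff_closed:
  assumes "0 \<in> T" "\<And>x. x \<in> T \<Longrightarrow> - x \<in> T" "\<And>M. c M \<in> T"
    and "\<And>x y. x \<in> S \<Longrightarrow> y \<in> S \<Longrightarrow> x + y \<in> S" "\<And>i x. x \<in> T \<Longrightarrow> X i x \<in> S" "0 \<in> S"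
  shows "kdiff X c M \<in> S"
proof -
  have "contract i c M \<in> T" for i
    using assms by (simp add: contract_def signed_def)
  then have "(\<Sum>i\<in>A. X i (contract i c M)) \<in> S" for A
    using assms by (induction A rule: infinite_finite_induct) auto
  then show ?thesis
    unfolding kdiff_def .
qed

lemma kdiff_subspace:
  "fmod.subspace P \<Longrightarrow> (\<And>M. c M \<in> P) \<Longrightarrow> kdiff fvar c M \<in> P"
  by (rule kdiff_closed[where T = P])
    (auto intro: fmod.subspace_0 fmod.subspace_neg fmod.subspace_add fmod.subspace_scale)

lemma kdiff_ideal:
  "pmod.subspace I \<Longrightarrow> (\<And>M. c M \<in> I) \<Longrightarrow> kdiff (\<lambda>i. (*) (monomial (mono_var i))) c M \<in> I"
  by (rule kdiff_closed[where T = I])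
    (auto intro: pmod.subspace_0 pmod.subspace_neg pmod.subspace_add pmod.subspace_scale)

section \<open>Comparison of Koszul homology with resolutions\<close>

abbreviation pdiff :: "('v::{finite,linorder} set \<Rightarrow> ('v, 'k::comm_ring_1) mpoly) \<Rightarrow> 'v set \<Rightarrow> ('v, 'k) mpoly" where
  "pdiff \<equiv> kdiff (\<lambda>i. (*) (monomial (mono_var i)))"

text \<open>The double complex has the entries \<open>K\<^sub>a \<otimes> P\<^sub>b\<close>. The set \<open>Q a b\<close> holds the coefficients that may occur
  in this entry: everything for the bound on the length of a resolution, the elements of a fixed
  total degree for the bound on Betti numbers. The condition \<open>Q_end\<close> is what makes the chase stop,
  since \<open>K\<^sub>1 \<otimes> P \<rightarrow> K\<^sub>0 \<otimes> P\<close> hits exactly the elements without constant terms.\<close>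

locale resolution_chase =
  fixes I :: "('v::{finite,linorder}, 'k::comm_ring_1) mpoly set" and P d \<epsilon>
    and Q :: "nat \<Rightarrow> nat \<Rightarrow> ('v, 'k) fmod set" and n :: nat
  assumes res: "resolution I P d \<epsilon>" and ds: "\<And>b. direct_summand (P b)"
    and Q_P: "\<And>a b. Q a b \<subseteq> P b"
    and Q_0: "\<And>a b. 0 \<in> Q a b"
    and Q_add: "\<And>a b x y. x \<in> Q a b \<Longrightarrow> y \<in> Q a b \<Longrightarrow> x + y \<in> Q a b"
    and Q_minus: "\<And>a b x. x \<in> Q a b \<Longrightarrow> - x \<in> Q a b"
    and Q_var: "\<And>a b x i. x \<in> Q (Suc a) b \<Longrightarrow> fvar i x \<in> Q a b"
    and Q_lift: "\<And>a b x. x \<in> Q a b \<Longrightarrow> x \<in> d b ` P (Suc b) \<Longrightarrow> \<exists>w\<in>Q a (Suc b). x = d b w"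
    and Q_end: "\<And>x k. x \<in> Q 0 n \<Longrightarrow> fcoeff x k 0 = 0"
begin

text \<open>Since \<open>d\<^sub>K u = d\<^sub>P w\<close> for some \<open>w\<close> one Koszul degree lower, and \<open>d\<^sub>K w\<close> is a \<open>d\<^sub>P\<close>-cycle, hence in the image
  of \<open>d\<^sub>P\<close>, induction gives \<open>w = d\<^sub>K v + d\<^sub>P y\<close>. Then \<open>u - d\<^sub>P v\<close> is a \<open>d\<^sub>K\<close>-cycle, and \<open>koszul_exact\<close>
  applies to it.\<close>

lemma chase_step:
  assumes "a + b = n" "in_degree a u" "\<And>M. u M \<in> Q a b"
    and "\<And>M. a \<noteq> 0 \<Longrightarrow> kdiff fvar u M \<in> d b ` P (Suc b)"
  shows "\<exists>v w. in_degree (Suc a) v \<and> (\<forall>M. w M \<in> P (Suc b)) \<and> (\<forall>M. u M = kdiff fvar v M + d b (w M))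
           \<and> (\<forall>M. v M \<in> P b)"
  using assms
proof (induction a arbitrary: b u)
  have hom: "module_hom fscale fscale (d b)" for b
    using res by (rule resolution_hom)
  have sub: "fmod.subspace (P b)" for b
    using ds[of b] by (simp add: direct_summand_def)
  have exact: "\<exists>v. in_degree (Suc a) v \<and> (\<forall>M. c M = kdiff fvar v M) \<and> (\<forall>M. v M \<in> P b)"
    if "\<And>M. kdiff fvar c M = 0" "\<And>k. fcoeff (c {}) k 0 = 0" "in_degree a c" "\<And>M. c M \<in> P b"
    for c :: "'v set \<Rightarrow> ('v, 'k) fmod" and a b
  proof -
    obtain \<pi> where \<pi>: "module_hom fscale fscale \<pi>" "\<And>x. \<pi> x \<in> P b" "\<And>x. x \<in> P b \<Longrightarrow> \<pi> x = x"
      using direct_summand_projection[OF ds[of b]] by blast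
    have cP: "\<pi> (c M) = c M" for M
      using that(4) by (rule \<pi>(3))
    from koszul_exact[OF that(1-3)]
    obtain v where v: "in_degree (Suc a) v" "\<And>M. c M = kdiff fvar v M"
      by blast
    have "kdiff fvar (\<lambda>M. \<pi> (v M)) M = \<pi> (kdiff fvar v M)" for M
      by (rule kdiff_intertwine) (use \<pi>(1) fmod_hom_additive module_hom.scale in blast)+
    then have "c M = kdiff fvar (\<lambda>M. \<pi> (v M)) M" for M
      using v(2)[of M] cP[of M] by simp
    moreover have "in_degree (Suc a) (\<lambda>M. \<pi> (v M))"
      using v(1) module_hom.zero[OF \<pi>(1)] by (simp add: in_degree_def)
    ultimately show ?thesis
      using \<pi>(2) by (intro exI[of _ "\<lambda>M. \<pi> (v M)"]) blast
  qed
  {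
    case 0
    have "M \<noteq> {} \<Longrightarrow> u M = 0" for M
      using 0(2) by (simp add: in_degree_def)
    then have "contract i u M = 0" for i M
      by (simp add: contract_def)
    then have "kdiff fvar u M = 0" for M
      by (simp add: kdiff_def)
    moreover have "fcoeff (u {}) k 0 = 0" for k
      using Q_end[of "u {}" k] 0(1) 0(3)[of "{}"] by simp
    moreover have "u M \<in> P b" for M
      using 0(3) Q_P by blast
    ultimately obtain v where "in_degree (Suc 0) v" "\<And>M. u M = kdiff fvar v M" "\<And>M. v M \<in> P b"
      using exact[of u 0 b] 0(2) by blast
    then show ?case
      using fmod.subspace_0[OF sub] module_hom.zero[OF hom]
      by (intro exI[of _ v] exI[of _ "\<lambda>M. 0"]) simp
  next
    case (Suc a)
    have kQ: "kdiff fvar u M \<in> Q a b" for M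
      by (rule kdiff_closed[where T = "Q (Suc a) b"])
        (use Q_0 Q_minus Suc.prems(3) Q_add Q_var in blast)+
    have "\<exists>w\<in>Q a (Suc b). kdiff fvar u M = d b w" for M
      by (rule Q_lift[OF kQ Suc.prems(4)]) simp
    then obtain w' where w': "\<And>M. w' M \<in> Q a (Suc b)" "\<And>M. kdiff fvar u M = d b (w' M)"
      by metis
    define w where "w M = (if card M = a then w' M else 0)" for M
    have wQ: "w M \<in> Q a (Suc b)" for M
      using w' Q_0 by (simp add: w_def)
    have dw: "kdiff fvar u M = d b (w M)" for M
      using w'(2)[of M] kdiff_in_degree[OF fmod.commuting_actions_axioms Suc.prems(2)]
        module_hom.zero[OF hom]
      by (cases "card M = a") (simp_all add: w_def in_degree_def)
    have inter: "kdiff fvar (\<lambda>M. d b (c M)) M = d b (kdiff fvar c M)" for b c M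
      by (rule kdiff_intertwine) (use hom fmod_hom_additive module_hom.scale in blast)+
    have "kdiff fvar w M \<in> d (Suc b) ` P (Suc (Suc b))" for M
    proof -
      have "d b (kdiff fvar w M) = kdiff fvar (kdiff fvar u) M"
        unfolding inter[symmetric] dw[symmetric, abs_def] ..
      also have "\<dots> = 0" by (rule fmod.kdiff_kdiff)
      finally have "d b (kdiff fvar w M) = 0" .
      moreover have "kdiff fvar w M \<in> P (Suc b)"
        by (rule kdiff_subspace[OF sub]) (rule subsetD[OF Q_P wQ])
      ultimately show ?thesis
        using resolution_exact[OF res] by blast
    qed
    moreover have "in_degree a w"
      by (simp add: w_def in_degree_def)
    ultimately obtain v y where v: "in_degree (Suc a) v" "\<And>M. v M \<in> P (Suc b)"
      and y: "\<And>M. y M \<in> P (Suc (Suc b))" and vy: "\<And>M. w M = kdiff fvar v M + d (Suc b) (y M)"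
      using Suc.IH[of "Suc b" w] Suc.prems(1) wQ by auto
    have "d b (w M) = d b (kdiff fvar v M)" for M
      using vy[of M] module_hom.add[OF hom] resolution_dd[OF res y] by simp
    then have "kdiff fvar (\<lambda>M. u M - d b (v M)) M = 0" for M
      by (simp add: fmod.kdiff_diff dw inter)
    moreover have deg: "in_degree (Suc a) (\<lambda>M. u M - d b (v M))"
      using Suc.prems(2) v(1) module_hom.zero[OF hom] by (simp add: in_degree_def)
    moreover have "fcoeff (u {} - d b (v {})) k 0 = 0" for k
      using deg by (simp add: in_degree_def)
    moreover have "u M - d b (v M) \<in> P b" for M
      using Suc.prems(3) Q_P resolution_maps[OF res v(2)] fmod.subspace_diff[OF sub] by blast
    ultimately obtain z where "in_degree (Suc (Suc a)) z" "\<And>M. u M - d b (v M) = kdiff fvar z M"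
      "\<And>M. z M \<in> P b"
      using exact[of "\<lambda>M. u M - d b (v M)" "Suc a" b] by blast
    then show ?case
      using v(2) by (intro exI[of _ z] exI[of _ v]) (auto simp: algebra_simps)
  }
qed

text \<open>A cycle over \<open>R/I\<close> is lifted to \<open>K \<otimes> P\<^sub>0\<close>, decomposed there by the chase, and mapped back; the part in
  the image of \<open>P\<^sub>1\<close> disappears modulo \<open>I\<close>.\<close>

lemma cycle_is_boundary:
  assumes I: "pmod.subspace I"
    and z: "in_degree n z" "\<And>M. pdiff z M \<in> I"
    and lift: "\<And>M. \<exists>u\<in>Q n 0. z M - \<epsilon> u \<in> I"
  shows "\<exists>v. \<forall>M. z M - pdiff v M \<in> I"
proof -
  have \<epsilon>: "module_hom fscale (*) \<epsilon>"
    using res by (rule resolution_augmentation_hom)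
  have inter: "pdiff (\<lambda>M. \<epsilon> (c M)) M = \<epsilon> (kdiff fvar c M)" for c M
    by (rule kdiff_intertwine) (use \<epsilon> fmod_hom_additive module_hom.scale in blast)+
  obtain u' where u': "\<And>M. u' M \<in> Q n 0" "\<And>M. z M - \<epsilon> (u' M) \<in> I"
    using lift by metis
  define u where "u M = (if card M = n then u' M else 0)" for M
  have u: "u M \<in> Q n 0" "z M - \<epsilon> (u M) \<in> I" for M
    using u' z(1) Q_0 pmod.subspace_0[OF I] module_hom.zero[OF \<epsilon>]
    by (auto simp: u_def in_degree_def)
  have du: "kdiff fvar u M \<in> d 0 ` P (Suc 0)" for M
  proof -
    have "pdiff (\<lambda>M. z M - \<epsilon> (u M)) M \<in> I"
      by (rule kdiff_ideal[OF I u(2)])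
    then have "pdiff z M - (pdiff z M - \<epsilon> (kdiff fvar u M)) \<in> I"
      using z(2) pmod.subspace_diff[OF I] by (simp only: mpoly.kdiff_diff inter)
    then have "\<epsilon> (kdiff fvar u M) \<in> I" by simp
    moreover have "kdiff fvar u M \<in> P 0"
      by (rule kdiff_subspace) (use ds[of 0] u Q_P direct_summand_def in blast)+
    ultimately show ?thesis
      using resolution_exact_0[OF res] by (simp add: One_nat_def)
  qed
  have deg: "in_degree n u"
    by (simp add: u_def in_degree_def)
  have "\<exists>v w. in_degree (Suc n) v \<and> (\<forall>M. w M \<in> P (Suc 0)) \<and>
      (\<forall>M. u M = kdiff fvar v M + d 0 (w M)) \<and> (\<forall>M. v M \<in> P 0)"
    by (rule chase_step[OF _ deg])
      (simp_all add: u(1) du)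
  then obtain v w where "\<And>M. w M \<in> P (Suc 0)" "\<And>M. u M = kdiff fvar v M + d 0 (w M)"
    by blast
  moreover from this have "\<epsilon> (d 0 (w M)) \<in> I" for M
    using resolution_exact_0[OF res, of "d 0 (w M)"] by (auto simp: One_nat_def)
  ultimately have "\<epsilon> (u M) - pdiff (\<lambda>M. \<epsilon> (v M)) M \<in> I" for M
    by (simp add: inter module_hom.add[OF \<epsilon>])
  then have "(z M - \<epsilon> (u M)) + (\<epsilon> (u M) - pdiff (\<lambda>M. \<epsilon> (v M)) M) \<in> I" for M
    by (intro pmod.subspace_add[OF I] u(2))
  then show ?thesis
    by (intro exI[of _ "\<lambda>M. \<epsilon> (v M)"]) simp
qed

end

definition pcomponent :: "nat \<Rightarrow> ('v, 'k::comm_ring_1) mpoly \<Rightarrow> ('v, 'k) mpoly" where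
  "pcomponent n = Poly_Mapping.mapp (\<lambda>m c. if mdeg m = n then c else 0)"

lemma lookup_pcomponent [simp]:
  "lookup (pcomponent n f) m = (if mdeg m = n then lookup f m else 0)"
  by (auto simp: pcomponent_def lookup_mapp when_def in_keys_iff)

lemma pcomponent_diff: "pcomponent n (f - g) = pcomponent n f - pcomponent n g"
  by (rule poly_mapping_eqI) (simp add: lookup_minus)

lemma pcomponent_monomial_times:
  fixes f :: "('v::finite, 'k::comm_ring_1) mpoly"
  shows "pcomponent (n + mdeg w) (monomial w * f) = monomial w * pcomponent n f"
proof (rule poly_mapping_eqI)
  fix m
  show "lookup (pcomponent (n + mdeg w) (monomial w * f)) m =
    lookup (monomial w * pcomponent n f) m"
  proof (cases "\<exists>m'. m = w + m'")
    case True
    then show ?thesis by (auto simp: lookup_single_times_plus)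
  next
    case False
    then show ?thesis by (simp add: lookup_single_times_not_plus)
  qed
qed

definition graded_ideal :: "('v, 'k::comm_ring_1) mpoly set \<Rightarrow> bool" where
  "graded_ideal I \<longleftrightarrow> pmod.subspace I \<and> (\<forall>f\<in>I. \<forall>n. pcomponent n f \<in> I)"

lemma lookup_times_zero:
  fixes f g :: "('v, 'k::comm_ring_1) mpoly"
  shows "lookup (f * g) 0 = lookup f 0 * lookup g 0"
proof -
  have eq: "0 = l + q \<longleftrightarrow> q = 0 \<and> l = 0" for l q :: "'v monom"
    by (auto simp: poly_mapping_eq_iff fun_eq_iff lookup_add)
  have "(\<Sum>q. lookup g q when 0 = l + q) = (lookup g 0 when l = 0)" for l
  proof -
    have "(\<Sum>q. lookup g q when 0 = l + q) =
        (\<Sum>q. (lookup g q when l = 0) when q = 0)"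
      by (simp add: eq when_when conj_commute)
    then show ?thesis by simp
  qed
  then show ?thesis by (simp add: lookup_mult mult_when)
qed

lemma fcoeff_hom_zero:
  assumes "module_hom fscale fscale f"
  shows "fcoeff (f x) l 0 =
    (\<Sum>k\<in>keys x. fcoeff x k 0 * fcoeff (f (single k 1)) l 0)"
  by (subst fmod_hom_expansion[OF assms]) (simp add: lookup_sum lookup_times_zero)

lemma minimal_resolution:
  "minimal_graded_free_resolution I B s d \<epsilon> \<Longrightarrow> resolution I (\<lambda>i. free_on (B i)) d \<epsilon>"
  by (simp add: minimal_graded_free_resolution_def)

lemma minimal_resolution_maps:
  assumes "minimal_graded_free_resolution I B s d \<epsilon>" "x \<in> free_on (B (Suc i))"
  shows "d i x \<in> free_on (B i)"
  using resolution_maps[OF minimal_resolution[OF assms(1)] assms(2)] .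

lemma minimal_resolution_graded:
  assumes res: "minimal_graded_free_resolution I B s d \<epsilon>"
  shows "graded_hom (B (Suc i)) (s (Suc i)) (B i) (s i) 0 (d i)"
  unfolding graded_hom_def
proof (intro conjI ballI)
  show "module_hom fscale fscale (d i)"
    using resolution_hom[OF minimal_resolution[OF res]] .
  fix k
  assume k: "k \<in> B (Suc i)"
  show free: "d i (single k 1) \<in> free_on (B i)"
    using minimal_resolution_maps[OF res] k by simp
  show "homogeneous (s i) (s (Suc i) k + 0) (d i (single k 1))"
    unfolding homogeneous_def
  proof (intro allI impI)
    fix l m
    assume nz: "fcoeff (d i (single k 1)) l m \<noteq> 0"
    with free have "l \<in> B i" by (auto simp: free_on_iff)
    with nz res k show "mdeg m + s i l = s (Suc i) k + 0"
      by (simp add: minimal_graded_free_resolution_def in_keys_iff)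
  qed
qed

lemma minimal_resolution_const:
  assumes res: "minimal_graded_free_resolution I B s d \<epsilon>" and x: "x \<in> free_on (B (Suc i))"
  shows "fcoeff (d i x) l 0 = 0"
proof -
  have hom: "module_hom fscale fscale (d i)"
    using resolution_hom[OF minimal_resolution[OF res]] .
  have "fcoeff (d i (single k 1)) l 0 = 0" if "k \<in> B (Suc i)" for k
  proof (cases "l \<in> B i")
    case True
    then show ?thesis
      using res that by (simp add: minimal_graded_free_resolution_def)
  next
    case False
    then show ?thesis
      using minimal_resolution_maps[OF res free_on_single[OF that], of 1]
      by (simp add: free_on_iff)
  qed
  then show ?thesis
    unfolding fcoeff_hom_zero[OF hom, of x] using x
    by (intro sum.neutral) (auto simp: free_on_def)
qed

text \<open>The augmentation is regarded as a graded map into the free module with one basis vector of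
  degree 0, in order to use the result on graded maps.\<close>

lemma minimal_resolution_augmentation_component:
  fixes I :: "('v::finite, 'k::comm_ring_1) mpoly set"
  assumes res: "minimal_graded_free_resolution I B s d \<epsilon>" and x: "x \<in> free_on (B 0)"
  shows "\<epsilon> (component (s 0) n x) = pcomponent n (\<epsilon> x)"
proof -
  have \<epsilon>: "module_hom fscale (*) \<epsilon>"
    using resolution_augmentation_hom[OF minimal_resolution[OF res]] .
  let ?f = "\<lambda>x. single (0::nat) (\<epsilon> x)"
  have "module_hom fscale fscale ?f"
    unfolding module_hom_iff
    by (auto simp: module_hom.add[OF \<epsilon>] module_hom.scale[OF \<epsilon>] single_add lookup_single when_def
        module_fscale intro!: poly_mapping_eqI[of "single 0 _"])
  then have "graded_hom (B 0) (s 0) {0} (\<lambda>_. 0) 0 ?f"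
    using res
    by (auto simp: graded_hom_def homogeneous_def lookup_single when_def in_keys_iff
        minimal_graded_free_resolution_def)
  from graded_hom_component[OF this x, of n]
  have "single 0 (\<epsilon> (component (s 0) n x)) =
      component (\<lambda>_. 0) n (single (0::nat) (\<epsilon> x))" by simp
  then have "fcoeff (single 0 (\<epsilon> (component (s 0) n x))) 0 m =
      fcoeff (component (\<lambda>_. 0) n (single (0::nat) (\<epsilon> x))) 0 m" for m
    by simp
  then show ?thesis
    by (intro poly_mapping_eqI) simp
qed

lemma graded_hom_shift:
  assumes "graded_hom B s B' s' t f"
  shows "graded_hom B (\<lambda>k. s k + a) B' (\<lambda>k. s' k + a) t f"
  using assms unfolding graded_hom_def homogeneous_def by (metis add.assoc add.commute)

text \<open>In position \<open>n\<close> beyond the length of the resolution the chase ends in the zero module.\<close>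

lemma koszul_boundary_of_projective_resolution:
  fixes I :: "('v::{finite,linorder}, 'k::comm_ring_1) mpoly set"
  assumes I: "pmod.subspace I" and proj: "has_projective_resolution I p" and n: "p < n"
    and z: "in_degree n z" "\<And>M. pdiff z M \<in> I"
  shows "\<exists>v. \<forall>M. z M - pdiff v M \<in> I"
proof -
  from proj obtain P d \<epsilon> where res: "resolution I P d \<epsilon>" and ds: "\<And>i. direct_summand (P i)"
    and vanish: "\<And>i. i > p \<Longrightarrow> P i = {0}"
    by (auto simp: has_projective_resolution_def)
  have sub: "fmod.subspace (P b)" for b
    using ds by (simp add: direct_summand_def)
  interpret resolution_chase I P d \<epsilon> "\<lambda>a b. P b" n
    by (unfold_locales; use res ds sub in \<open>auto simp: vanish[OF n] intro: fmod.subspace_0 fmod.subspace_add fmod.subspace_neg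
      fmod.subspace_scale\<close>)
  show ?thesis
    using I z resolution_onto[OF res] by (rule cycle_is_boundary)
qed

text \<open>The chase is carried out in total degree \<open>n\<close>. It ends in elements of degree \<open>n\<close> of \<open>F\<^sub>i\<close>, which can have
  constant terms only at basis vectors of degree \<open>n\<close>.\<close>

lemma koszul_boundary_of_betti_zero:
  fixes I :: "('v::{finite,linorder}, 'k::comm_ring_1) mpoly set"
  assumes I: "graded_ideal I" and min: "minimal_graded_free_resolution I B s d \<epsilon>"
    and z: "in_degree i z" "\<And>M. pdiff z M \<in> I"
    and deg: "\<And>M m. lookup (z M) m \<noteq> 0 \<Longrightarrow> mdeg m + i = n"
    and betti: "\<And>k. k \<in> B i \<Longrightarrow> s i k \<noteq> n"
  shows "\<exists>v. \<forall>M. z M - pdiff v M \<in> I"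
proof -
  note res = minimal_resolution[OF min]
  have sub: "pmod.subspace I" using I by (simp add: graded_ideal_def)
  define Q :: "nat \<Rightarrow> nat \<Rightarrow> ('v, 'k) fmod set"
    where "Q a b = {x \<in> free_on (B b). homogeneous (\<lambda>k. s b k + a) n x}" for a b
  interpret resolution_chase I "\<lambda>b. free_on (B b)" d \<epsilon> Q i
  proof
    show "\<exists>w\<in>Q a (Suc b). x = d b w" if "x \<in> Q a b" "x \<in> d b ` free_on (B (Suc b))" for a b x
    proof -
      from that obtain w where w: "w \<in> free_on (B (Suc b))" "x = d b w" by blast
      have hom: "homogeneous (\<lambda>k. s b k + a) n x"
        using that(1) by (simp add: Q_def)
      have "d b (component (\<lambda>k. s (Suc b) k + a) n w) = x"
        using graded_hom_component[OF graded_hom_shift[OF minimal_resolution_graded[OF min]] w(1), of a n]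
          component_homogeneous[OF hom] w(2) by simp
      then show ?thesis
        using w by (intro bexI[of _ "component (\<lambda>k. s (Suc b) k + a) n w"])
          (auto simp: Q_def component_free_on)
    qed
    show "fcoeff x k 0 = 0" if "x \<in> Q 0 i" for x k
    proof (rule ccontr)
      assume nz: "fcoeff x k 0 \<noteq> 0"
      then have "k \<in> B i"
        using that by (auto simp: Q_def free_on_iff)
      moreover have "mdeg (0 :: 'v monom) + (s i k + 0) = n"
        using that nz unfolding Q_def homogeneous_def by blast
      ultimately show False
        using betti by simp
    qed
    show "fvar v x \<in> Q a b" if "x \<in> Q (Suc a) b" for a b x v
    proof -
      have "mdeg m + (s b k + a) = n" if nz: "fcoeff (fvar v x) k m \<noteq> 0" for k m
      proof -
        obtain m' where m: "m = mono_var v + m'"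
          using nz lookup_single_times_not_plus[of m "mono_var v"] by (metis lookup_fscale)
        then have "fcoeff x k m' \<noteq> 0"
          using nz by (simp add: lookup_single_times_plus)
        then have "mdeg m' + (s b k + Suc a) = n"
          using \<open>x \<in> Q (Suc a) b\<close> unfolding Q_def homogeneous_def by blast
        then show ?thesis
          unfolding m mdeg_plus mdeg_mono_var by linarith
      qed
      then show ?thesis
        using that by (auto simp: Q_def homogeneous_def intro: fmod.subspace_scale[OF subspace_free_on])
    qed
    show "x + y \<in> Q a b" if "x \<in> Q a b" "y \<in> Q a b" for x y a b
    proof -
      have "fcoeff x k m \<noteq> 0 \<or> fcoeff y k m \<noteq> 0" if "fcoeff (x + y) k m \<noteq> 0" for k m
        using that by (auto simp: lookup_add)
      then show ?thesis
        using that unfolding Q_def homogeneous_def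
        by (blast intro: fmod.subspace_add[OF subspace_free_on])
    qed
  qed (auto simp: Q_def res homogeneous_def direct_summand_free_on
      intro: fmod.subspace_0 fmod.subspace_neg subspace_free_on)
  have "\<exists>u\<in>Q i 0. z M - \<epsilon> u \<in> I" for M
  proof (cases "z M = 0")
    case True
    then show ?thesis
      using module_hom.zero[OF resolution_augmentation_hom[OF res]] fmod.subspace_0[OF subspace_free_on]
        pmod.subspace_0[OF sub]
      by (intro bexI[of _ 0]) (auto simp: Q_def homogeneous_def)
  next
    case False
    then obtain m where "lookup (z M) m \<noteq> 0"
      by (metis lookup_zero poly_mapping_eqI)
    with deg have n: "i \<le> n" by fastforce
    obtain x where x: "x \<in> free_on (B 0)" "z M - \<epsilon> x \<in> I"
      using resolution_onto[OF res] by blast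
    have "pcomponent (n - i) (z M) = z M"
      using deg n by (intro poly_mapping_eqI) fastforce
    then have "pcomponent (n - i) (z M - \<epsilon> x) = z M - \<epsilon> (component (s 0) (n - i) x)"
      by (simp add: pcomponent_diff minimal_resolution_augmentation_component[OF min x(1)])
    then have "z M - \<epsilon> (component (s 0) (n - i) x) \<in> I"
      using I x(2) unfolding graded_ideal_def by metis
    moreover have "component (s 0) (n - i) x \<in> Q i 0"
      using x n by (auto simp: Q_def component_free_on homogeneous_def)
    ultimately show ?thesis by blast
  qed
  with sub z show ?thesis by (rule cycle_is_boundary)
qed

section \<open>Uniqueness of minimal resolutions\<close>

lemma lift_graded_hom:
  fixes f :: "('v::finite, 'k::comm_ring_1) fmod \<Rightarrow> ('v, 'k) fmod"
  assumes min: "minimal_graded_free_resolution I B' s' d \<epsilon>"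
    and f: "graded_hom B s (B' i) (s' i) t f"
    and im: "\<And>k. k \<in> B \<Longrightarrow> f (single k 1) \<in> d i ` free_on (B' (Suc i))"
  shows "\<exists>h. graded_hom B s (B' (Suc i)) (s' (Suc i)) t h \<and> (\<forall>x\<in>free_on B. d i (h x) = f x)"
proof -
  note d = minimal_resolution_graded[OF min, of i]
  have "\<exists>w\<in>free_on (B' (Suc i)). homogeneous (s' (Suc i)) (s k + t) w \<and>
      d i w = f (single k 1)" if k: "k \<in> B" for k
  proof -
    obtain w where w: "w \<in> free_on (B' (Suc i))" "f (single k 1) = d i w"
      using im[OF k] by blast
    have "homogeneous (s' i) (s k + t) (d i w)"
      using f k w(2)[symmetric] by (simp add: graded_hom_def)
    then have "d i (component (s' (Suc i)) (s k + t) w) = f (single k 1)"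
      using graded_hom_component[OF d w(1), of "s k + t"] by (simp add: w(2) component_homogeneous)
    then show ?thesis
      using w(1) by (intro bexI[of _ "component (s' (Suc i)) (s k + t) w"]) (simp_all add: component_free_on)
  qed
  then obtain w where w: "\<And>k. k \<in> B \<Longrightarrow> w k \<in> free_on (B' (Suc i))"
    "\<And>k. k \<in> B \<Longrightarrow> homogeneous (s' (Suc i)) (s k + t) (w k)"
    "\<And>k. k \<in> B \<Longrightarrow> d i (w k) = f (single k 1)"
    by metis
  have hom: "module_hom fscale fscale f" "module_hom fscale fscale (d i)"
    using f d by (auto simp: graded_hom_def)
  have "module_hom fscale fscale (\<lambda>x. d i (linear_extension w x))"
    using hom(2) linear_extension_hom[of w] unfolding module_hom_iff by auto
  then have "d i (linear_extension w x) = f x" if "x \<in> free_on B" for x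
    by (rule fmod_hom_eq_on_free[OF _ hom(1) that]) (simp add: w(3))
  moreover have "graded_hom B s (B' (Suc i)) (s' (Suc i)) t (linear_extension w)"
    using w by (simp add: graded_hom_def linear_extension_hom)
  ultimately show ?thesis by blast
qed

lemma graded_hom_hom: "graded_hom B s B' s' t f \<Longrightarrow> module_hom fscale fscale f"
  by (simp add: graded_hom_def)

lemma graded_hom_zero: "graded_hom B s B' s' t f \<Longrightarrow> f 0 = 0"
  by (rule module_hom.zero[OF graded_hom_hom])

lemma graded_hom_compose:
  fixes f :: "('v::finite, 'k::comm_ring_1) fmod \<Rightarrow> ('v, 'k) fmod"
  assumes f: "graded_hom B s B' s' t f" and g: "graded_hom B' s' B'' s'' t' g"
  shows "graded_hom B s B'' s'' (t + t') (\<lambda>x. g (f x))"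
proof -
  have "module_hom fscale fscale (\<lambda>x. g (f x))"
    using f g unfolding graded_hom_def module_hom_iff by simp
  moreover have "g (f (single k 1)) \<in> free_on B''" if "k \<in> B" for k
    using that f graded_hom_maps[OF g] by (simp add: graded_hom_def)
  moreover have "homogeneous s'' (s k + t + t') (g (f (single k 1)))" if "k \<in> B" for k
    by (rule graded_hom_homogeneous[OF g]) (use f that in \<open>auto simp: graded_hom_def\<close>)
  ultimately show ?thesis
    by (simp add: graded_hom_def add.assoc)
qed

lemma homogeneous_diff:
  assumes "homogeneous s n x" "homogeneous s n y"
  shows "homogeneous s n (x - y)"
  unfolding homogeneous_def
proof (intro allI impI)
  fix k m
  assume "fcoeff (x - y) k m \<noteq> 0"
  then have "fcoeff x k m \<noteq> 0 \<or> fcoeff y k m \<noteq> 0"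
    by (auto simp: lookup_minus)
  with assms show "mdeg m + s k = n" by (auto simp: homogeneous_def)
qed

lemma graded_hom_diff:
  assumes f: "graded_hom B s B' s' t f" and g: "graded_hom B s B' s' t g"
  shows "graded_hom B s B' s' t (\<lambda>x. f x - g x)"
proof -
  have "module_hom fscale fscale (\<lambda>x. f x - g x)"
    using f g unfolding graded_hom_def module_hom_iff
    by (simp add: fmod.scale_right_diff_distrib)
  then show ?thesis
    using f g unfolding graded_hom_def
    by (auto intro: homogeneous_diff fmod.subspace_diff[OF subspace_free_on])
qed

text \<open>The comparison map covers multiplication by a monomial \<open>w\<close>: for \<open>w = 1\<close> this is the usual
  comparison of two resolutions, other \<open>w\<close> are needed for mapping cones.\<close>

lemma comparison_map:
  fixes I I' :: "('v::finite, 'k::comm_ring_1) mpoly set"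
  assumes min: "minimal_graded_free_resolution I B s d \<epsilon>"
    and min': "minimal_graded_free_resolution I' B' s' d' \<epsilon>'"
    and I': "graded_ideal I'" and w: "\<And>r. r \<in> I \<Longrightarrow> monomial w * r \<in> I'"
  shows "\<exists>f. (\<forall>i. graded_hom (B i) (s i) (B' i) (s' i) (mdeg w) (f i)) \<and>
     (\<forall>x\<in>free_on (B 0). \<epsilon>' (f 0 x) - monomial w * \<epsilon> x \<in> I') \<and>
     (\<forall>i. \<forall>x\<in>free_on (B (Suc i)). d' i (f (Suc i) x) = f i (d i x))"
proof -
  note res = minimal_resolution[OF min] and res' = minimal_resolution[OF min']
  note \<epsilon> = resolution_augmentation_hom[OF res] and \<epsilon>' = resolution_augmentation_hom[OF res']
  have sub: "pmod.subspace I'" using I' by (simp add: graded_ideal_def)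
  have "\<exists>y\<in>free_on (B' 0). homogeneous (s' 0) (s 0 k + mdeg w) y \<and>
      \<epsilon>' y - monomial w * \<epsilon> (single k 1) \<in> I'" if k: "k \<in> B 0" for k
  proof -
    let ?e = "\<epsilon> (single k 1)"
    obtain y where y: "y \<in> free_on (B' 0)" "monomial w * ?e - \<epsilon>' y \<in> I'"
      using resolution_onto[OF res'] by blast
    have "pcomponent (s 0 k) ?e = ?e"
    proof (rule poly_mapping_eqI)
      fix m
      show "lookup (pcomponent (s 0 k) ?e) m = lookup ?e m"
        using min k by (cases "m \<in> keys ?e")
          (auto simp: minimal_graded_free_resolution_def in_keys_iff)
    qed
    then have "pcomponent (s 0 k + mdeg w) (monomial w * ?e) = monomial w * ?e"
      by (simp add: pcomponent_monomial_times)
    then have "pcomponent (s 0 k + mdeg w) (monomial w * ?e - \<epsilon>' y) =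
        monomial w * ?e - \<epsilon>' (component (s' 0) (s 0 k + mdeg w) y)"
      by (simp add: pcomponent_diff minimal_resolution_augmentation_component[OF min' y(1)])
    then have "monomial w * ?e - \<epsilon>' (component (s' 0) (s 0 k + mdeg w) y) \<in> I'"
      using I' y(2) unfolding graded_ideal_def by metis
    then have "\<epsilon>' (component (s' 0) (s 0 k + mdeg w) y) - monomial w * ?e \<in> I'"
      using pmod.subspace_neg[OF sub] by fastforce
    then show ?thesis
      using y(1) by (intro bexI[of _ "component (s' 0) (s 0 k + mdeg w) y"]) (simp_all add: component_free_on)
  qed
  then obtain y where y: "\<And>k. k \<in> B 0 \<Longrightarrow> y k \<in> free_on (B' 0)"
    "\<And>k. k \<in> B 0 \<Longrightarrow> homogeneous (s' 0) (s 0 k + mdeg w) (y k)"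
    "\<And>k. k \<in> B 0 \<Longrightarrow> \<epsilon>' (y k) - monomial w * \<epsilon> (single k 1) \<in> I'"
    by metis
  define f0 where "f0 = linear_extension y"
  have f0: "graded_hom (B 0) (s 0) (B' 0) (s' 0) (mdeg w) f0"
    using y by (simp add: graded_hom_def f0_def linear_extension_hom)
  have aug: "\<epsilon>' (f0 x) - monomial w * \<epsilon> x \<in> I'" if x: "x \<in> free_on (B 0)" for x
  proof -
    have 1: "module_hom fscale (*) (\<lambda>x. \<epsilon>' (f0 x) - monomial w * \<epsilon> x)"
      unfolding module_hom_iff
      by (simp add: module_fscale module_mpoly f0_def module_hom.add[OF \<epsilon>] module_hom.add[OF \<epsilon>']
          module_hom.add[OF linear_extension_hom] module_hom.scale[OF \<epsilon>] module_hom.scale[OF \<epsilon>']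
          module_hom.scale[OF linear_extension_hom] distrib_left right_diff_distrib mult.left_commute)
    show ?thesis
      unfolding fmod_hom_expansion[OF 1, of x]
      by (intro pmod.subspace_sum[OF sub] pmod.subspace_scale[OF sub])
        (use x y(3) in \<open>auto simp: f0_def free_on_def\<close>)
  qed
  \<comment> \<open>\<open>P i f\<close> contains that \<open>f\<close> preserves boundaries, which is what the next lifting step needs.\<close>
  define P where "P i f \<longleftrightarrow> graded_hom (B i) (s i) (B' i) (s' i) (mdeg w) f \<and>
     (\<forall>x\<in>d i ` free_on (B (Suc i)). f x \<in> d' i ` free_on (B' (Suc i))) \<and> (i = 0 \<longrightarrow> f = f0)" for i f
  define R where "R i f g \<longleftrightarrow> (\<forall>x\<in>free_on (B (Suc i)). d' i (g x) = f (d i x))" for i f g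
  have "\<exists>f. \<forall>i. P i (f i) \<and> R i (f i) (f (Suc i))"
  proof (rule dependent_nat_choice)
    have "f0 x \<in> d' 0 ` free_on (B' (Suc 0))" if "x \<in> d 0 ` free_on (B (Suc 0))" for x
    proof -
      have x: "x \<in> free_on (B 0)" "\<epsilon> x \<in> I"
        using that resolution_exact_0[OF res, of x] by (auto simp: One_nat_def)
      have "(\<epsilon>' (f0 x) - monomial w * \<epsilon> x) + monomial w * \<epsilon> x \<in> I'"
        by (intro pmod.subspace_add[OF sub] aug w x)
      then show ?thesis
        using resolution_exact_0[OF res', of "f0 x"] graded_hom_maps[OF f0 x(1)]
        by (simp add: One_nat_def)
    qed
    then show "\<exists>f. P 0 f" using f0 by (auto simp: P_def)
  next
    fix f i
    assume f: "P i f"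
    have "graded_hom (B (Suc i)) (s (Suc i)) (B' i) (s' i) (0 + mdeg w) (\<lambda>x. f (d i x))"
      by (rule graded_hom_compose[OF minimal_resolution_graded[OF min]]) (use f P_def in auto)
    then have "graded_hom (B (Suc i)) (s (Suc i)) (B' i) (s' i) (mdeg w) (\<lambda>x. f (d i x))"
      by simp
    from lift_graded_hom[OF min' this] f obtain g where
      g: "graded_hom (B (Suc i)) (s (Suc i)) (B' (Suc i)) (s' (Suc i)) (mdeg w) g"
      "\<And>x. x \<in> free_on (B (Suc i)) \<Longrightarrow> d' i (g x) = f (d i x)"
      by (auto simp: P_def)
    have "g x \<in> d' (Suc i) ` free_on (B' (Suc (Suc i)))"
      if "x \<in> d (Suc i) ` free_on (B (Suc (Suc i)))" for x
    proof -
      have x: "x \<in> free_on (B (Suc i))" "d i x = 0"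
        using that resolution_exact[OF res, of x] by auto
      have "f 0 = 0"
        using f by (auto simp: P_def intro: graded_hom_zero)
      then show ?thesis
        using x g resolution_exact[OF res', of "g x"] graded_hom_maps[OF g(1)] by auto
    qed
    then show "\<exists>g. P (Suc i) g \<and> R i f g"
      using g by (auto simp: P_def R_def)
  qed
  then obtain f where "\<And>i. P i (f i)" "\<And>i. R i (f i) (f (Suc i))" by blast
  moreover from this have "f 0 = f0" by (simp add: P_def)
  ultimately show ?thesis
    using aug by (intro exI[of _ f]) (auto simp: P_def R_def)
qed

text \<open>A map that lifts zero is null-homotopic, \<open>f = d h + h d\<close>, and both terms have no constant terms
  since \<open>d\<close> has none. To construct the next \<open>h\<close> it suffices to know \<open>d h = f\<close> on boundaries, so the
  induction carries only this.\<close>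

lemma null_comparison_map:
  fixes I :: "('v::finite, 'k::comm_ring_1) mpoly set"
  assumes min: "minimal_graded_free_resolution I B s d \<epsilon>"
    and f: "\<And>i. graded_hom (B i) (s i) (B i) (s i) 0 (f i)"
    and aug: "\<And>x. x \<in> free_on (B 0) \<Longrightarrow> \<epsilon> (f 0 x) \<in> I"
    and comm: "\<And>i x. x \<in> free_on (B (Suc i)) \<Longrightarrow> d i (f (Suc i) x) = f i (d i x)"
    and x: "x \<in> free_on (B i)"
  shows "fcoeff (f i x) l 0 = 0"
proof -
  note res = minimal_resolution[OF min]
  have "\<exists>h. graded_hom (B i) (s i) (B (Suc i)) (s (Suc i)) 0 h \<and>
      (\<forall>y\<in>d i ` free_on (B (Suc i)). d i (h y) = f i y) \<and>
      (\<forall>x\<in>free_on (B i). \<forall>l. fcoeff (f i x) l 0 = 0)"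
  proof (induction i)
    case 0
    have im: "f 0 x \<in> d 0 ` free_on (B (Suc 0))" if "x \<in> free_on (B 0)" for x
      using aug[OF that] graded_hom_maps[OF f that] resolution_exact_0[OF res, of "f 0 x"]
      by (simp add: One_nat_def)
    then obtain h where h: "graded_hom (B 0) (s 0) (B (Suc 0)) (s (Suc 0)) 0 h"
      "\<And>x. x \<in> free_on (B 0) \<Longrightarrow> d 0 (h x) = f 0 x"
      using lift_graded_hom[OF min f, of 0] by auto
    moreover have "y \<in> free_on (B 0)" if "y \<in> d 0 ` free_on (B (Suc 0))" for y
      using that minimal_resolution_maps[OF min] by blast
    moreover have "fcoeff (f 0 x) l 0 = 0" if "x \<in> free_on (B 0)" for x l
      using im[OF that] minimal_resolution_const[OF min] by auto
    ultimately show ?case by blast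
  next
    case (Suc i)
    then obtain h where h: "graded_hom (B i) (s i) (B (Suc i)) (s (Suc i)) 0 h"
      and dh: "\<And>y. y \<in> d i ` free_on (B (Suc i)) \<Longrightarrow> d i (h y) = f i y" by blast
    let ?g = "\<lambda>x. f (Suc i) x - h (d i x)"
    have hd: "graded_hom (B (Suc i)) (s (Suc i)) (B (Suc i)) (s (Suc i)) 0 (\<lambda>x. h (d i x))"
      using graded_hom_compose[OF minimal_resolution_graded[OF min] h] by simp
    have g: "graded_hom (B (Suc i)) (s (Suc i)) (B (Suc i)) (s (Suc i)) 0 ?g"
      by (rule graded_hom_diff[OF f hd])
    have d_diff: "d i (a - b) = d i a - d i b" for a b
      using additive.diff[OF fmod_hom_additive[OF resolution_hom[OF res]]] .
    have im: "?g x \<in> d (Suc i) ` free_on (B (Suc (Suc i)))" if "x \<in> free_on (B (Suc i))" for x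
    proof -
      have "d i (?g x) = 0"
        using that by (simp add: d_diff comm dh)
      then show ?thesis
        using graded_hom_maps[OF g that] resolution_exact[OF res, of "?g x"] by simp
    qed
    then obtain h' where h': "graded_hom (B (Suc i)) (s (Suc i)) (B (Suc (Suc i))) (s (Suc (Suc i))) 0 h'"
      "\<And>x. x \<in> free_on (B (Suc i)) \<Longrightarrow> d (Suc i) (h' x) = ?g x"
      using lift_graded_hom[OF min g] by auto
    have "d (Suc i) (h' y) = f (Suc i) y" if "y \<in> d (Suc i) ` free_on (B (Suc (Suc i)))" for y
    proof -
      have "y \<in> free_on (B (Suc i))" "d i y = 0"
        using that resolution_exact[OF res, of y] by auto
      moreover have "h 0 = 0"
        using h by (rule graded_hom_zero)
      ultimately show ?thesis using h'(2) by simp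
    qed
    moreover have "fcoeff (f (Suc i) x) l 0 = 0" if x: "x \<in> free_on (B (Suc i))" for x l
    proof -
      have "fcoeff (?g x) l 0 = 0"
        using im[OF x] minimal_resolution_const[OF min] by auto
      moreover have "fcoeff (h (d i x)) l 0 = 0"
      proof -
        have "module_hom fscale fscale h" using h by (simp add: graded_hom_def)
        then show ?thesis
          by (subst fcoeff_hom_zero) (simp_all add: minimal_resolution_const[OF min x])
      qed
      ultimately show ?thesis by (simp add: lookup_minus)
    qed
    ultimately show ?case using h'(1) by blast
  qed
  with x show ?thesis by blast
qed

text \<open>Elimination: if some entry of column \<open>l\<close> is nonzero, its row serves to clear the column, and a
  relation between the remaining rows extends to this row.\<close>

lemma nontrivial_linear_relation:
  fixes A :: "'i \<Rightarrow> 'j \<Rightarrow> 'k::field"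
  assumes "finite Y" "finite X" "card Y < card X"
  shows "\<exists>x. (\<exists>i\<in>X. x i \<noteq> 0) \<and> (\<forall>j\<in>Y. (\<Sum>i\<in>X. x i * A i j) = 0)"
  using assms
proof (induction Y arbitrary: X A rule: finite_induct)
  case empty
  then obtain i where "i \<in> X" by fastforce
  then show ?case by (intro exI[of _ "\<lambda>_. 1"]) auto
next
  case (insert l Y)
  show ?case
  proof (cases "\<forall>i\<in>X. A i l = 0")
    case True
    obtain x where x: "\<exists>i\<in>X. x i \<noteq> 0" "\<forall>j\<in>Y. (\<Sum>i\<in>X. x i * A i j) = 0"
      using insert.IH[of X A] insert.prems insert.hyps by auto
    have "(\<Sum>i\<in>X. x i * A i l) = 0"
      using True by (intro sum.neutral) simp
    with x show ?thesis by auto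
  next
    case False
    then obtain p where p: "p \<in> X" "A p l \<noteq> 0" by blast
    define A' where "A' i j = A i j - A i l / A p l * A p j" for i j
    have "card Y < card (X - {p})"
      using insert.prems insert.hyps p by (simp add: card_Diff_singleton)
    then obtain x where x: "\<exists>i\<in>X - {p}. x i \<noteq> 0" "\<And>j. j \<in> Y \<Longrightarrow> (\<Sum>i\<in>X - {p}. x i * A' i j) = 0"
      using insert.IH[of "X - {p}" A'] insert.prems by auto
    define c where "c = (\<Sum>i\<in>X - {p}. x i * A i l / A p l)"
    define x' where "x' = x(p := - c)"
    have sum: "(\<Sum>i\<in>X. x' i * A i j) = - c * A p j + (\<Sum>i\<in>X - {p}. x i * A i j)" for j
    proof -
      have "(\<Sum>i\<in>X - {p}. x' i * A i j) = (\<Sum>i\<in>X - {p}. x i * A i j)"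
        by (rule sum.cong) (auto simp: x'_def)
      then show ?thesis
        using sum.remove[OF \<open>finite X\<close> p(1), of "\<lambda>i. x' i * A i j"] by (simp add: x'_def)
    qed
    have "(\<Sum>i\<in>X - {p}. x i * A' i j) = (\<Sum>i\<in>X - {p}. x i * A i j) - c * A p j" for j
      by (simp add: A'_def c_def algebra_simps sum_subtractf sum_distrib_left)
    then have "(\<Sum>i\<in>X. x' i * A i j) = 0" if "j \<in> Y" for j
      using x(2)[OF that] by (simp add: sum)
    moreover have "c * A p l = (\<Sum>i\<in>X - {p}. x i * A i l)"
      using p(2) by (simp add: c_def sum_distrib_right)
    then have "(\<Sum>i\<in>X. x' i * A i l) = 0" by (simp add: sum)
    moreover have "\<exists>i\<in>X. x' i \<noteq> 0"
      using x(1) by (auto simp: x'_def)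
    ultimately show ?thesis by auto
  qed
qed

text \<open>Comparison maps \<open>f\<close> and \<open>g\<close> between the resolutions satisfy \<open>g f = 1\<close> up to entries without constant
  terms. As constant terms relate basis vectors of equal degree only, the matrices of constant
  terms in degree \<open>j\<close> have product 1, and the first has at least as many columns as rows.\<close>

lemma minimal_resolution_card_le:
  fixes I :: "('v::finite, 'k::field) mpoly set"
  assumes I: "graded_ideal I"
    and min: "minimal_graded_free_resolution I B s d \<epsilon>"
    and min': "minimal_graded_free_resolution I B' s' d' \<epsilon>'"
  shows "card {k\<in>B i. s i k = j} \<le> card {k\<in>B' i. s' i k = j}"
proof (rule ccontr)
  define X where "X = {k\<in>B i. s i k = j}"
  define Y where "Y = {k\<in>B' i. s' i k = j}"
  assume "\<not> card {k\<in>B i. s i k = j} \<le> card {k\<in>B' i. s' i k = j}"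
  then have card: "card Y < card X" by (simp add: X_def Y_def)
  have fin: "finite (B i)" "finite (B' i)" for i
    using min min' by (simp_all add: minimal_graded_free_resolution_def)
  have sub: "pmod.subspace I" using I by (simp add: graded_ideal_def)
  have one: "monomial 0 * r = r" for r :: "('v, 'k) mpoly" by simp
  have "\<exists>f. (\<forall>i. graded_hom (B i) (s i) (B' i) (s' i) 0 (f i)) \<and>
     (\<forall>x\<in>free_on (B 0). \<epsilon>' (f 0 x) - \<epsilon> x \<in> I) \<and>
     (\<forall>i. \<forall>x\<in>free_on (B (Suc i)). d' i (f (Suc i) x) = f i (d i x))"
    using comparison_map[OF min min' I, of 0] by (simp add: one)
  then obtain f where f: "\<And>i. graded_hom (B i) (s i) (B' i) (s' i) 0 (f i)"
    and f0: "\<And>x. x \<in> free_on (B 0) \<Longrightarrow> \<epsilon>' (f 0 x) - \<epsilon> x \<in> I"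
    and fc: "\<And>i x. x \<in> free_on (B (Suc i)) \<Longrightarrow> d' i (f (Suc i) x) = f i (d i x)"
    by metis
  have "\<exists>f. (\<forall>i. graded_hom (B' i) (s' i) (B i) (s i) 0 (f i)) \<and>
     (\<forall>x\<in>free_on (B' 0). \<epsilon> (f 0 x) - \<epsilon>' x \<in> I) \<and>
     (\<forall>i. \<forall>x\<in>free_on (B' (Suc i)). d i (f (Suc i) x) = f i (d' i x))"
    using comparison_map[OF min' min I, of 0] by (simp add: one)
  then obtain g where g: "\<And>i. graded_hom (B' i) (s' i) (B i) (s i) 0 (g i)"
    and g0: "\<And>x. x \<in> free_on (B' 0) \<Longrightarrow> \<epsilon> (g 0 x) - \<epsilon>' x \<in> I"
    and gc: "\<And>i x. x \<in> free_on (B' (Suc i)) \<Longrightarrow> d i (g (Suc i) x) = g i (d' i x)"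
    by metis
  let ?h = "\<lambda>i x. g i (f i x) - x"
  have id: "graded_hom (B i) (s i) (B i) (s i) 0 (\<lambda>x. x)" for i
    by (auto simp: graded_hom_def fmod.module_hom_ident homogeneous_def lookup_single when_def lookup_one
        split: if_splits)
  have h: "graded_hom (B i) (s i) (B i) (s i) 0 (?h i)" for i
    using graded_hom_diff[OF graded_hom_compose[OF f g, simplified] id] .
  have d_diff: "d i (a - b) = d i a - d i b" for i a b
    using additive.diff[OF fmod_hom_additive[OF resolution_hom[OF minimal_resolution[OF min]]]] .
  have \<epsilon>_diff: "\<epsilon> (a - b) = \<epsilon> a - \<epsilon> b" for a b
    using additive.diff[OF fmod_hom_additive[OF resolution_augmentation_hom[OF minimal_resolution[OF min]]]] .
  have const: "fcoeff (?h i x) l 0 = 0" if "x \<in> free_on (B i)" for x l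
  proof (rule null_comparison_map[OF min h _ _ that])
    fix x :: "('v, 'k) fmod"
    assume x: "x \<in> free_on (B 0)"
    have "(\<epsilon> (g 0 (f 0 x)) - \<epsilon>' (f 0 x)) + (\<epsilon>' (f 0 x) - \<epsilon> x) \<in> I"
      by (intro pmod.subspace_add[OF sub] g0 f0 x graded_hom_maps[OF f])
    then show "\<epsilon> (?h 0 x) \<in> I" by (simp add: \<epsilon>_diff)
  next
    fix i and x :: "('v, 'k) fmod"
    assume x: "x \<in> free_on (B (Suc i))"
    then show "d i (?h (Suc i) x) = ?h i (d i x)"
      by (simp add: d_diff gc fc graded_hom_maps[OF f])
  qed
  let ?A = "\<lambda>k l. fcoeff (f i (single k 1)) l 0"
  let ?C = "\<lambda>l k. fcoeff (g i (single l 1)) k 0"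
  have inv: "(\<Sum>l\<in>Y. ?A k l * ?C l k') = (if k = k' then 1 else 0)" if k: "k \<in> X" for k k'
  proof -
    let ?x = "f i (single k 1)"
    have kB: "k \<in> B i" and sk: "s i k = j" using k by (auto simp: X_def)
    have x: "?x \<in> free_on (B' i)" "homogeneous (s' i) j ?x"
      using f[of i] kB sk by (auto simp: graded_hom_def)
    have gh: "module_hom fscale fscale (g i)" using g by (simp add: graded_hom_def)
    have nz: "l \<in> Y" if "?A k l \<noteq> 0" for l
      using that x(1) homogeneousD[OF x(2) that] by (auto simp: Y_def free_on_iff)
    have "fcoeff (g i ?x) k' 0 = (\<Sum>l\<in>keys ?x. ?A k l * ?C l k')"
      by (rule fcoeff_hom_zero[OF gh])
    also have "\<dots> = (\<Sum>l\<in>Y. ?A k l * ?C l k')"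
      using nz fin(2)[of i]
      by (intro sum.mono_neutral_cong) (auto simp: Y_def in_keys_iff)
    finally show ?thesis
      using const[of "single k 1" k'] kB
      by (simp add: lookup_minus lookup_single when_def split: if_splits)
  qed
  have "finite X" "finite Y" using fin by (simp_all add: X_def Y_def)
  then obtain x where x: "\<exists>k\<in>X. x k \<noteq> 0" "\<And>l. l \<in> Y \<Longrightarrow> (\<Sum>k\<in>X. x k * ?A k l) = 0"
    using nontrivial_linear_relation[of Y X ?A] card by blast
  then obtain k' where k': "k' \<in> X" "x k' \<noteq> 0" by blast
  have "0 = (\<Sum>l\<in>Y. (\<Sum>k\<in>X. x k * ?A k l) * ?C l k')"
    using x(2) by simp
  also have "\<dots> = (\<Sum>k\<in>X. x k * (\<Sum>l\<in>Y. ?A k l * ?C l k'))"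
    by (simp add: sum_distrib_left sum_distrib_right mult.assoc) (rule sum.swap)
  also have "\<dots> = (\<Sum>k\<in>X. if k = k' then x k' else 0)"
    by (rule sum.cong) (auto simp: inv)
  also have "\<dots> = x k'"
    using k' \<open>finite X\<close> by simp
  finally show False using k' by simp
qed

lemma graded_betti_eq:
  fixes I :: "('v::finite, 'k::field) mpoly set"
  assumes "graded_ideal I" "minimal_graded_free_resolution I B s d \<epsilon>"
  shows "graded_betti I i j = card {k\<in>B i. s i k = j}"
  unfolding graded_betti_def
proof (rule the_equality)
  show "\<exists>B' s' d \<epsilon>. minimal_graded_free_resolution I B' s' d \<epsilon> \<and>
      card {k\<in>B i. s i k = j} = card {k\<in>B' i. s' i k = j}"
    using assms by blast
next
  fix b
  assume "\<exists>B s d \<epsilon>. minimal_graded_free_resolution I B s d \<epsilon> \<and> b = card {k\<in>B i. s i k = j}"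
  then obtain B' s' d' \<epsilon>' where min': "minimal_graded_free_resolution I B' s' d' \<epsilon>'"
    and b: "b = card {k\<in>B' i. s' i k = j}" by blast
  show "b = card {k\<in>B i. s i k = j}"
    unfolding b
    by (intro order_antisym minimal_resolution_card_le[OF assms(1) min' assms(2)]
        minimal_resolution_card_le[OF assms min'])
qed

section \<open>Monomial ideals\<close>

definition multiples :: "'v monom set \<Rightarrow> 'v monom set" where
  "multiples G = {g + h | g h. g \<in> G}"

lemma multiples_base: "g \<in> G \<Longrightarrow> g \<in> multiples G"
  unfolding multiples_def by (metis (mono_tags, lifting) CollectI add_0_right)

lemma multiples_plus: "m \<in> multiples G \<Longrightarrow> m + h \<in> multiples G"
  by (auto simp: multiples_def) (metis add.assoc)

lemma keys_single_times:
  fixes f :: "('v, 'k::comm_ring_1) mpoly"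
  shows "keys (monomial w * f) = (+) w ` keys f"
proof (intro set_eqI iffI)
  fix m
  assume "m \<in> keys (monomial w * f)"
  then have nz: "lookup (monomial w * f) m \<noteq> 0" by (simp add: in_keys_iff)
  then obtain n where "m = w + n"
    using lookup_single_times_not_plus by blast
  then show "m \<in> (+) w ` keys f"
    using nz by (auto simp: lookup_single_times_plus in_keys_iff)
next
  fix m
  assume "m \<in> (+) w ` keys f"
  then show "m \<in> keys (monomial w * f)"
    by (auto simp: in_keys_iff lookup_single_times_plus)
qed

lemma mpoly_expansion:
  "(f :: ('v, 'k::comm_ring_1) mpoly) = (\<Sum>m\<in>keys f. single m (lookup f m))"
  by (rule poly_mapping_eqI) (auto simp: lookup_sum lookup_single when_def in_keys_iff)

lemma subspace_keys_multiples:
  "pmod.subspace {f :: ('v, 'k::comm_ring_1) mpoly. keys f \<subseteq> multiples G}"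
proof (rule pmod.subspaceI)
  fix f g :: "('v, 'k) mpoly"
  assume "f \<in> {f. keys f \<subseteq> multiples G}" "g \<in> {f. keys f \<subseteq> multiples G}"
  then show "f + g \<in> {f. keys f \<subseteq> multiples G}"
    using Poly_Mapping.keys_add[of f g] by blast
next
  fix c f :: "('v, 'k) mpoly"
  assume f: "f \<in> {f. keys f \<subseteq> multiples G}"
  show "c * f \<in> {f. keys f \<subseteq> multiples G}"
  proof (intro CollectI subsetI)
    fix m
    assume "m \<in> keys (c * f)"
    then obtain a b where "m = a + b" "b \<in> keys f"
      using keys_mult[of c f] by blast
    then show "m \<in> multiples G"
      using f multiples_plus[of b G a] by (auto simp: add.commute)
  qed
qed simp

lemma monomial_ideal_iff:
  "(f :: ('v, 'k::comm_ring_1) mpoly) \<in> monomial_ideal G \<longleftrightarrow> keys f \<subseteq> multiples G"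
proof
  assume "f \<in> monomial_ideal G"
  moreover have "monomial_ideal G \<subseteq> {f :: ('v, 'k) mpoly. keys f \<subseteq> multiples G}"
    unfolding monomial_ideal_def
    by (rule pmod.span_minimal[OF _ subspace_keys_multiples])
      (auto simp: multiples_base)
  ultimately show "keys f \<subseteq> multiples G" by blast
next
  assume keys: "keys f \<subseteq> multiples G"
  have "single m c \<in> monomial_ideal G" if "m \<in> multiples G" for m and c :: 'k
  proof -
    from that obtain g h where m: "m = g + h" "g \<in> G" by (auto simp: multiples_def)
    then have "single m c = single h c * monomial g"
      by (simp add: mult_single add.commute)
    then show ?thesis
      using m(2) unfolding monomial_ideal_def
      by (simp add: pmod.span_base pmod.span_scale)
  qed
  then have "(\<Sum>m\<in>keys f. single m (lookup f m)) \<in> monomial_ideal G"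
    using keys unfolding monomial_ideal_def by (intro pmod.span_sum) blast
  then show "f \<in> monomial_ideal G"
    using mpoly_expansion[of f] by simp
qed

lemma subspace_monomial_ideal: "pmod.subspace (monomial_ideal G)"
  unfolding monomial_ideal_def by (rule pmod.subspace_span)

lemma graded_monomial_ideal: "graded_ideal (monomial_ideal G :: ('v, 'k::comm_ring_1) mpoly set)"
proof -
  have "keys (pcomponent n f) \<subseteq> keys f" for n and f :: "('v, 'k) mpoly"
    by (auto simp: in_keys_iff split: if_splits)
  then show ?thesis
    unfolding graded_ideal_def
    by (intro conjI ballI allI subspace_monomial_ideal)
      (auto simp: monomial_ideal_iff intro: order_trans)
qed

lemma monomial_times_in_monomial_ideal:
  "monomial w * (f :: ('v, 'k::comm_ring_1) mpoly) \<in> monomial_ideal G \<longleftrightarrow>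
     (\<forall>m\<in>keys f. w + m \<in> multiples G)"
  by (auto simp: monomial_ideal_iff keys_single_times)

lemma monomial_ideal_insert:
  "(f :: ('v, 'k::comm_ring_1) mpoly) \<in> monomial_ideal (insert w G) \<longleftrightarrow>
     (\<exists>q. f - monomial w * q \<in> monomial_ideal G)"
  unfolding monomial_ideal_def by (simp add: pmod.span_insert mult.commute)

section \<open>Mapping cones\<close>

text \<open>A direct sum of two free modules is realised on even and odd indices.\<close>

abbreviation even_part :: "('v, 'k::comm_ring_1) fmod \<Rightarrow> ('v, 'k) fmod" where
  "even_part \<equiv> Poly_Mapping.map_key (\<lambda>k. 2 * k)"

abbreviation odd_part :: "('v, 'k::comm_ring_1) fmod \<Rightarrow> ('v, 'k) fmod" where
  "odd_part \<equiv> Poly_Mapping.map_key (\<lambda>k. 2 * k + 1)"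

definition interleave :: "('v, 'k::comm_ring_1) fmod \<Rightarrow> ('v, 'k) fmod \<Rightarrow> ('v, 'k) fmod" where
  "interleave a b = linear_extension (\<lambda>k. single (2 * k) 1) a
     + linear_extension (\<lambda>k. single (2 * k + 1) 1) b"

lemma inj_even_odd: "inj (\<lambda>k::nat. 2 * k)" "inj (\<lambda>k::nat. 2 * k + 1)"
  by (auto intro: injI)

lemma lookup_even_part [simp]: "lookup (even_part x) k = lookup x (2 * k)"
  using inj_even_odd(1) by (simp add: map_key.rep_eq)

lemma lookup_odd_part [simp]: "lookup (odd_part x) k = lookup x (2 * k + 1)"
  using inj_even_odd(2) by (simp add: map_key.rep_eq)

lemma lookup_linear_extension_single:
  assumes "inj f"
  shows "lookup (linear_extension (\<lambda>k. single (f k) 1) a) (f k) =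
    lookup a k"
proof -
  have "lookup (linear_extension (\<lambda>k. single (f k) 1) a) (f k) =
      (\<Sum>j\<in>keys a. if j = k then lookup a k else 0)"
    unfolding linear_extension_def lookup_sum
    using assms by (intro sum.cong) (simp_all add: lookup_single when_def inj_eq)
  then show ?thesis by (simp add: in_keys_iff)
qed

lemma lookup_linear_extension_single_other:
  assumes "\<And>j. f j \<noteq> l"
  shows "lookup (linear_extension (\<lambda>k. single (f k) 1) a) l = 0"
  using assms by (simp add: linear_extension_def lookup_sum lookup_single when_def)

lemma even_part_interleave [simp]: "even_part (interleave a b) = a"
proof (rule poly_mapping_eqI)
  fix k
  have "2 * j + 1 \<noteq> 2 * k" for j :: nat by presburger
  then show "lookup (even_part (interleave a b)) k = lookup a k"
    by (simp add: interleave_def lookup_add lookup_linear_extension_single[OF inj_even_odd(1)]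
        lookup_linear_extension_single_other)
qed

lemma odd_part_interleave [simp]: "odd_part (interleave a b) = b"
proof (rule poly_mapping_eqI)
  fix k
  have "2 * j \<noteq> 2 * k + 1" for j :: nat by presburger
  then show "lookup (odd_part (interleave a b)) k = lookup b k"
    using lookup_linear_extension_single[OF inj_even_odd(2), of b k]
    by (simp add: interleave_def lookup_add lookup_linear_extension_single_other)
qed

lemma fmod_eq_iff_parts: "x = y \<longleftrightarrow> even_part x = even_part y \<and> odd_part x = odd_part y"
proof
  assume *: "even_part x = even_part y \<and> odd_part x = odd_part y"
  show "x = y"
  proof (rule poly_mapping_eqI)
    fix k
    show "lookup x k = lookup y k"
    proof (cases "even k")
      case True
      then obtain j where "k = 2 * j" by (rule evenE)
      then show ?thesis
        using * lookup_even_part[of x j] lookup_even_part[of y j] by simp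
    next
      case False
      then obtain j where "k = 2 * j + 1" by (rule oddE)
      then show ?thesis
        using * lookup_odd_part[of x j] lookup_odd_part[of y j] by simp
    qed
  qed
qed simp

lemma part_simps [simp]:
  "even_part (x + y) = even_part x + even_part y" "odd_part (x + y) = odd_part x + odd_part y"
  "even_part (fscale r x) = fscale r (even_part x)" "odd_part (fscale r x) = fscale r (odd_part x)"
  "even_part 0 = 0" "odd_part 0 = 0"
  by (rule poly_mapping_eqI, simp add: lookup_add)+

lemma part_single [simp]:
  "even_part (single (2 * k) r) = single k r"
  "odd_part (single (2 * k) r) = 0"
  "even_part (single (2 * k + 1) r) = 0"
  "odd_part (single (2 * k + 1) r) = single k r"
proof -
  have "2 * k \<noteq> 2 * j + 1" "2 * k + 1 \<noteq> 2 * j" for j :: nat by presburger+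
  then show "even_part (single (2 * k) r) = single k r"
    "odd_part (single (2 * k) r) = 0"
    "even_part (single (2 * k + 1) r) = 0"
    "odd_part (single (2 * k + 1) r) = single k r"
    by (simp_all add: poly_mapping_eq_iff fun_eq_iff lookup_single when_def)
qed

text \<open>The colon condition says \<open>I' = I : xu\<close> for the ideals \<open>I\<close>, \<open>I'\<close> generated by \<open>G\<close>, \<open>G'\<close>, and \<open>f\<close> lifts
  multiplication by \<open>u\<close> from \<open>R/I'\<close> to \<open>R/I\<close>. The cone is formed over \<open>x f\<close>, which lifts the injection
  \<open>R/I' \<rightarrow> R/I\<close> given by \<open>xu\<close>; its cokernel is the quotient by \<open>I + (xu)\<close>.\<close>

locale cone =
  fixes x :: "'v::finite" and u :: "'v monom" and G G' :: "'v monom set"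
    and B B' s s' and d d' :: "nat \<Rightarrow> ('v, 'k::comm_ring_1) fmod \<Rightarrow> ('v, 'k) fmod" and \<epsilon> \<epsilon>'
    and f :: "nat \<Rightarrow> ('v, 'k) fmod \<Rightarrow> ('v, 'k) fmod"
  assumes colon: "\<And>m. m + (mono_var x + u) \<in> multiples G \<longleftrightarrow> m \<in> multiples G'"
    and min: "minimal_graded_free_resolution (monomial_ideal G) B s d \<epsilon>"
    and min': "minimal_graded_free_resolution (monomial_ideal G') B' s' d' \<epsilon>'"
    and f: "\<And>i. graded_hom (B' i) (s' i) (B i) (s i) (mdeg u) (f i)"
    and f0: "\<And>b. b \<in> free_on (B' 0) \<Longrightarrow> \<epsilon> (f 0 b) - monomial u * \<epsilon>' b \<in> monomial_ideal G"
    and fd: "\<And>i b. b \<in> free_on (B' (Suc i)) \<Longrightarrow> d i (f (Suc i) b) = f i (d' i b)"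
begin

text \<open>In position \<open>i\<close>, the odd indices carry the basis in position \<open>i - 1\<close> of the resolution of \<open>R/I'\<close>, moved
  up by the degree of \<open>xu\<close>.\<close>

definition cone_basis :: "nat \<Rightarrow> nat set" where
  "cone_basis i = (\<lambda>k. 2 * k) ` B i \<union> (case i of 0 \<Rightarrow> {} | Suc j \<Rightarrow> (\<lambda>k. 2 * k + 1) ` B' j)"

definition cone_shift :: "nat \<Rightarrow> nat \<Rightarrow> nat" where
  "cone_shift i k = (if even k then s i (k div 2) else s' (i - 1) (k div 2) + (mdeg u + 1))"

definition cone_map :: "nat \<Rightarrow> ('v, 'k) fmod \<Rightarrow> ('v, 'k) fmod" where
  "cone_map i y = interleave (d i (even_part y) + fvar x (f i (odd_part y)))
     (case i of 0 \<Rightarrow> 0 | Suc j \<Rightarrow> - d' j (odd_part y))"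

lemmas res = minimal_resolution[OF min] and res' = minimal_resolution[OF min']

lemmas homs = resolution_hom[OF res] resolution_hom[OF res'] graded_hom_hom[OF f]
  resolution_augmentation_hom[OF res] resolution_augmentation_hom[OF res']

lemmas hom_simps = homs[THEN module_hom.add] homs[THEN module_hom.scale] homs[THEN module_hom.zero]
  homs[THEN module_hom.neg]

lemma even_part_cone_map [simp]:
  "even_part (cone_map i y) = d i (even_part y) + fvar x (f i (odd_part y))"
  by (simp add: cone_map_def)

lemma odd_part_cone_map [simp]:
  "odd_part (cone_map 0 y) = 0" "odd_part (cone_map (Suc j) y) = - d' j (odd_part y)"
  by (simp_all add: cone_map_def)

lemma free_on_parts:
  "y \<in> free_on C \<longleftrightarrow> even_part y \<in> free_on {k. 2 * k \<in> C} \<and> odd_part y \<in> free_on {k. 2 * k + 1 \<in> C}"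
proof -
  have "(\<forall>k. P k) \<longleftrightarrow> (\<forall>k. P (2 * k)) \<and> (\<forall>k. P (2 * k + 1))" for P :: "nat \<Rightarrow> bool"
    by (metis evenE oddE)
  from this[of "\<lambda>k. k \<notin> C \<longrightarrow> lookup y k = 0"] show ?thesis
    by (simp add: free_on_iff)
qed

lemma cone_basis_members:
  "{k. 2 * k \<in> cone_basis i} = B i"
  "{k. 2 * k + 1 \<in> cone_basis 0} = {}"
  "{k. 2 * k + 1 \<in> cone_basis (Suc j)} = B' j"
  by (auto simp: cone_basis_def split: nat.splits) presburger+

lemma free_on_cone_0: "y \<in> free_on (cone_basis 0) \<longleftrightarrow> even_part y \<in> free_on (B 0) \<and> odd_part y = 0"
  by (simp only: free_on_parts[of y] cone_basis_members free_on_empty)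

lemma free_on_cone_Suc:
  "y \<in> free_on (cone_basis (Suc i)) \<longleftrightarrow> even_part y \<in> free_on (B (Suc i)) \<and> odd_part y \<in> free_on (B' i)"
  by (simp only: free_on_parts[of y] cone_basis_members)

lemma cone_map_hom: "module_hom fscale fscale (cone_map i)"
proof -
  have "even_part (cone_map i (y + z)) = even_part (cone_map i y + cone_map i z)"
    "even_part (cone_map i (fscale r y)) = even_part (fscale r (cone_map i y))" for y z r
    by (simp_all add: hom_simps fmod.scale_right_distrib fmod.scale_scale mult.commute[of r])
  moreover have "odd_part (cone_map i (y + z)) = odd_part (cone_map i y + cone_map i z)"
    "odd_part (cone_map i (fscale r y)) = odd_part (fscale r (cone_map i y))" for y z r
    by (cases i; simp add: hom_simps)+
  ultimately show ?thesis
    unfolding module_hom_iff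
    by (intro conjI allI module_fscale) (rule fmod_eq_iff_parts[THEN iffD2], blast)+
qed

lemma colon_times:
  "monomial (mono_var x + u) * (q :: ('v, 'k) mpoly) \<in> monomial_ideal G \<longleftrightarrow> q \<in> monomial_ideal G'"
  unfolding monomial_times_in_monomial_ideal add.commute[of "mono_var x + u"] colon
  unfolding monomial_ideal_iff by blast

lemma f_maps: "b \<in> free_on (B' i) \<Longrightarrow> f i b \<in> free_on (B i)"
  using graded_hom_maps[OF f] .

text \<open>Injectivity of \<open>R/I' \<rightarrow> R/I\<close> enters here, in position 0; elsewhere the claim is exactness of the
  resolution of \<open>R/I'\<close>.\<close>

lemma f_kernel:
  assumes b: "b \<in> free_on (B' i)" and a: "a \<in> free_on (B (Suc i))"
    and eq: "d i a + fvar x (f i b) = 0" and cycle: "\<And>j. i = Suc j \<Longrightarrow> d' j b = 0"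
  shows "b \<in> d' i ` free_on (B' (Suc i))"
proof (cases i)
  case (Suc j)
  then show ?thesis
    using b cycle resolution_exact[OF res', of b j] by blast
next
  case 0
  let ?I = "monomial_ideal G :: ('v, 'k) mpoly set" and ?x = "monomial (mono_var x) :: ('v, 'k) mpoly"
  note I = subspace_monomial_ideal[of G]
  have "d 0 a \<in> d 0 ` free_on (B 1)"
    using a by (simp add: 0 One_nat_def)
  then have "\<epsilon> (d 0 a) \<in> ?I"
    using resolution_exact_0[OF res, of "d 0 a"] by blast
  moreover have "\<epsilon> (d 0 a) + ?x * \<epsilon> (f 0 b) = 0"
    using arg_cong[OF eq, of \<epsilon>] by (simp add: hom_simps 0)
  then have "\<epsilon> (d 0 a) = - (?x * \<epsilon> (f 0 b))"
    by (simp only: add_eq_0_iff2)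
  ultimately have 1: "?x * \<epsilon> (f 0 b) \<in> ?I"
    using pmod.subspace_neg[OF I, of "- (?x * \<epsilon> (f 0 b))"] by simp
  have "?x * (\<epsilon> (f 0 b) - monomial u * \<epsilon>' b) \<in> ?I"
    using b by (intro pmod.subspace_scale[OF I] f0) (simp add: 0)
  from pmod.subspace_diff[OF I 1 this] have "monomial (mono_var x + u) * \<epsilon>' b \<in> ?I"
    by (simp add: right_diff_distrib mult.assoc[symmetric] mult_single)
  then have "\<epsilon>' b \<in> monomial_ideal G'"
    by (simp only: colon_times)
  then show ?thesis
    using b resolution_exact_0[OF res', of b] by (simp add: 0 One_nat_def)
qed

lemma cone_exact:
  "cone_map (Suc i) ` free_on (cone_basis (Suc (Suc i))) =
     {y \<in> free_on (cone_basis (Suc i)). cone_map i y = 0}"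
proof (intro set_eqI iffI)
  fix y
  assume "y \<in> cone_map (Suc i) ` free_on (cone_basis (Suc (Suc i)))"
  then obtain z where z: "z \<in> free_on (cone_basis (Suc (Suc i)))" and y: "y = cone_map (Suc i) z"
    by blast
  define a b where "a = even_part z" and "b = odd_part z"
  have ab: "a \<in> free_on (B (Suc (Suc i)))" "b \<in> free_on (B' (Suc i))"
    using z by (simp_all add: a_def b_def free_on_cone_Suc)
  have "y \<in> free_on (cone_basis (Suc i))"
    unfolding free_on_cone_Suc y even_part_cone_map odd_part_cone_map a_def[symmetric] b_def[symmetric]
    using ab minimal_resolution_maps[OF min] minimal_resolution_maps[OF min'] f_maps
    by (intro conjI fmod.subspace_add[OF subspace_free_on] fmod.subspace_neg[OF subspace_free_on]
        fmod.subspace_scale[OF subspace_free_on])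
  moreover have "even_part (cone_map i y) = 0"
    using ab resolution_dd[OF res ab(1)]
    by (simp add: y a_def[symmetric] b_def[symmetric] hom_simps fd fmod.scale_minus_right)
  moreover have "odd_part (cone_map i y) = 0"
    using ab resolution_dd[OF res', of b] by (cases i) (simp_all add: y b_def[symmetric] hom_simps)
  ultimately show "y \<in> {y \<in> free_on (cone_basis (Suc i)). cone_map i y = 0}"
    by (simp add: fmod_eq_iff_parts[of "cone_map i y" 0])
next
  fix y
  assume "y \<in> {y \<in> free_on (cone_basis (Suc i)). cone_map i y = 0}"
  then have y: "y \<in> free_on (cone_basis (Suc i))" and zero: "cone_map i y = 0" by auto
  define a b where "a = even_part y" and "b = odd_part y"
  have ab: "a \<in> free_on (B (Suc i))" "b \<in> free_on (B' i)"
    using y by (simp_all add: a_def b_def free_on_cone_Suc)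
  have eq: "d i a + fvar x (f i b) = 0"
    using zero even_part_cone_map[of i y] by (simp add: a_def b_def)
  have "d' j b = 0" if "i = Suc j" for j
    using zero odd_part_cone_map(2)[of j y] that by (simp add: b_def)
  from f_kernel[OF ab(2,1) eq this] obtain b' where b': "b' \<in> free_on (B' (Suc i))" "b = d' i b'"
    by blast
  have "a + fvar x (f (Suc i) b') \<in> free_on (B (Suc i))"
    by (intro fmod.subspace_add[OF subspace_free_on] fmod.subspace_scale[OF subspace_free_on] ab f_maps b')
  moreover have "d i (a + fvar x (f (Suc i) b')) = 0"
    using eq by (simp add: hom_simps fd b')
  ultimately have "a + fvar x (f (Suc i) b') \<in> d (Suc i) ` free_on (B (Suc (Suc i)))"
    using resolution_exact[OF res] by blast
  then obtain a' where a': "a' \<in> free_on (B (Suc (Suc i)))" "a + fvar x (f (Suc i) b') = d (Suc i) a'"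
    by blast
  have "y = cone_map (Suc i) (interleave a' (- b'))"
    unfolding fmod_eq_iff_parts[of y]
    by (simp add: a'(2)[symmetric] hom_simps fmod.scale_minus_right b'(2)[symmetric] a_def b_def)
  moreover have "interleave a' (- b') \<in> free_on (cone_basis (Suc (Suc i)))"
    by (simp add: free_on_cone_Suc a' fmod.subspace_neg[OF subspace_free_on] b')
  ultimately show "y \<in> cone_map (Suc i) ` free_on (cone_basis (Suc (Suc i)))" by blast
qed

lemma cone_exact_0:
  "cone_map 0 ` free_on (cone_basis 1) =
     {y \<in> free_on (cone_basis 0). \<epsilon> (even_part y) \<in> monomial_ideal (insert (mono_var x + u) G)}"
proof (intro set_eqI iffI)
  let ?I = "monomial_ideal G :: ('v, 'k) mpoly set" and ?x = "monomial (mono_var x) :: ('v, 'k) mpoly"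
  let ?w = "monomial (mono_var x + u) :: ('v, 'k) mpoly"
  note I = subspace_monomial_ideal[of G]
  have xu: "?x * (monomial u * q) = ?w * q" for q
    by (simp add: mult.assoc[symmetric] mult_single)
  {
    fix y
    assume "y \<in> cone_map 0 ` free_on (cone_basis 1)"
    then obtain z where z: "z \<in> free_on (cone_basis (Suc 0))" and y: "y = cone_map 0 z"
      unfolding One_nat_def by blast
    define a b where "a = even_part z" and "b = odd_part z"
    have ab: "a \<in> free_on (B (Suc 0))" "b \<in> free_on (B' 0)"
      using z by (simp_all add: a_def b_def free_on_cone_Suc)
    have "y \<in> free_on (cone_basis 0)"
      unfolding free_on_cone_0 y even_part_cone_map odd_part_cone_map a_def[symmetric] b_def[symmetric]
      using ab minimal_resolution_maps[OF min] f_maps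
      by (intro conjI refl fmod.subspace_add[OF subspace_free_on] fmod.subspace_scale[OF subspace_free_on])
    moreover have "\<epsilon> (d 0 a) + ?x * (\<epsilon> (f 0 b) - monomial u * \<epsilon>' b) \<in> ?I"
    proof (intro pmod.subspace_add[OF I] pmod.subspace_scale[OF I] f0 ab)
      show "\<epsilon> (d 0 a) \<in> ?I"
        using resolution_exact_0[OF res, of "d 0 a"] ab(1) by (auto simp: One_nat_def)
    qed
    then have "\<epsilon> (even_part y) - ?w * \<epsilon>' b \<in> ?I"
      by (simp add: y a_def b_def hom_simps right_diff_distrib mult.assoc[symmetric] mult_single add_diff_eq)
    ultimately show "y \<in> {y \<in> free_on (cone_basis 0). \<epsilon> (even_part y) \<in> monomial_ideal (insert (mono_var x + u) G)}"
      by (auto simp: monomial_ideal_insert)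
  next
    fix y
    assume "y \<in> {y \<in> free_on (cone_basis 0). \<epsilon> (even_part y) \<in> monomial_ideal (insert (mono_var x + u) G)}"
    then obtain q where a: "even_part y \<in> free_on (B 0)" and odd: "odd_part y = 0"
      and q: "\<epsilon> (even_part y) - ?w * q \<in> ?I"
      by (auto simp: free_on_cone_0 monomial_ideal_insert)
    obtain b where b: "b \<in> free_on (B' 0)" "q - \<epsilon>' b \<in> monomial_ideal G'"
      using resolution_onto[OF res'] by blast
    define a' where "a' = even_part y - fvar x (f 0 b)"
    have "?w * (q - \<epsilon>' b) \<in> ?I"
      using b(2) by (simp only: colon_times)
    moreover have "?x * (\<epsilon> (f 0 b) - monomial u * \<epsilon>' b) \<in> ?I"
      by (intro pmod.subspace_scale[OF I] f0 b)
    ultimately have "(\<epsilon> (even_part y) - ?w * q) + ?w * (q - \<epsilon>' b) -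
        ?x * (\<epsilon> (f 0 b) - monomial u * \<epsilon>' b) \<in> ?I"
      by (intro pmod.subspace_diff[OF I] pmod.subspace_add[OF I] q)
    moreover have "\<epsilon> a' = \<epsilon> (even_part y) - ?x * \<epsilon> (f 0 b)"
      unfolding a'_def
      by (simp add: additive.diff[OF fmod_hom_additive[OF resolution_augmentation_hom[OF res]]] hom_simps)
    ultimately have "\<epsilon> a' \<in> ?I"
      by (simp add: right_diff_distrib mult.assoc[symmetric] mult_single)
    moreover have "a' \<in> free_on (B 0)"
      unfolding a'_def
      by (intro fmod.subspace_diff[OF subspace_free_on] fmod.subspace_scale[OF subspace_free_on] a f_maps b)
    ultimately have "a' \<in> d 0 ` free_on (B 1)"
      using resolution_exact_0[OF res] by blast
    then obtain a'' where a'': "a'' \<in> free_on (B (Suc 0))" "a' = d 0 a''"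
      unfolding One_nat_def by blast
    have "y = cone_map 0 (interleave a'' b)"
      unfolding fmod_eq_iff_parts[of y] by (simp add: a''(2)[symmetric] a'_def odd)
    moreover have "interleave a'' b \<in> free_on (cone_basis 1)"
      using free_on_cone_Suc[of "interleave a'' b" 0] a'' b unfolding One_nat_def[symmetric] by simp
    ultimately show "y \<in> cone_map 0 ` free_on (cone_basis 1)" by blast
  }
qed

lemma cone_resolution:
  "resolution (monomial_ideal (insert (mono_var x + u) G)) (\<lambda>i. free_on (cone_basis i)) cone_map
     (\<lambda>y. \<epsilon> (even_part y))"
  unfolding resolution_def
proof (intro conjI allI cone_map_hom cone_exact cone_exact_0)
  show "module_hom fscale (*) (\<lambda>y. \<epsilon> (even_part y))"
    by (simp add: module_hom_iff module_fscale module_mpoly hom_simps)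
  fix r
  obtain a where a: "a \<in> free_on (B 0)" "r - \<epsilon> a \<in> monomial_ideal G"
    using resolution_onto[OF res] by blast
  then have "r - \<epsilon> a - monomial (mono_var x + u) * 0 \<in> monomial_ideal G" by simp
  then have "r - \<epsilon> (even_part (interleave a 0)) \<in> monomial_ideal (insert (mono_var x + u) G)"
    unfolding monomial_ideal_insert even_part_interleave by blast
  moreover have "interleave a 0 \<in> free_on (cone_basis 0)"
    by (simp add: free_on_cone_0 a)
  ultimately show "\<exists>y\<in>free_on (cone_basis 0). r - \<epsilon> (even_part y) \<in> monomial_ideal (insert (mono_var x + u) G)"
    by blast
qed

lemma cone_augmentation_degree:
  assumes "k \<in> cone_basis 0" "m \<in> keys (\<epsilon> (even_part (single k 1)))"
  shows "mdeg m = cone_shift 0 k"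
proof -
  obtain j where "k = 2 * j" "j \<in> B 0"
    using assms(1) by (auto simp: cone_basis_def)
  then show ?thesis
    using min assms(2) by (simp add: cone_shift_def minimal_graded_free_resolution_def)
qed

text \<open>The entries that are not entries of one of the two given resolutions carry the factor \<open>x\<close>, so
  they have no constant terms either.\<close>

lemma cone_map_graded:
  assumes k: "k \<in> cone_basis (Suc i)" and nz: "fcoeff (cone_map i (single k 1)) l m \<noteq> 0"
  shows "mdeg m + cone_shift i l = cone_shift (Suc i) k" and "m \<noteq> 0"
proof -
  let ?y = "cone_map i (single k 1)"
  have *: "mdeg m + cone_shift i l = cone_shift (Suc i) k \<and> m \<noteq> 0"
  proof (cases "even k")
    case True
    then obtain j where k': "k = 2 * j" by (rule evenE)
    then have j: "j \<in> B (Suc i)"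
      using k cone_basis_members(1)[of "Suc i"] by blast
    have odd: "odd_part ?y = 0"
      by (cases i) (simp_all add: k' hom_simps)
    have even: "even_part ?y = d i (single j 1)"
      by (simp add: k' hom_simps)
    show ?thesis
    proof (cases "even l")
      case True
      then obtain l' where l: "l = 2 * l'" by (rule evenE)
      have nz': "fcoeff (d i (single j 1)) l' m \<noteq> 0"
        using nz lookup_even_part[of ?y l'] unfolding even l by simp
      have "homogeneous (s i) (s (Suc i) j + 0) (d i (single j 1))"
        using minimal_resolution_graded[OF min, of i] j by (simp add: graded_hom_def)
      from homogeneousD[OF this nz'] have "mdeg m + s i l' = s (Suc i) j" by simp
      moreover have "m \<noteq> 0"
        using nz' minimal_resolution_const[OF min free_on_single[OF j]] by metis
      ultimately show ?thesis
        by (simp add: cone_shift_def k' l)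
    next
      case False
      then obtain l' where l: "l = 2 * l' + 1" by (rule oddE)
      show ?thesis
        using nz lookup_odd_part[of ?y l'] unfolding odd l by simp
    qed
  next
    case False
    then obtain j where k': "k = 2 * j + 1" by (rule oddE)
    then have j: "j \<in> B' i"
      using k cone_basis_members(3)[of i] by blast
    have even: "even_part ?y = fvar x (f i (single j 1))"
      unfolding even_part_cone_map k' part_single by (simp add: hom_simps)
    show ?thesis
    proof (cases "even l")
      case True
      then obtain l' where l: "l = 2 * l'" by (rule evenE)
      have "lookup (monomial (mono_var x) *
          lookup (f i (single j 1)) l') m \<noteq> 0"
        using nz lookup_even_part[of ?y l'] unfolding even l lookup_fscale by simp
      then obtain m' where m: "m = mono_var x + m'"
        and nz': "fcoeff (f i (single j 1)) l' m' \<noteq> 0"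
        by (metis lookup_single_times_not_plus lookup_single_times_plus mult_1)
      have "homogeneous (s i) (s' i j + mdeg u) (f i (single j 1))"
        using f[of i] j by (simp add: graded_hom_def)
      from homogeneousD[OF this nz'] have "mdeg m' + s i l' = s' i j + mdeg u" .
      moreover have "m \<noteq> 0"
        using m mono_var_plus_iff[of m x] by auto
      ultimately show ?thesis
        by (simp add: cone_shift_def k' l m)
    next
      case False
      then obtain l' where l: "l = 2 * l' + 1" by (rule oddE)
      show ?thesis
      proof (cases i)
        case 0
        show ?thesis
          using nz lookup_odd_part[of ?y l'] unfolding 0 odd_part_cone_map l by simp
      next
        case (Suc i')
        have "odd_part ?y = - d' i' (single j 1)"
          unfolding Suc odd_part_cone_map k' part_single ..
        then have "lookup ?y l = - lookup (d' i' (single j 1)) l'"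
          using lookup_odd_part[of ?y l'] by (simp add: l)
        then have nz': "fcoeff (d' i' (single j 1)) l' m \<noteq> 0"
          using nz by simp
        have "homogeneous (s' i') (s' (Suc i') j + 0) (d' i' (single j 1))"
          using minimal_resolution_graded[OF min', of i'] j by (simp add: graded_hom_def Suc)
        from homogeneousD[OF this nz'] have "mdeg m + s' i' l' = s' (Suc i') j" by simp
        moreover have "m \<noteq> 0"
          using nz' minimal_resolution_const[OF min', of "single j 1" i'] j
          by (auto simp: Suc)
        ultimately show ?thesis
          by (simp add: cone_shift_def k' l Suc)
      qed
    qed
  qed
  then show "mdeg m + cone_shift i l = cone_shift (Suc i) k" and "m \<noteq> 0" by auto
qed

lemma cone_minimal:
  "minimal_graded_free_resolution (monomial_ideal (insert (mono_var x + u) G))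
     cone_basis cone_shift cone_map (\<lambda>y. \<epsilon> (even_part y))"
  unfolding minimal_graded_free_resolution_def
proof (intro conjI allI ballI cone_resolution)
  fix i
  have "finite (B j)" "finite (B' j)" for j
    using min min' by (simp_all add: minimal_graded_free_resolution_def)
  then show "finite (cone_basis i)"
    by (simp add: cone_basis_def split: nat.splits)
next
  fix k m
  assume "k \<in> cone_basis 0" "m \<in> keys (\<epsilon> (even_part (single k 1)))"
  then show "mdeg m = cone_shift 0 k" by (rule cone_augmentation_degree)
next
  fix i k l m
  assume "k \<in> cone_basis (Suc i)"
    "m \<in> keys (lookup (cone_map i (single k 1)) l)"
  then show "mdeg m + cone_shift i l = cone_shift (Suc i) k"
    using cone_map_graded(1) by (simp add: in_keys_iff)
next
  fix i k l
  assume "k \<in> cone_basis (Suc i)"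
  then show "fcoeff (cone_map i (single k 1)) l 0 = 0"
    using cone_map_graded(2) by blast
qed

end

text \<open>\<open>T\<close> restricts the pairs (homological degree, degree) of the basis elements of some minimal
  resolution. The type argument fixes the coefficients, which \<open>G\<close> does not determine.\<close>

definition resolved_within :: "'k::comm_ring_1 itself \<Rightarrow> 'v monom set \<Rightarrow> (nat \<times> nat) set \<Rightarrow> bool" where
  "resolved_within K G T \<longleftrightarrow> (\<exists>B s d \<epsilon>.
     minimal_graded_free_resolution (monomial_ideal G :: ('v, 'k) mpoly set) B s d \<epsilon> \<and>
     (\<forall>i. \<forall>k\<in>B i. (i, s i k) \<in> T))"

lemma resolved_within_mono: "resolved_within K G T \<Longrightarrow> T \<subseteq> T' \<Longrightarrow> resolved_within K G T'"
  unfolding resolved_within_def by blast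

text \<open>A variable that divides no generator is a nonzerodivisor modulo the ideal.\<close>

lemma mono_var_zero_iff:
  "(\<forall>g\<in>G. lookup g v = 0) \<Longrightarrow> m + mono_var v \<in> multiples G \<longleftrightarrow> m \<in> multiples G"
proof
  assume G: "\<forall>g\<in>G. lookup g v = 0" and "m + mono_var v \<in> multiples G"
  then obtain g h where gh: "m + mono_var v = g + h" "g \<in> G"
    by (auto simp: multiples_def)
  have "lookup h v = lookup (g + h) v"
    using G gh(2) by (simp add: lookup_add)
  then have "0 < lookup h v"
    by (simp add: gh(1)[symmetric] lookup_add)
  then obtain h' where "h = mono_var v + h'"
    using mono_var_plus_iff[of h v] by blast
  then have "m = g + h'"
    using gh(1) by (metis add.assoc add.commute add_right_cancel)
  then show "m \<in> multiples G"
    using gh(2) by (auto simp: multiples_def)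
qed (simp add: multiples_plus)

text \<open>As \<open>x\<close> divides no element of \<open>G\<close>, the colon ideal by \<open>xu\<close> is that by \<open>u\<close>, and the mapping cone
  applies.\<close>

lemma resolved_within_insert:
  fixes x :: "'v::finite"
  assumes x: "\<And>g. g \<in> G \<Longrightarrow> lookup g x = 0"
    and u: "\<And>m. m + u \<in> multiples G \<longleftrightarrow> m \<in> multiples G'"
    and G: "resolved_within K G T" and G': "resolved_within K G' T'"
    and T: "T \<subseteq> T''" "\<And>i j. (i, j) \<in> T' \<Longrightarrow> (Suc i, j + (mdeg u + 1)) \<in> T''"
  shows "resolved_within (K :: 'k::comm_ring_1 itself) (insert (mono_var x + u) G) T''"
proof -
  obtain B s d \<epsilon> where min: "minimal_graded_free_resolution (monomial_ideal G :: ('v, 'k) mpoly set) B s d \<epsilon>"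
    and B: "\<And>i k. k \<in> B i \<Longrightarrow> (i, s i k) \<in> T"
    using G by (auto simp: resolved_within_def)
  obtain B' s' d' \<epsilon>' where min': "minimal_graded_free_resolution (monomial_ideal G' :: ('v, 'k) mpoly set) B' s' d' \<epsilon>'"
    and B': "\<And>i k. k \<in> B' i \<Longrightarrow> (i, s' i k) \<in> T'"
    using G' by (auto simp: resolved_within_def)
  have colon: "m + (mono_var x + u) \<in> multiples G \<longleftrightarrow> m \<in> multiples G'" for m
    using mono_var_zero_iff[of G x "m + u"] x u[of m] by (simp add: add.assoc add.commute[of u])
  have "monomial u * r \<in> monomial_ideal G" if "r \<in> monomial_ideal G'" for r :: "('v, 'k) mpoly"
    using that unfolding monomial_times_in_monomial_ideal add.commute[of u] u
    unfolding monomial_ideal_iff by blast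
  then have "\<exists>f. (\<forall>i. graded_hom (B' i) (s' i) (B i) (s i) (mdeg u) (f i)) \<and>
     (\<forall>x\<in>free_on (B' 0). \<epsilon> (f 0 x) - monomial u * \<epsilon>' x \<in> monomial_ideal G) \<and>
     (\<forall>i. \<forall>x\<in>free_on (B' (Suc i)). d i (f (Suc i) x) = f i (d' i x))"
    by (rule comparison_map[OF min' min graded_monomial_ideal])
  then obtain f where f: "\<And>i. graded_hom (B' i) (s' i) (B i) (s i) (mdeg u) (f i)"
    "\<And>x. x \<in> free_on (B' 0) \<Longrightarrow> \<epsilon> (f 0 x) - monomial u * \<epsilon>' x \<in> monomial_ideal G"
    "\<And>i x. x \<in> free_on (B' (Suc i)) \<Longrightarrow> d i (f (Suc i) x) = f i (d' i x)"
    by metis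
  interpret cone x u G G' B B' s s' d d' \<epsilon> \<epsilon>' f
    by (unfold_locales; fact colon min min' f)
  have "(i, cone_shift i k) \<in> T''" if "k \<in> cone_basis i" for i k
  proof (cases "even k")
    case True
    then obtain j where k: "k = 2 * j" by (rule evenE)
    then have "j \<in> B i" using that cone_basis_members(1)[of i] by blast
    then show ?thesis using B T(1) by (auto simp: cone_shift_def k)
  next
    case False
    then obtain j where k: "k = 2 * j + 1" by (rule oddE)
    show ?thesis
    proof (cases i)
      case 0
      then show ?thesis using that cone_basis_members(2) k by blast
    next
      case (Suc i')
      then have "j \<in> B' i'" using that cone_basis_members(3)[of i'] k by blast
      then show ?thesis using B' T(2) by (auto simp: cone_shift_def k Suc)
    qed
  qed
  then show ?thesis
    unfolding resolved_within_def using cone_minimal by blast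
qed

lemma resolved_within_empty: "resolved_within (K :: 'k::comm_ring_1 itself) ({} :: 'v monom set) {(0, 0)}"
proof -
  let ?B = "\<lambda>i::nat. if i = 0 then {0} else {} :: nat set"
  let ?\<epsilon> = "\<lambda>x :: ('v, 'k) fmod. lookup x 0"
  let ?d = "\<lambda>(i :: nat) (x :: ('v, 'k) fmod). 0 :: ('v, 'k) fmod"
  have ideal: "(f :: ('v, 'k) mpoly) \<in> monomial_ideal {} \<longleftrightarrow> f = 0" for f
    by (simp add: monomial_ideal_def)
  have one: "x \<in> free_on {0} \<Longrightarrow> lookup x 0 = 0 \<Longrightarrow> x = 0" for x :: "('v, 'k) fmod"
    by (rule poly_mapping_eqI) (metis empty_iff free_on_iff insert_iff lookup_zero)
  have "resolution (monomial_ideal {}) (\<lambda>i. free_on (?B i)) ?d ?\<epsilon>"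
    unfolding resolution_def
  proof (intro conjI allI)
    show "\<exists>x\<in>free_on (?B 0). r - lookup x 0 \<in> monomial_ideal {}" for r :: "('v, 'k) mpoly"
      by (intro bexI[of _ "single 0 r"]) (simp_all add: ideal)
    show "?d 0 ` free_on (?B 1) = {x \<in> free_on (?B 0). lookup x 0 \<in> (monomial_ideal {} :: ('v, 'k) mpoly set)}"
      using one by (auto simp: ideal free_on_empty fmod.subspace_0[OF subspace_free_on])
  qed (auto simp: module_hom_iff module_fscale module_mpoly lookup_add free_on_empty)
  then have "minimal_graded_free_resolution (monomial_ideal {}) ?B (\<lambda>_ _. 0) ?d ?\<epsilon>"
    by (simp add: minimal_graded_free_resolution_def)
  then show ?thesis
    unfolding resolved_within_def by (intro exI conjI) (auto split: if_splits)
qed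

section \<open>Forests and bouquets\<close>

text \<open>Adding a new variable \<open>v\<close> is the case \<open>u = 1\<close> of the cone, over two copies of the same resolution.
  The set \<open>M\<close> records for which variables the second copy was taken.\<close>

lemma resolved_within_variables:
  fixes G :: "'v::finite monom set"
  assumes "finite N" "\<And>g v. g \<in> G \<Longrightarrow> v \<in> N \<Longrightarrow> lookup g v = 0"
    and "resolved_within K G T"
  shows "resolved_within (K :: 'k::comm_ring_1 itself) (G \<union> mono_var ` N)
    {(i + card M, j + card M) | i j M. (i, j) \<in> T \<and> M \<subseteq> N}"
  using assms(1,2)
proof (induction N rule: finite_induct)
  case empty
  have "{(i + card M, j + card M) | i j M. (i, j) \<in> T \<and> M \<subseteq> {}} = T" by force
  then show ?case using assms(3) by simp
next
  case (insert v N)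
  let ?G = "G \<union> mono_var ` N"
  let ?T = "\<lambda>N. {(i + card M, j + card M) | i j M. (i, j) \<in> T \<and> M \<subseteq> N}"
  have IH: "resolved_within K ?G (?T N)"
    using insert by blast
  have v: "lookup g v = 0" if "g \<in> ?G" for g
    using that insert.prems insert.hyps by (auto simp: lookup_single when_def)
  have "resolved_within K (insert (mono_var v + 0) ?G) (?T (insert v N))"
  proof (rule resolved_within_insert[OF v _ IH IH])
    show "(Suc i, j + (mdeg (0 :: 'v monom) + 1)) \<in> ?T (insert v N)" if ij: "(i, j) \<in> ?T N" for i j
    proof -
      from ij obtain i' j' M where M: "M \<subseteq> N" "(i', j') \<in> T" "i = i' + card M" "j = j' + card M"
        by blast
      have "card (insert v M) = card M + 1"
        using M(1) insert.hyps finite_subset by (subst card_insert_disjoint) auto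
      then show ?thesis
        using M by (intro CollectI exI[of _ i'] exI[of _ j'] exI[of _ "insert v M"]) auto
    qed
  qed auto
  then show ?case by simp
qed

text \<open>The first vertex \<open>x\<close> of a longest path is a leaf: a neighbour outside the path would extend it, and
  one on the path other than the second vertex would close a cycle.\<close>

lemma exists_leaf:
  fixes E :: "'v::finite set set"
  assumes "simple_graph E" "E \<noteq> {}" "\<nexists>vs. graph_cycle E vs"
  shows "\<exists>x y. x \<noteq> y \<and> {x, y} \<in> E \<and> (\<forall>e\<in>E. x \<in> e \<longrightarrow> e = {x, y})"
proof -
  define path where "path vs \<longleftrightarrow> distinct vs \<and> 2 \<le> length vs \<and>
    (\<forall>i. Suc i < length vs \<longrightarrow> {vs ! i, vs ! Suc i} \<in> E)" for vs
  obtain e where "e \<in> E" using assms(2) by blast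
  then have "card e = 2" using assms(1) by (simp add: simple_graph_def)
  then obtain a b where "e = {a, b}" "a \<noteq> b" by (auto simp: card_2_iff)
  then have "path [a, b]"
    using \<open>e \<in> E\<close> by (auto simp: path_def less_Suc_eq)
  moreover have "length vs < Suc (card (UNIV :: 'v set))" if "path vs" for vs
  proof -
    have "length vs = card (set vs)"
      using that by (simp add: path_def distinct_card)
    also have "\<dots> \<le> card (UNIV :: 'v set)"
      by (rule card_mono) auto
    finally show ?thesis by simp
  qed
  ultimately obtain vs where vs: "path vs" and max: "\<And>ws. path ws \<Longrightarrow> length ws \<le> length vs"
    using ex_has_greatest_nat[of path "[a, b]" length "Suc (card (UNIV :: 'v set))"] by blast
  obtain x y ws where vs_eq: "vs = x # y # ws"
    using vs unfolding path_def by (metis One_nat_def Suc_1 Suc_le_length_iff)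
  have xy: "x \<noteq> y" "{x, y} \<in> E"
    using vs by (auto simp: path_def vs_eq)
  have "e = {x, y}" if e: "e \<in> E" "x \<in> e" for e
  proof -
    have "card e = 2" using e assms(1) by (simp add: simple_graph_def)
    then obtain z where z: "e = {x, z}" "x \<noteq> z"
      using e(2) by (auto simp: card_2_iff)
    show ?thesis
    proof (rule ccontr)
      assume "e \<noteq> {x, y}"
      then have "z \<noteq> y" using z by auto
      show False
      proof (cases "z \<in> set vs")
        case False
        have "path (z # vs)"
          unfolding path_def
        proof (intro conjI allI impI)
          fix i
          assume "Suc i < length (z # vs)"
          then show "{(z # vs) ! i, (z # vs) ! Suc i} \<in> E"
            using vs e(1) by (cases i) (auto simp: path_def z vs_eq insert_commute)
        qed (use vs False in \<open>auto simp: path_def\<close>)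
        then show False using max by fastforce
      next
        case True
        then obtain k where k: "k < length vs" "vs ! k = z" by (auto simp: in_set_conv_nth)
        have "k \<noteq> 0"
          using k(2) z(2) by (intro notI) (simp add: vs_eq)
        moreover have "k \<noteq> 1"
          using k(2) \<open>z \<noteq> y\<close> by (intro notI) (simp add: vs_eq)
        ultimately have k2: "2 \<le> k" by linarith
        let ?c = "take (Suc k) vs"
        have len: "length ?c = Suc k" using k by simp
        have "graph_cycle E ?c"
          unfolding graph_cycle_def len
        proof (intro conjI allI impI)
          show "3 \<le> Suc k" using k2 by simp
          show "distinct ?c" using vs by (simp add: path_def)
          fix i
          assume i: "i < Suc k"
          show "{?c ! i, ?c ! (Suc i mod Suc k)} \<in> E"
          proof (cases "i = k")
            case True
            have "?c ! k = z" using k(2) by simp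
            moreover have "?c ! 0 = x" by (simp add: vs_eq)
            ultimately show ?thesis using e(1) True by (simp add: z insert_commute)
          next
            case False
            then have "Suc i < Suc k" using i by simp
            then show ?thesis using vs k by (simp add: path_def)
          qed
        qed
        with assms(3) show False by blast
      qed
    qed
  qed
  with xy show ?thesis by blast
qed

text \<open>A bouquet \<open>(y, x, L)\<close> has the centre \<open>y\<close>, the set \<open>L\<close> of leaves, and a leaf \<open>x\<close> chosen such that in a
  family the edges \<open>xy\<close> form an induced matching. The other leaves of a bouquet may be adjacent to
  vertices of other bouquets, as long as they are not leaves there.\<close>

type_synonym 'v bouquet = "'v \<times> 'v \<times> 'v set"

definition core :: "'v bouquet list \<Rightarrow> 'v set" where
  "core bs = (\<Union>(y, x, L)\<in>set bs. {y, x})"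

definition leaves :: "'v bouquet list \<Rightarrow> 'v set" where
  "leaves bs = (\<Union>(y, x, L)\<in>set bs. L)"

definition leaf_count :: "'v bouquet list \<Rightarrow> nat" where
  "leaf_count bs = (\<Sum>(y, x, L)\<leftarrow>bs. card L)"

fun bouquet_family :: "'v set set \<Rightarrow> 'v bouquet list \<Rightarrow> bool" where
  "bouquet_family E [] \<longleftrightarrow> True"
| "bouquet_family E ((y, x, L) # bs) \<longleftrightarrow> x \<in> L \<and> (\<forall>l\<in>L. {y, l} \<in> E) \<and> L \<inter> leaves bs = {} \<and>
     (\<forall>v\<in>{y, x}. \<forall>w\<in>core bs. v \<noteq> w \<and> {v, w} \<notin> E) \<and> bouquet_family E bs"

lemma core_simps [simp]: "core [] = {}" "core ((y, x, L) # bs) = insert y (insert x (core bs))"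
  and leaves_simps [simp]: "leaves [] = {}" "leaves ((y, x, L) # bs) = L \<union> leaves bs"
  and leaf_count_simps [simp]: "leaf_count [] = 0" "leaf_count ((y, x, L) # bs) = card L + leaf_count bs"
  by (auto simp: core_def leaves_def leaf_count_def)

lemma bouquet_vertices: "bouquet_family E bs \<Longrightarrow> core bs \<union> leaves bs \<subseteq> \<Union>E"
proof (induction bs)
  case (Cons b bs)
  then show ?case
  proof (cases b)
    case (fields y x L)
    then show ?thesis using Cons by auto
  qed
qed simp

text \<open>Only edges between vertices of the family matter for it to be one, so families of an induced
  subgraph remain families.\<close>

lemma bouquet_family_induced:
  assumes "E' \<subseteq> E" "\<And>v w. v \<in> \<Union>E' \<Longrightarrow> w \<in> \<Union>E' \<Longrightarrow> {v, w} \<in> E \<Longrightarrow> {v, w} \<in> E'"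
    and "bouquet_family E' bs"
  shows "bouquet_family E bs"
  using assms(3)
proof (induction bs)
  case (Cons b bs)
  obtain y x L where b: "b = (y, x, L)" by (cases b)
  have "v \<noteq> w \<and> {v, w} \<notin> E" if "v \<in> {y, x}" "w \<in> core bs" for v w
  proof -
    have "v \<in> \<Union>E'" "w \<in> \<Union>E'"
      using bouquet_vertices[OF Cons.prems] that unfolding b core_simps by blast+
    moreover have "v \<noteq> w" "{v, w} \<notin> E'"
      using Cons.prems that unfolding b bouquet_family.simps by blast+
    ultimately show ?thesis using assms(2) by blast
  qed
  moreover have "\<forall>l\<in>L. {y, l} \<in> E"
    using Cons.prems assms(1) unfolding b bouquet_family.simps by blast
  ultimately show ?case
    using Cons.IH Cons.prems unfolding b bouquet_family.simps by blast
qed simp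

definition bouquet_degrees :: "'v set set \<Rightarrow> (nat \<times> nat) set" where
  "bouquet_degrees E = {(leaf_count bs, leaf_count bs + length bs) | bs. bouquet_family E bs}"

lemma multiples_Un: "multiples (G \<union> G') = multiples G \<union> multiples G'"
  by (auto simp: multiples_def)

lemma multiples_edge_monomials:
  "m \<in> multiples (edge_monomials E) \<longleftrightarrow>
     (\<exists>a b. a \<noteq> b \<and> {a, b} \<in> E \<and> 0 < lookup m a \<and> 0 < lookup m b)"
proof
  assume "m \<in> multiples (edge_monomials E)"
  then obtain a b h where "a \<noteq> b" "{a, b} \<in> E" "m = mono_var a + mono_var b + h"
    by (auto simp: multiples_def edge_monomials_def)
  then show "\<exists>a b. a \<noteq> b \<and> {a, b} \<in> E \<and> 0 < lookup m a \<and> 0 < lookup m b"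
    by (intro exI[of _ a] exI[of _ b]) (simp add: lookup_add)
next
  assume "\<exists>a b. a \<noteq> b \<and> {a, b} \<in> E \<and> 0 < lookup m a \<and> 0 < lookup m b"
  then obtain a b where ab: "a \<noteq> b" "{a, b} \<in> E" "0 < lookup m a" "0 < lookup m b"
    by blast
  then obtain n where n: "m = mono_var a + n"
    using mono_var_plus_iff[of m a] by blast
  then have "0 < lookup n b"
    using ab by (simp add: lookup_add lookup_single)
  then obtain n' where "n = mono_var b + n'"
    using mono_var_plus_iff[of n b] by blast
  then have "m = (mono_var a + mono_var b) + n'" by (simp add: n add.assoc)
  moreover have "mono_var a + mono_var b \<in> edge_monomials E"
    using ab by (auto simp: edge_monomials_def)
  ultimately show "m \<in> multiples (edge_monomials E)"
    unfolding multiples_def by blast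
qed

lemma edge_monomials_insert:
  assumes "x \<noteq> y"
  shows "edge_monomials (insert {x, y} E) = insert (mono_var x + mono_var y) (edge_monomials E)"
proof (intro set_eqI iffI)
  fix g
  assume "g \<in> edge_monomials (insert {x, y} E)"
  then obtain u v where "g = mono_var u + mono_var v" "u \<noteq> v" "{u, v} = {x, y} \<or> {u, v} \<in> E"
    by (auto simp: edge_monomials_def)
  then show "g \<in> insert (mono_var x + mono_var y) (edge_monomials E)"
    by (auto simp: edge_monomials_def doubleton_eq_iff add.commute)
next
  fix g
  assume "g \<in> insert (mono_var x + mono_var y) (edge_monomials E)"
  then show "g \<in> edge_monomials (insert {x, y} E)"
    using assms by (auto simp: edge_monomials_def)
qed

lemma multiples_variables:
  "m \<in> multiples (mono_var ` N) \<longleftrightarrow> (\<exists>v\<in>N. 0 < lookup m v)"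
  unfolding multiples_def using mono_var_plus_iff[of m] by blast

text \<open>Induction on the number of edges, with the mapping cone for \<open>I(E) = I(E\<^sub>0) + (xy)\<close>. Basis elements of
  the resolution for \<open>E\<^sub>0\<close> keep their family. Those of the resolution for \<open>I(E\<^sub>1) + (N)\<close> are given by a
  family in \<open>E\<^sub>1\<close> and a set \<open>M \<subseteq> N\<close>, and they get the new bouquet with centre \<open>y\<close>, chosen leaf \<open>x\<close> and
  leaves \<open>M \<union> {x}\<close>.\<close>

lemma resolved_within_forest:
  fixes E :: "'v::finite set set"
  assumes "simple_graph E" "\<nexists>vs. graph_cycle E vs"
  shows "resolved_within (K :: 'k::comm_ring_1 itself) (edge_monomials E) (bouquet_degrees E)"
  using assms
proof (induction "card E" arbitrary: E rule: less_induct)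
  case less
  show ?case
  proof (cases "E = {}")
    case True
    then have "(0, 0) \<in> bouquet_degrees E"
      by (auto simp: bouquet_degrees_def intro: exI[of _ "[]"])
    moreover have "edge_monomials E = {}"
      using True by (simp add: edge_monomials_def)
    ultimately show ?thesis
      using resolved_within_mono[OF resolved_within_empty[of K], of "bouquet_degrees E"] by simp
  next
    case False
    obtain x y where xy: "x \<noteq> y" "{x, y} \<in> E" and leaf: "\<And>e. e \<in> E \<Longrightarrow> x \<in> e \<Longrightarrow> e = {x, y}"
      using exists_leaf[OF less.prems(1) False less.prems(2)] by blast
    have yx: "{y, x} \<in> E" using xy by (simp add: insert_commute)
    define N where "N = {v. {y, v} \<in> E} - {x}"
    define E0 where "E0 = E - {{x, y}}"
    define E1 where "E1 = {e \<in> E. e \<inter> insert x (insert y N) = {}}"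
    have sub: "E0 \<subseteq> E" "E1 \<subseteq> E" by (auto simp: E0_def E1_def)
    have "y \<notin> N"
      using less.prems(1) by (force simp: N_def simple_graph_def)
    have card: "card E0 < card E" "card E1 < card E"
      by (rule psubset_card_mono[OF finite], use xy(2) in \<open>auto simp: E0_def E1_def\<close>)+
    have graphs: "simple_graph E'" "\<nexists>vs. graph_cycle E' vs" if "E' \<subseteq> E" for E'
      using less.prems that by (auto simp: simple_graph_def graph_cycle_def) blast
    have R0: "resolved_within K (edge_monomials E0) (bouquet_degrees E0)"
      by (rule less.hyps[OF card(1) graphs[OF sub(1)]])
    have R1: "resolved_within K (edge_monomials E1) (bouquet_degrees E1)"
      by (rule less.hyps[OF card(2) graphs[OF sub(2)]])
    have "lookup g v = 0" if "g \<in> edge_monomials E1" "v \<in> N" for g v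
      using that by (auto simp: edge_monomials_def E1_def lookup_add lookup_single when_def)
    from resolved_within_variables[OF finite this R1]
    have R1N: "resolved_within K (edge_monomials E1 \<union> mono_var ` N)
        {(i + card M, j + card M) | i j M. (i, j) \<in> bouquet_degrees E1 \<and> M \<subseteq> N}" by blast
    have x0: "x \<notin> \<Union>E0"
      using leaf by (auto simp: E0_def)
    have "resolved_within K (insert (mono_var x + mono_var y) (edge_monomials E0)) (bouquet_degrees E)"
    proof (rule resolved_within_insert[OF _ _ R0 R1N])
      show "lookup g x = 0" if "g \<in> edge_monomials E0" for g
        using that x0 by (auto simp: edge_monomials_def lookup_add lookup_single when_def)
      fix m :: "'v monom"
      show "m + mono_var y \<in> multiples (edge_monomials E0) \<longleftrightarrow>
        m \<in> multiples (edge_monomials E1 \<union> mono_var ` N)"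
      proof
        assume "m + mono_var y \<in> multiples (edge_monomials E0)"
        then obtain a b where ab: "a \<noteq> b" "{a, b} \<in> E0"
          and pos: "0 < lookup (m + mono_var y) a" "0 < lookup (m + mono_var y) b"
          by (auto simp: multiples_edge_monomials)
        have nx: "a \<noteq> x" "b \<noteq> x" using ab(2) x0 by auto
        have mem: "c \<in> N" if "{y, c} \<in> E0" for c
          using that x0 by (auto simp: N_def E0_def)
        have "0 < lookup m c" if "c \<in> {a, b}" "c \<noteq> y" for c
          using that pos by (auto simp: lookup_add lookup_single)
        moreover have "a \<in> N" if "b = y" using that mem ab(2) by (simp add: insert_commute)
        moreover have "b \<in> N" if "a = y" using that mem ab(2) by simp
        moreover have "{a, b} \<in> E1" if "a \<noteq> y" "b \<noteq> y" "a \<notin> N" "b \<notin> N"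
          using that nx ab(2) by (auto simp: E1_def E0_def)
        ultimately show "m \<in> multiples (edge_monomials E1 \<union> mono_var ` N)"
          unfolding multiples_Un Un_iff multiples_edge_monomials multiples_variables
          using ab(1) by (metis insertI1 insertI2)
      next
        assume "m \<in> multiples (edge_monomials E1 \<union> mono_var ` N)"
        then consider a b where "a \<noteq> b" "{a, b} \<in> E1" "0 < lookup m a" "0 < lookup m b"
          | v where "v \<in> N" "0 < lookup m v"
          unfolding multiples_Un Un_iff multiples_edge_monomials multiples_variables by blast
        then have "\<exists>a b. a \<noteq> b \<and> {a, b} \<in> E0 \<and> 0 < lookup (m + mono_var y) a \<and>
            0 < lookup (m + mono_var y) b"
        proof cases
          case 1
          then show ?thesis
            by (intro exI[of _ a] exI[of _ b]) (auto simp: E1_def E0_def lookup_add)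
        next
          case 2
          then have "{y, v} \<noteq> {x, y}" "{y, v} \<in> E" "y \<noteq> v"
            using \<open>y \<notin> N\<close> xy(1) by (auto simp: N_def doubleton_eq_iff)
          with 2 show ?thesis
            by (intro exI[of _ y] exI[of _ v]) (auto simp: E0_def lookup_add)
        qed
        then show "m + mono_var y \<in> multiples (edge_monomials E0)"
          unfolding multiples_edge_monomials .
      qed
    next
      have "bouquet_family E bs" if "bouquet_family E0 bs" for bs
      proof (rule bouquet_family_induced[OF sub(1) _ that])
        fix v w
        assume "v \<in> \<Union>E0" "w \<in> \<Union>E0" "{v, w} \<in> E"
        then show "{v, w} \<in> E0" using x0 by (auto simp: E0_def doubleton_eq_iff)
      qed
      then show "bouquet_degrees E0 \<subseteq> bouquet_degrees E"
        unfolding bouquet_degrees_def by blast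
    next
      fix i j
      assume "(i, j) \<in> {(i + card M, j + card M) | i j M. (i, j) \<in> bouquet_degrees E1 \<and> M \<subseteq> N}"
      then obtain bs M where bs: "bouquet_family E1 bs" and M: "M \<subseteq> N"
        and ij: "i = leaf_count bs + card M" "j = leaf_count bs + length bs + card M"
        by (auto simp: bouquet_degrees_def)
      have bsE: "bouquet_family E bs"
      proof (rule bouquet_family_induced[OF sub(2) _ bs])
        fix v w
        assume "v \<in> \<Union>E1" "w \<in> \<Union>E1" "{v, w} \<in> E"
        then show "{v, w} \<in> E1" by (auto simp: E1_def)
      qed
      have avoid: "v \<notin> insert x (insert y N)" if "v \<in> core bs \<union> leaves bs" for v
        using bouquet_vertices[OF bs] that by (auto simp: E1_def)
      have "v \<noteq> w \<and> {v, w} \<notin> E" if "v \<in> {y, x}" "w \<in> core bs" for v w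
      proof -
        have w: "w \<noteq> x" "w \<noteq> y" "w \<notin> N" using avoid that(2) by auto
        then have "{y, w} \<notin> E" by (simp add: N_def)
        moreover have "{x, w} \<notin> E" using leaf[of "{x, w}"] w by (auto simp: doubleton_eq_iff)
        ultimately show ?thesis using that(1) w by auto
      qed
      moreover have "insert x M \<inter> leaves bs = {}" using avoid M by auto
      moreover have "\<forall>l\<in>insert x M. {y, l} \<in> E" using M yx by (auto simp: N_def)
      ultimately have "bouquet_family E ((y, x, insert x M) # bs)"
        using bsE unfolding bouquet_family.simps by blast
      moreover have "card (insert x M) = Suc (card M)"
        using M by (intro card_insert_disjoint) (auto simp: N_def)
      ultimately show "(Suc i, j + (mdeg (mono_var y) + 1)) \<in> bouquet_degrees E"
        unfolding bouquet_degrees_def mdeg_mono_var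
        by (intro CollectI exI[of _ "(y, x, insert x M) # bs"]) (simp add: ij)
    qed
    moreover have "edge_monomials E = insert (mono_var x + mono_var y) (edge_monomials E0)"
    proof -
      have "E = insert {x, y} E0" using xy by (auto simp: E0_def)
      then show ?thesis using xy(1) by (simp add: edge_monomials_insert)
    qed
    ultimately show ?thesis by simp
  qed
qed

section \<open>Nonvanishing classes\<close>

text \<open>The partial derivative with respect to \<open>y\<close>.\<close>

definition derivation :: "'v \<Rightarrow> ('v, 'k::comm_ring_1) mpoly \<Rightarrow> ('v, 'k) mpoly" where
  "derivation y p = Poly_Mapping.mapp (\<lambda>m c. of_nat (lookup m y + 1) * c) (pquot y p)"

lemma lookup_derivation [simp]:
  "lookup (derivation y p) m =
     of_nat (lookup m y + 1) * lookup p (mono_var y + m)"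
  by (auto simp: derivation_def lookup_mapp when_def in_keys_iff)

lemma derivation_additive: "Modules.additive (derivation y)"
  unfolding Modules.additive_def by (intro allI poly_mapping_eqI) (simp add: lookup_add distrib_left)

lemma derivation_mono_var_times:
  "derivation y (monomial (mono_var i) * p) =
     monomial (mono_var i) * derivation y p + (if i = y then p else 0)"
proof (rule poly_mapping_eqI)
  fix m
  let ?x = "monomial (mono_var i) :: ('a, 'b) mpoly"
  show "lookup (derivation y (?x * p)) m =
    lookup (?x * derivation y p + (if i = y then p else 0)) m"
  proof (cases "\<exists>n. m = mono_var i + n")
    case True
    then obtain n where m: "m = mono_var i + n" by blast
    have "mono_var y + m = mono_var i + (mono_var y + n)" by (simp add: m add.left_commute)
    then have "lookup (?x * p) (mono_var y + m) = lookup p (mono_var y + n)"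
      by (simp only: lookup_single_times_plus mult_1)
    moreover have "lookup (?x * derivation y p) m =
        of_nat (lookup n y + 1) * lookup p (mono_var y + n)"
      by (simp add: m lookup_single_times_plus)
    ultimately show ?thesis
      by (simp add: m lookup_add lookup_single algebra_simps)
  next
    case False
    then have 1: "lookup (?x * derivation y p) m = 0"
      by (rule lookup_single_times_not_plus)
    have my: "lookup m i = 0"
      using False mono_var_plus_iff[of m i] by simp
    show ?thesis
    proof (cases "i = y")
      case True
      then show ?thesis
        using 1 my by (simp add: lookup_add lookup_single_times_plus)
    next
      case neq: False
      have "\<nexists>n. mono_var y + m = mono_var i + n"
        unfolding mono_var_plus_iff using my neq by (simp add: lookup_add lookup_single)
      then have "lookup (?x * p) (mono_var y + m) = 0"
        by (rule lookup_single_times_not_plus)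
      then show ?thesis using 1 neq by simp
    qed
  qed
qed

lemma derivation_signed_monomial:
  assumes "lookup m y = 0"
  shows "derivation y (signed n (monomial (mono_var y + m))) = (signed n (monomial m) :: ('v, 'k::comm_ring_1) mpoly)"
proof -
  have "derivation y (monomial (mono_var y + m)) = (monomial m :: ('v, 'k) mpoly)"
    using assms by (intro poly_mapping_eqI) (auto simp: lookup_single when_def)
  then show ?thesis
    by (simp add: additive_signed[OF derivation_additive])
qed

text \<open>This operator takes the value 1 on both \<open>y e\<^sub>x\<close> and \<open>x e\<^sub>y\<close>, whose difference is the boundary of
  \<open>e\<^sub>x \<wedge> e\<^sub>y\<close> up to sign. Using derivatives instead of coefficients makes it anticommute with the
  Koszul differential without any further terms.\<close>

definition swap_operator :: "'v::{finite,linorder} \<Rightarrow> 'v \<Rightarrow>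
    ('v set \<Rightarrow> ('v, 'k::comm_ring_1) mpoly) \<Rightarrow> 'v set \<Rightarrow> ('v, 'k) mpoly" where
  "swap_operator y x c M = derivation y (contract x c M) + derivation x (contract y c M)"

lemma contract_pdiff:
  "contract l (pdiff c) M = pdiff (\<lambda>M. - contract l c M) M"
proof -
  have "contract l (pdiff c) M =
      (\<Sum>i\<in>UNIV. monomial (mono_var i) * contract l (contract i c) M)"
    by (simp add: kdiff_def[abs_def] contract_sum mpoly.contract_action)
  also have "\<dots> = (\<Sum>i\<in>UNIV. monomial (mono_var i) * contract i (\<lambda>M. - contract l c M) M)"
  proof (rule sum.cong[OF refl])
    fix i
    have "contract i (\<lambda>M. - contract l c M) M = - contract i (contract l c) M"
      by (simp add: contract_def signed_uminus)
    then show "monomial (mono_var i) * contract l (contract i c) M =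
        monomial (mono_var i) * contract i (\<lambda>M. - contract l c M) M"
      by (simp add: contract_anticommute[of l i])
  qed
  finally show ?thesis by (simp add: kdiff_def)
qed

lemma derivation_contract_pdiff:
  "derivation y (contract x (pdiff c) M) =
     pdiff (\<lambda>M. - derivation y (contract x c M)) M - contract y (contract x c) M"
proof -
  note add = derivation_additive[of y]
  let ?c = "\<lambda>M. - contract x c M"
  have "derivation y (contract x (pdiff c) M) =
      (\<Sum>i\<in>UNIV. derivation y (monomial (mono_var i) * contract i ?c M))"
    by (simp add: contract_pdiff) (simp add: kdiff_def additive.sum[OF add])
  also have "\<dots> = (\<Sum>i\<in>UNIV. monomial (mono_var i) * derivation y (contract i ?c M)
      + (if i = y then contract y ?c M else 0))"
    by (rule sum.cong) (auto simp: derivation_mono_var_times)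
  also have "\<dots> = (\<Sum>i\<in>UNIV. monomial (mono_var i) * derivation y (contract i ?c M)) + contract y ?c M"
    by (simp add: sum.distrib)
  also have "contract y ?c M = - contract y (contract x c) M"
    by (simp add: contract_def signed_uminus)
  also have "(\<Sum>i\<in>UNIV. monomial (mono_var i) * derivation y (contract i ?c M)) =
      pdiff (\<lambda>M. derivation y (?c M)) M"
    unfolding kdiff_def contract_additive[OF add, of _ ?c] ..
  finally show ?thesis
    by (simp add: additive.minus[OF add])
qed

text \<open>Derivatives commute with multiplication by variables except for \<open>[D\<^sub>y, y] = [D\<^sub>x, x] = 1\<close>. The two
  contractions that this leaves over, \<open>contract y \<circ> contract x\<close> and \<open>contract x \<circ> contract y\<close>, cancel.\<close>

lemma swap_operator_pdiff:
  "swap_operator y x (pdiff c) M = pdiff (\<lambda>M. - swap_operator y x c M) M"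
proof -
  have "swap_operator y x (pdiff c) M = pdiff (\<lambda>M. - derivation y (contract x c M)) M
      + pdiff (\<lambda>M. - derivation x (contract y c M)) M"
    unfolding swap_operator_def derivation_contract_pdiff
    by (simp add: contract_anticommute[of y x])
  then show ?thesis
    by (simp add: mpoly.kdiff_add[symmetric] swap_operator_def[abs_def] add.commute)
qed

definition contract_all :: "'v::{finite,linorder} set \<Rightarrow> ('v set \<Rightarrow> 'a::ab_group_add) \<Rightarrow> 'v set \<Rightarrow> 'a" where
  "contract_all S c = fold contract (sorted_list_of_set S) c"

text \<open>For each bouquet, the leaves other than the chosen one are contracted away, and the swap operator
  removes the remaining edge \<open>xy\<close>. Under Hochster's description of Koszul homology this is evaluation
  on the cross-polytope whose pairs of opposite vertices are the edges \<open>xy\<close>.\<close>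

fun swap_functional ::
  "'v::{finite,linorder} bouquet list \<Rightarrow> ('v set \<Rightarrow> ('v, 'k::comm_ring_1) mpoly) \<Rightarrow> 'k" where
  "swap_functional [] c = lookup (c {}) 0"
| "swap_functional ((y, x, L) # bs) c = swap_functional bs (swap_operator y x (contract_all (L - {x}) c))"

lemma contract_all_induct:
  assumes "\<And>l c. P c \<Longrightarrow> P (contract l c)" "P c"
  shows "P (contract_all S c)"
proof -
  have "P (fold contract ls c)" for ls
    using assms by (induction ls arbitrary: c) auto
  then show ?thesis by (simp add: contract_all_def)
qed

lemma swap_functional_boundary:
  fixes b :: "'v::{finite,linorder} set \<Rightarrow> ('v, 'k::comm_ring_1) mpoly"
  shows "swap_functional bs (pdiff b) = 0"
proof -
  have "\<exists>b. c = pdiff b \<Longrightarrow> swap_functional bs c = 0" for c :: "'v set \<Rightarrow> ('v, 'k) mpoly"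
  proof (induction bs c rule: swap_functional.induct)
    case (1 c)
    then obtain b where "c = pdiff b" by blast
    then show ?case by (simp add: kdiff_def lookup_sum)
  next
    case (2 y x L bs c)
    have "\<exists>b. contract_all (L - {x}) c = pdiff b"
    proof (rule contract_all_induct)
      fix l and c :: "'v set \<Rightarrow> ('v, 'k) mpoly"
      assume "\<exists>b. c = pdiff b"
      then show "\<exists>b. contract l c = pdiff b"
        using contract_pdiff by fastforce
    qed (rule 2)
    then have "\<exists>b. swap_operator y x (contract_all (L - {x}) c) = pdiff b"
      using swap_operator_pdiff by fastforce
    then show ?case using 2 by simp
  qed
  then show ?thesis by blast
qed

text \<open>Products of one vertex from each edge \<open>xy\<close>. These are the only monomials whose coefficients the
  functional reads.\<close>

fun transversals :: "'v bouquet list \<Rightarrow> 'v monom set" where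
  "transversals [] = {0}"
| "transversals ((y, x, L) # bs) = {mono_var v + m | v m. v \<in> {y, x} \<and> m \<in> transversals bs}"

lemma swap_functional_vanishes:
  assumes "\<And>m M. m \<in> transversals bs \<Longrightarrow> lookup (c M) m = 0"
  shows "swap_functional bs c = 0"
  using assms
proof (induction bs c rule: swap_functional.induct)
  case (2 y x L bs c)
  let ?c = "contract_all (L - {x}) c"
  have contract: "\<forall>M. lookup (contract l c M) m = 0" if "\<forall>M. lookup (c M) m = 0"
    for l m and c :: "'a set \<Rightarrow> ('a, 'b) mpoly"
    using that by (simp add: contract_def signed_def)
  have c: "\<forall>M. lookup (?c M) m = 0" if "m \<in> transversals ((y, x, L) # bs)" for m
    by (rule contract_all_induct[where P = "\<lambda>c. \<forall>M. lookup (c M) m = 0"])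
      (simp_all add: contract "2.prems" that del: transversals.simps)
  have "lookup (swap_operator y x ?c M) m = 0" if m: "m \<in> transversals bs" for m M
  proof -
    have "mono_var y + m \<in> transversals ((y, x, L) # bs)" "mono_var x + m \<in> transversals ((y, x, L) # bs)"
      using m by auto
    then have "lookup (contract x ?c M) (mono_var y + m) = 0"
      "lookup (contract y ?c M) (mono_var x + m) = 0"
      using contract[of ?c] c by blast+
    then show ?thesis
      by (simp add: swap_operator_def lookup_add)
  qed
  then show ?case using "2.IH" by simp
qed simp

definition chain_single :: "'v set \<Rightarrow> 'a::zero \<Rightarrow> 'v set \<Rightarrow> 'a" where
  "chain_single L p M = (if M = L then p else 0)"

lemma contract_chain_single:
  "l \<in> L \<Longrightarrow> contract l (chain_single L p) = chain_single (L - {l}) (signed (below l (L - {l})) p)"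
  by (rule ext) (auto simp: contract_def chain_single_def insert_absorb)

lemma contract_chain_single_other: "l \<notin> L \<Longrightarrow> contract l (chain_single L p) M = 0"
  by (auto simp: contract_def chain_single_def)

lemma contract_all_chain_single:
  assumes "S \<subseteq> L"
  shows "\<exists>n. contract_all S (chain_single L p) = chain_single (L - S) (signed n p)"
proof -
  have "distinct ls \<Longrightarrow> set ls \<subseteq> L \<Longrightarrow>
      \<exists>n. fold contract ls (chain_single L p) = chain_single (L - set ls) (signed n p)" for ls
  proof (induction ls arbitrary: L p)
    case Nil
    show ?case by (intro exI[of _ 0]) simp
  next
    case (Cons l ls)
    then have l: "l \<in> L" "set ls \<subseteq> L - {l}" "distinct ls" by auto
    obtain n where "fold contract ls (chain_single (L - {l}) (signed (below l (L - {l})) p)) =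
        chain_single (L - {l} - set ls) (signed n (signed (below l (L - {l})) p))"
      using Cons.IH[OF l(3,2)] by blast
    moreover have "L - {l} - set ls = L - set (l # ls)" by auto
    ultimately show ?case
      by (simp add: contract_chain_single[OF l(1)] signed_signed) blast
  qed
  from this[of "sorted_list_of_set S"] assms show ?thesis
    by (simp add: contract_all_def)
qed

definition centre_monomial :: "'v bouquet list \<Rightarrow> 'v monom" where
  "centre_monomial bs = (\<Sum>(y, x, L)\<leftarrow>bs. mono_var y)"

lemma centre_monomial_simps [simp]:
  "centre_monomial [] = 0" "centre_monomial ((y, x, L) # bs) = mono_var y + centre_monomial bs"
  by (simp_all add: centre_monomial_def)

lemma lookup_centre_monomial: "v \<notin> core bs \<Longrightarrow> lookup (centre_monomial bs) v = 0"
  by (induction bs) (auto simp: lookup_add lookup_single)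

lemma leaves_adjacent: "bouquet_family E bs \<Longrightarrow> l \<in> leaves bs \<Longrightarrow> \<exists>w\<in>core bs. {w, l} \<in> E"
  by (induction bs) auto

text \<open>In the product of the cycles \<open>y e\<^sub>L\<close> no centre occurs as an exterior factor. So of the two summands
  of each swap operator only the one contracting \<open>x\<close> contributes, and the value is \<open>\<plusminus>1\<close>.\<close>

lemma swap_functional_bouquets:
  assumes "simple_graph E" "bouquet_family E bs"
  shows "swap_functional bs (chain_single (leaves bs) (signed n (monomial (centre_monomial bs)))) \<noteq>
    (0 :: 'k::comm_ring_1)"
  using assms(2)
proof (induction bs arbitrary: n)
  case Nil
  show ?case by (simp add: chain_single_def signed_def)
next
  case (Cons b bs)
  obtain y x L where b: "b = (y, x, L)" by (cases b)
  have fam: "bouquet_family E bs" and xL: "x \<in> L" and L: "L \<inter> leaves bs = {}" and yx: "{y, x} \<in> E"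
    and core: "\<And>v w. v \<in> {y, x} \<Longrightarrow> w \<in> core bs \<Longrightarrow> v \<noteq> w \<and> {v, w} \<notin> E"
    using Cons.prems unfolding b bouquet_family.simps by blast+
  have "x \<noteq> y" using yx assms(1) by (force simp: simple_graph_def)
  have y: "y \<notin> leaves bs"
    using leaves_adjacent[OF fam, of y] core[of y] by (metis insertI1 insert_commute)
  have yc: "lookup (centre_monomial bs) y = 0"
    using core[of y] by (intro lookup_centre_monomial) blast
  let ?p = "monomial (mono_var y + centre_monomial bs) :: ('a, 'k) mpoly"
  obtain n' where n': "contract_all (L - {x}) (chain_single (L \<union> leaves bs) (signed n ?p)) =
      chain_single (L \<union> leaves bs - (L - {x})) (signed n' (signed n ?p))"
    using contract_all_chain_single[of "L - {x}" "L \<union> leaves bs"] by blast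
  have S: "L \<union> leaves bs - (L - {x}) = insert x (leaves bs)"
    using xL L by auto
  have x: "insert x (leaves bs) - {x} = leaves bs"
    using xL L by auto
  let ?m = "below x (leaves bs) + (n' + n)"
  have "swap_operator y x (chain_single (insert x (leaves bs)) (signed (n' + n) ?p)) =
      chain_single (leaves bs) (signed ?m (monomial (centre_monomial bs)))"
  proof (rule ext)
    fix M
    have "contract y (chain_single (insert x (leaves bs)) (signed (n' + n) ?p)) M = 0"
      using y \<open>x \<noteq> y\<close> by (intro contract_chain_single_other) auto
    moreover have "contract x (chain_single (insert x (leaves bs)) (signed (n' + n) ?p)) M =
        chain_single (leaves bs) (signed ?m ?p) M"
      by (simp add: contract_chain_single x signed_signed)
    ultimately show "swap_operator y x (chain_single (insert x (leaves bs)) (signed (n' + n) ?p)) M =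
        chain_single (leaves bs) (signed ?m (monomial (centre_monomial bs))) M"
      by (simp add: swap_operator_def chain_single_def additive.zero[OF derivation_additive]
          derivation_signed_monomial[OF yc])
  qed
  then show ?case
    using Cons.IH[OF fam, of ?m] unfolding b
    by (simp add: n' S signed_signed)
qed

text \<open>Because the matching is induced, a transversal contains no edge and its monomial is not in the
  edge ideal.\<close>

lemma transversals_independent:
  assumes "bouquet_family E bs" "m \<in> transversals bs"
  shows "keys m \<subseteq> core bs \<and>
    (\<forall>a\<in>keys m. \<forall>b\<in>keys m. a \<noteq> b \<longrightarrow> {a, b} \<notin> E)"
  using assms
proof (induction bs arbitrary: m)
  case (Cons b bs)
  obtain y x L where b: "b = (y, x, L)" by (cases b)
  obtain v m' where m: "m = mono_var v + m'" "v \<in> {y, x}" "m' \<in> transversals bs"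
    using Cons.prems(2) unfolding b transversals.simps by blast
  have fam: "bouquet_family E bs"
    and core: "\<And>w. w \<in> core bs \<Longrightarrow> {v, w} \<notin> E"
    using Cons.prems(1) m(2) unfolding b bouquet_family.simps by blast+
  have "keys m = insert v (keys m')"
    by (auto simp: m(1) in_keys_iff lookup_add lookup_single when_def split: if_splits)
  moreover note IH = Cons.IH[OF fam m(3)]
  moreover have "{c, v} \<notin> E" if "c \<in> keys m'" for c
    using core[of c] IH that by (auto simp: insert_commute)
  moreover have "{v, c} \<notin> E" if "c \<in> keys m'" for c
    using core[of c] IH that by auto
  ultimately show ?case
    using m(2) unfolding b core_simps by auto
qed simp

lemma swap_functional_add:
  fixes c c' :: "'v::{finite,linorder} set \<Rightarrow> ('v, 'k::comm_ring_1) mpoly"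
  shows "swap_functional bs (\<lambda>M. c M + c' M) = swap_functional bs c + swap_functional bs c'"
proof (induction bs arbitrary: c c')
  case (Cons b bs)
  obtain y x L where b: "b = (y, x, L)" by (cases b)
  have "fold contract ls (\<lambda>M. c M + c' M) = (\<lambda>M. fold contract ls c M + fold contract ls c' M)" for ls
    and c c' :: "'v set \<Rightarrow> ('v, 'k) mpoly"
  proof (induction ls arbitrary: c c')
    case (Cons l ls)
    have "contract l (\<lambda>M. c M + c' M) = (\<lambda>M. contract l c M + contract l c' M)"
      by (rule ext) (rule contract_add)
    then show ?case by (simp add: Cons.IH)
  qed simp
  moreover have "swap_operator y x (\<lambda>M. c M + c' M) = (\<lambda>M. swap_operator y x c M + swap_operator y x c' M)"
    for c c' :: "'v set \<Rightarrow> ('v, 'k) mpoly"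
    by (rule ext) (simp add: swap_operator_def contract_add additive.add[OF derivation_additive])
  ultimately show ?case
    unfolding b by (simp add: contract_all_def Cons.IH)
qed (simp add: lookup_add)

lemma bouquet_class_nonzero:
  fixes v :: "'v::{finite,linorder} set \<Rightarrow> ('v, 'k::comm_ring_1) mpoly"
  assumes "simple_graph E" "bouquet_family E bs"
    and "\<And>M. chain_single (leaves bs) (signed n (monomial (centre_monomial bs))) M - pdiff v M
      \<in> edge_ideal E"
  shows False
proof -
  let ?z = "chain_single (leaves bs) (signed n (monomial (centre_monomial bs))) :: 'v set \<Rightarrow> ('v, 'k) mpoly"
  have "lookup (?z M - pdiff v M) m = 0" if m: "m \<in> transversals bs" for m M
  proof -
    have "m \<notin> multiples (edge_monomials E)"
    proof
      assume "m \<in> multiples (edge_monomials E)"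
      then obtain a b where ab: "a \<noteq> b" "{a, b} \<in> E"
        and pos: "0 < lookup m a" "0 < lookup m b"
        unfolding multiples_edge_monomials by blast
      from pos have "a \<in> keys m" "b \<in> keys m"
        by (simp_all add: in_keys_iff)
      with ab show False
        using transversals_independent[OF assms(2) m] by blast
    qed
    then show ?thesis
      using assms(3)[of M] unfolding monomial_ideal_iff by (auto simp: in_keys_iff)
  qed
  then have "swap_functional bs (\<lambda>M. ?z M - pdiff v M) = 0"
    by (rule swap_functional_vanishes)
  then have "swap_functional bs (\<lambda>M. (?z M - pdiff v M) + pdiff v M) = 0"
    unfolding swap_functional_add by (simp add: swap_functional_boundary)
  then have "swap_functional bs ?z = 0" by simp
  then show False
    using swap_functional_bouquets[OF assms(1,2)] by blast
qed

section \<open>The homology algebra\<close>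

definition chain_of :: "('v::finite set \<Rightarrow> ('v, 'k::comm_ring_1) mpoly) \<Rightarrow> ('v, 'k) kchain" where
  "chain_of f = (\<Sum>L\<in>UNIV. single L (f L))"

lemma lookup_chain_of [simp]: "lookup (chain_of f) L = f L"
  by (simp add: chain_of_def lookup_sum lookup_single when_def)

lemma chain_expansion:
  fixes c :: "('v::finite, 'k::comm_ring_1) kchain"
  shows "c = (\<Sum>L\<in>UNIV. single L (lookup c L))"
  by (rule poly_mapping_eqI) (simp add: lookup_sum lookup_single when_def)

lemma below_insert_self: "below i (insert i M) = below i M"
  unfolding below_def by (rule arg_cong[where f = card]) auto

lemma lookup_koszul_d: "lookup (koszul_d c) M = pdiff (lookup c) M"
proof -
  let ?t = "\<lambda>L i. (-1) ^ below i L * monomial (mono_var i) * lookup c L"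
  have "lookup (koszul_d c) M = (\<Sum>L\<in>UNIV. \<Sum>i\<in>L. if L - {i} = M then ?t L i else 0)"
    unfolding koszul_d_def below_def by (simp add: lookup_sum lookup_single when_def)
  also have "\<dots> = (\<Sum>L\<in>UNIV. \<Sum>i\<in>UNIV. if i \<in> L \<and> L - {i} = M then ?t L i else 0)"
    by (rule sum.cong[OF refl]) (simp add: sum.If_cases if_if_eq_conj flip: sum.inter_restrict,
      rule sum.mono_neutral_cong_left, auto)
  also have "\<dots> = (\<Sum>i\<in>UNIV. \<Sum>L\<in>UNIV. if i \<in> L \<and> L - {i} = M then ?t L i else 0)"
    by (rule sum.swap)
  also have "\<dots> = (\<Sum>i\<in>UNIV. monomial (mono_var i) * contract i (lookup c) M)"
  proof (rule sum.cong[OF refl])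
    fix i
    have eq: "i \<in> L \<and> L - {i} = M \<longleftrightarrow> L = insert i M \<and> i \<notin> M" for L
      by (metis Diff_insert_absorb insertI1 insert_Diff Diff_iff)
    have "(\<Sum>L\<in>UNIV. if i \<in> L \<and> L - {i} = M then ?t L i else 0) =
        (\<Sum>L\<in>UNIV. if L = insert i M then (if i \<in> M then 0 else ?t L i) else 0)"
      unfolding eq by (intro sum.cong refl) simp
    also have "\<dots> = (if i \<in> M then 0 else ?t (insert i M) i)"
      by simp
    also have "\<dots> = monomial (mono_var i) * contract i (lookup c) M"
      by (cases "i \<in> M")
        (simp_all add: contract_def below_insert_self signed_def minus_one_power_iff)
    finally show "(\<Sum>L\<in>UNIV. if i \<in> L \<and> L - {i} = M then ?t L i else 0) =
        monomial (mono_var i) * contract i (lookup c) M" .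
  qed
  finally show ?thesis by (simp add: kdiff_def)
qed

lemma koszul_boundaries_iff:
  "z \<in> koszul_boundaries I \<longleftrightarrow> (\<exists>v. \<forall>M. lookup z M - pdiff v M \<in> I)"
proof
  assume "z \<in> koszul_boundaries I"
  then obtain b y where "z = koszul_d b + y" "y \<in> ideal_chains I"
    by (auto simp: koszul_boundaries_def)
  then show "\<exists>v. \<forall>M. lookup z M - pdiff v M \<in> I"
    by (intro exI[of _ "lookup b"]) (simp add: lookup_add lookup_koszul_d ideal_chains_def)
next
  assume "\<exists>v. \<forall>M. lookup z M - pdiff v M \<in> I"
  then obtain v where v: "\<And>M. lookup z M - pdiff v M \<in> I" by blast
  have "lookup (chain_of v) = v" by (rule ext) simp
  then have "z - koszul_d (chain_of v) \<in> ideal_chains I"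
    using v by (simp add: ideal_chains_def lookup_minus lookup_koszul_d)
  then show "z \<in> koszul_boundaries I"
    unfolding koszul_boundaries_def
    by (intro CollectI exI[of _ "chain_of v"] exI[of _ "z - koszul_d (chain_of v)"]) simp
qed

text \<open>The number of transpositions of neighbours that sort \<open>L\<close> followed by \<open>M\<close>, whose parity is the sign in
  \<open>e\<^sub>L \<and> e\<^sub>M\<close>.\<close>

definition inversions :: "'v::linorder set \<Rightarrow> 'v set \<Rightarrow> nat" where
  "inversions L M = card {(i, j). i \<in> L \<and> j \<in> M \<and> j < i}"

definition above :: "'v::linorder \<Rightarrow> 'v set \<Rightarrow> nat" where
  "above i M = card {l\<in>M. i < l}"

lemma below_above:
  fixes M :: "'v::{finite,linorder} set"
  assumes "i \<notin> M"
  shows "below i M + above i M = card M"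
proof -
  have "l < i \<or> i < l" if "l \<in> M" for l
    using that assms by (cases l i rule: linorder_cases) auto
  then have "M = {l\<in>M. l < i} \<union> {l\<in>M. i < l}" by blast
  moreover have "card ({l\<in>M. l < i} \<union> {l\<in>M. i < l}) = below i M + above i M"
    unfolding below_def above_def by (rule card_Un_disjoint) auto
  ultimately show ?thesis by simp
qed

lemma inversions_insert_left:
  fixes M :: "'v::{finite,linorder} set"
  assumes "i \<notin> L"
  shows "inversions (insert i L) M = inversions L M + below i M"
proof -
  have "{(a, b). a \<in> insert i L \<and> b \<in> M \<and> b < a} =
      {(a, b). a \<in> L \<and> b \<in> M \<and> b < a} \<union> Pair i ` {l\<in>M. l < i}" by auto
  moreover have "card ({(a, b). a \<in> L \<and> b \<in> M \<and> b < a} \<union> Pair i ` {l\<in>M. l < i}) =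
      inversions L M + card (Pair i ` {l\<in>M. l < i})"
    unfolding inversions_def using assms by (intro card_Un_disjoint) auto
  moreover have "card (Pair i ` {l\<in>M. l < i}) = below i M"
    unfolding below_def by (rule card_image) (auto intro: inj_onI)
  ultimately show ?thesis by (simp add: inversions_def)
qed

lemma inversions_insert_right:
  fixes M :: "'v::{finite,linorder} set"
  assumes "i \<notin> M"
  shows "inversions L (insert i M) = inversions L M + above i L"
proof -
  have "{(a, b). a \<in> L \<and> b \<in> insert i M \<and> b < a} =
      {(a, b). a \<in> L \<and> b \<in> M \<and> b < a} \<union> (\<lambda>l. (l, i)) ` {l\<in>L. i < l}" by auto
  moreover have "card ({(a, b). a \<in> L \<and> b \<in> M \<and> b < a} \<union> (\<lambda>l. (l, i)) ` {l\<in>L. i < l}) =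
      inversions L M + card ((\<lambda>l. (l, i)) ` {l\<in>L. i < l})"
    unfolding inversions_def using assms by (intro card_Un_disjoint) auto
  moreover have "card ((\<lambda>l. (l, i)) ` {l\<in>L. i < l}) = above i L"
    unfolding above_def by (rule card_image) (auto intro: inj_onI)
  ultimately show ?thesis by (simp add: inversions_def)
qed

lemma below_Un:
  fixes M :: "'v::{finite,linorder} set"
  assumes "L \<inter> M = {}"
  shows "below i (L \<union> M) = below i L + below i M"
proof -
  have "{l \<in> L \<union> M. l < i} = {l\<in>L. l < i} \<union> {l\<in>M. l < i}" by auto
  then show ?thesis
    unfolding below_def using assms by (simp add: card_Un_disjoint disjoint_iff)
qed

lemma koszul_wedge_single:
  "koszul_wedge (single L f) (single M g) =
     (if L \<inter> M \<noteq> {} then 0 else single (L \<union> M) (signed (inversions L M) (f * g)))"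
proof -
  let ?t = "if L \<inter> M \<noteq> {} then 0 else single (L \<union> M) (signed (inversions L M) (f * g))"
  have "koszul_wedge (single L f) (single M g) =
      (\<Sum>L'\<in>UNIV. \<Sum>M'\<in>UNIV. if L' = L then (if M' = M then ?t else 0) else 0)"
    unfolding koszul_wedge_def
  proof (intro sum.cong refl)
    fix L' M'
    show "(if L' \<inter> M' \<noteq> {} then 0 else single (L' \<union> M')
        ((-1) ^ card {(i, j). i \<in> L' \<and> j \<in> M' \<and> j < i} *
          lookup (single L f) L' * lookup (single M g) M')) =
      (if L' = L then (if M' = M then ?t else 0) else 0)"
      by (cases "L' = L"; cases "M' = M")
        (simp_all add: lookup_single_not_eq signed_def minus_one_power_iff inversions_def)
  qed
  also have "\<dots> = (\<Sum>L'\<in>UNIV. if L' = L then ?t else 0)"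
    by (rule sum.cong) auto
  finally show ?thesis by simp
qed

lemma power_times_eq_signed: "(-1) ^ n * p * q = signed n (p * q :: 'a::ring_1)"
  by (simp add: signed_def minus_one_power_iff)

lemma koszul_d_single:
  "koszul_d (single L f) =
     (\<Sum>i\<in>L. single (L - {i}) (signed (below i L) (monomial (mono_var i) * f)))"
proof -
  have "koszul_d (single L f) = (\<Sum>L'\<in>UNIV. if L' = L then
      (\<Sum>i\<in>L. single (L - {i}) (signed (below i L) (monomial (mono_var i) * f))) else 0)"
    unfolding koszul_d_def
  proof (rule sum.cong[OF refl])
    fix L'
    show "(\<Sum>i\<in>L'. single (L' - {i}) ((-1) ^ card {l\<in>L'. l < i} *
        monomial (mono_var i) * lookup (single L f) L')) = (if L' = L then
      (\<Sum>i\<in>L. single (L - {i}) (signed (below i L) (monomial (mono_var i) * f))) else 0)"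
      by (cases "L' = L")
        (simp_all add: lookup_single_not_eq power_times_eq_signed below_def)
  qed
  then show ?thesis by simp
qed

lemma koszul_d_additive: "Modules.additive koszul_d"
  unfolding Modules.additive_def
proof (intro allI, rule poly_mapping_eqI)
  fix x y :: "('a, 'b) kchain" and k
  have "lookup (x + y) = (\<lambda>M. lookup x M + lookup y M)"
    by (rule ext) (rule lookup_add)
  then show "lookup (koszul_d (x + y)) k = lookup (koszul_d x + koszul_d y) k"
    by (simp add: lookup_koszul_d lookup_add mpoly.kdiff_add)
qed

lemma koszul_wedge_additive_left: "Modules.additive (\<lambda>a. koszul_wedge a b)"
  unfolding Modules.additive_def koszul_wedge_def
  by (intro allI) (auto simp: lookup_add single_add distrib_left distrib_right sum.distrib[symmetric]
      intro!: sum.cong)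

lemma koszul_wedge_additive_right: "Modules.additive (koszul_wedge a)"
  unfolding Modules.additive_def koszul_wedge_def
  by (intro allI) (auto simp: lookup_add single_add distrib_left distrib_right sum.distrib[symmetric]
      intro!: sum.cong)

lemma signed_sum: "signed n (sum f A) = (\<Sum>a\<in>A. signed n (f a))"
  by (simp add: signed_def sum_negf)

text \<open>The sign by which the differential passes over the first factor in the Leibniz rule.\<close>

definition parity_twist :: "('v::finite, 'k::comm_ring_1) kchain \<Rightarrow> ('v, 'k) kchain" where
  "parity_twist a = chain_of (\<lambda>L. signed (card L) (lookup a L))"

lemma parity_twist_twice [simp]: "parity_twist (parity_twist a) = a"
  by (rule poly_mapping_eqI) (simp add: parity_twist_def)

lemma parity_twist_additive: "Modules.additive parity_twist"
  unfolding Modules.additive_def parity_twist_def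
  by (intro allI, rule poly_mapping_eqI) (simp add: lookup_add signed_add)

lemma parity_twist_single:
  "parity_twist (single L f) = single L (signed (card L) f)"
  by (rule poly_mapping_eqI) (simp add: parity_twist_def lookup_single when_def)

lemma koszul_d_parity_twist:
  "koszul_d (parity_twist a) = - parity_twist (koszul_d a)"
proof (rule poly_mapping_eqI)
  fix M :: "'a set"
  have "contract i (\<lambda>L. signed (card L) (lookup a L)) M =
      - signed (card M) (contract i (lookup a) M)" for i
    by (simp add: contract_def signed_signed signed_uminus add.commute)
  moreover have "lookup (parity_twist a) = (\<lambda>L. signed (card L) (lookup a L))"
    by (rule ext) (simp add: parity_twist_def)
  ultimately show "lookup (koszul_d (parity_twist a)) M =
      lookup (- parity_twist (koszul_d a)) M"
    by (simp add: lookup_koszul_d kdiff_def parity_twist_def sum_negf signed_sum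
        additive_signed[OF mpoly.action_additive])
qed

lemma signed_opposite: "(even m \<longleftrightarrow> odd n) \<Longrightarrow> signed m a = - signed n a"
  by (auto simp: signed_def)

text \<open>For disjoint \<open>L\<close> and \<open>M\<close> the summands on both sides correspond to each other. If \<open>L\<close> and \<open>M\<close> meet in
  one element \<open>j\<close>, the left side is 0, and on the right only the two summands for \<open>j\<close> survive and
  cancel. If they meet in more, everything vanishes.\<close>

lemma leibniz_single:
  fixes f g :: "('v::{finite,linorder}, 'k::comm_ring_1) mpoly" and L M :: "'v set"
  defines "a \<equiv> single L f" and "b \<equiv> single M g"
  shows "koszul_d (koszul_wedge a b) = koszul_wedge (koszul_d a) b + koszul_wedge (parity_twist a) (koszul_d b)"
proof -
  let ?x = "\<lambda>i. monomial (mono_var i) :: ('v, 'k) mpoly"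
  let ?l = "\<lambda>i. if (L - {i}) \<inter> M \<noteq> {} then 0 else single (L - {i} \<union> M)
      (signed (inversions (L - {i}) M + below i L) (?x i * f * g))"
  let ?r = "\<lambda>i. if L \<inter> (M - {i}) \<noteq> {} then 0 else single (L \<union> (M - {i}))
      (signed (inversions L (M - {i}) + (card L + below i M)) (?x i * f * g))"
  have signed_times: "signed m p * q = signed m (p * q)" "p * signed m q = signed m (p * q)"
    for m and p q :: "('v, 'k) mpoly"
    by (simp_all add: signed_def)
  have xfg: "f * ?x i * g = ?x i * f * g" for i
    by (simp only: mult.commute[of f])
  have l: "koszul_wedge (koszul_d a) b = (\<Sum>i\<in>L. ?l i)"
    unfolding a_def b_def koszul_d_single additive.sum[OF koszul_wedge_additive_left]
    by (rule sum.cong) (auto simp: koszul_wedge_single signed_times signed_signed)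
  have r: "koszul_wedge (parity_twist a) (koszul_d b) = (\<Sum>i\<in>M. ?r i)"
    unfolding a_def b_def koszul_d_single parity_twist_single additive.sum[OF koszul_wedge_additive_right]
    by (rule sum.cong) (auto simp: koszul_wedge_single signed_times signed_signed xfg
        add.commute[of _ "card L"])
  show ?thesis
  proof (cases "L \<inter> M = {}")
    case True
    have "koszul_d (koszul_wedge a b) = (\<Sum>i\<in>L \<union> M. single (L \<union> M - {i})
        (signed (below i (L \<union> M) + inversions L M) (?x i * f * g)))"
      using True by (simp add: a_def b_def koszul_wedge_single koszul_d_single signed_times signed_signed)
    also have "\<dots> = (\<Sum>i\<in>L. single (L \<union> M - {i})
        (signed (below i (L \<union> M) + inversions L M) (?x i * f * g))) +
      (\<Sum>i\<in>M. single (L \<union> M - {i})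
        (signed (below i (L \<union> M) + inversions L M) (?x i * f * g)))"
      using True by (simp add: sum.union_disjoint)
    also have "(\<Sum>i\<in>L. single (L \<union> M - {i})
        (signed (below i (L \<union> M) + inversions L M) (?x i * f * g))) = (\<Sum>i\<in>L. ?l i)"
    proof (rule sum.cong[OF refl])
      fix i
      assume i: "i \<in> L"
      have "L \<union> M - {i} = L - {i} \<union> M" "(L - {i}) \<inter> M = {}" using True i by auto
      moreover have "inversions L M = inversions (L - {i}) M + below i M"
        using inversions_insert_left[of i "L - {i}" M] i by (simp add: insert_absorb)
      then have "even (below i (L \<union> M) + inversions L M) \<longleftrightarrow> even (inversions (L - {i}) M + below i L)"
        using below_Un[OF True, of i] by presburger
      ultimately show "single (L \<union> M - {i})
        (signed (below i (L \<union> M) + inversions L M) (?x i * f * g)) = ?l i"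
        by (simp add: signed_def)
    qed
    also have "(\<Sum>i\<in>M. single (L \<union> M - {i})
        (signed (below i (L \<union> M) + inversions L M) (?x i * f * g))) = (\<Sum>i\<in>M. ?r i)"
    proof (rule sum.cong[OF refl])
      fix i
      assume i: "i \<in> M"
      then have iL: "i \<notin> L" using True by auto
      have "L \<union> M - {i} = L \<union> (M - {i})" "L \<inter> (M - {i}) = {}" using True i by auto
      moreover have "inversions L M = inversions L (M - {i}) + above i L"
        using inversions_insert_right[of i "M - {i}" L] i by (simp add: insert_absorb)
      then have "even (below i (L \<union> M) + inversions L M) \<longleftrightarrow>
          even (inversions L (M - {i}) + (card L + below i M))"
        using below_Un[OF True, of i] below_above[OF iL] by presburger
      ultimately show "single (L \<union> M - {i})
        (signed (below i (L \<union> M) + inversions L M) (?x i * f * g)) = ?r i"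
        by (simp add: signed_def)
    qed
    finally show ?thesis unfolding l r .
  next
    case False
    then obtain j where j: "j \<in> L" "j \<in> M" by blast
    have 0: "koszul_d (koszul_wedge a b) = 0"
      using False by (simp add: a_def b_def koszul_wedge_single additive.zero[OF koszul_d_additive])
    have "(\<Sum>i\<in>L. ?l i) = (\<Sum>i\<in>L. if i = j then ?l j else 0)"
      by (rule sum.cong) (use j in auto)
    also have "\<dots> = ?l j" using j by simp
    finally have l': "(\<Sum>i\<in>L. ?l i) = ?l j" .
    have "(\<Sum>i\<in>M. ?r i) = (\<Sum>i\<in>M. if i = j then ?r j else 0)"
      by (rule sum.cong) (use j in auto)
    also have "\<dots> = ?r j" using j by simp
    finally have r': "(\<Sum>i\<in>M. ?r i) = ?r j" .
    define L' M' where "L' = L - {j}" and "M' = M - {j}"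
    have disj: "L' \<inter> M = {} \<longleftrightarrow> L \<inter> M' = {}" and un: "L' \<union> M = L \<union> M'"
      using j by (auto simp: L'_def M'_def)
    have LM: "L = insert j L'" "j \<notin> L'" "M = insert j M'" "j \<notin> M'"
      using j by (auto simp: L'_def M'_def)
    have "inversions L' M = inversions L' M' + above j L'"
      using LM inversions_insert_right by blast
    moreover have "inversions L M' = inversions L' M' + below j M'"
      using LM inversions_insert_left by blast
    moreover have "below j L = below j L'" "below j M = below j M'"
      using LM below_insert_self by blast+
    moreover have "card L = Suc (card L')" using LM by simp
    ultimately have par: "even (inversions L' M + below j L) \<longleftrightarrow> odd (inversions L M' + (card L + below j M))"
      using below_above[OF LM(2)] by presburger
    have "?l j = - ?r j"
      unfolding L'_def[symmetric] M'_def[symmetric] disj un signed_opposite[OF par]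
      by (simp only: single_uminus if_distrib[of uminus] minus_zero)
    then show ?thesis unfolding 0 l r l' r' by simp
  qed
qed

lemma leibniz:
  fixes a b :: "('v::{finite,linorder}, 'k::comm_ring_1) kchain"
  shows "koszul_d (koszul_wedge a b) = koszul_wedge (koszul_d a) b + koszul_wedge (parity_twist a) (koszul_d b)"
proof -
  note sums = additive.sum[OF koszul_d_additive] additive.sum[OF koszul_wedge_additive_left]
    additive.sum[OF koszul_wedge_additive_right] additive.sum[OF parity_twist_additive]
  let ?a = "\<lambda>L. single L (lookup a L)"
  let ?b = "\<lambda>L. single L (lookup b L)"
  have "koszul_d (koszul_wedge (sum ?a UNIV) (sum ?b UNIV)) =
      koszul_wedge (koszul_d (sum ?a UNIV)) (sum ?b UNIV) +
      koszul_wedge (parity_twist (sum ?a UNIV)) (koszul_d (sum ?b UNIV))"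
    by (simp only: sums leibniz_single sum.distrib)
  then show ?thesis
    using chain_expansion[of a] chain_expansion[of b] by simp
qed

lemma ideal_chains_closed:
  assumes "pmod.subspace I"
  shows "0 \<in> ideal_chains I" "a \<in> ideal_chains I \<Longrightarrow> b \<in> ideal_chains I \<Longrightarrow> a + b \<in> ideal_chains I"
    "a \<in> ideal_chains I \<Longrightarrow> - a \<in> ideal_chains I"
    "a \<in> ideal_chains I \<Longrightarrow> koszul_d a \<in> ideal_chains I"
    "a \<in> ideal_chains I \<Longrightarrow> parity_twist a \<in> ideal_chains I"
  using assms kdiff_ideal[OF assms]
  by (auto simp: ideal_chains_def lookup_add lookup_koszul_d parity_twist_def signed_def
      pmod.subspace_0 pmod.subspace_add pmod.subspace_neg)

lemma ideal_chains_sum: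
  fixes I :: "('v::{finite,linorder}, 'k::comm_ring_1) mpoly set"
  assumes "pmod.subspace I" "\<And>x. x \<in> A \<Longrightarrow> f x \<in> ideal_chains I"
  shows "sum f A \<in> ideal_chains I"
  using assms(2)
  by (induction A rule: infinite_finite_induct) (auto intro: ideal_chains_closed[OF assms(1)])

lemma ideal_chains_wedge:
  assumes I: "pmod.subspace I" and "a \<in> ideal_chains I \<or> b \<in> ideal_chains I"
  shows "koszul_wedge a b \<in> ideal_chains I"
proof -
  have "p * lookup a L * lookup b M \<in> I" for p L M
  proof (cases "a \<in> ideal_chains I")
    case True
    then have "(p * lookup b M) * lookup a L \<in> I"
      by (intro pmod.subspace_scale[OF I]) (simp add: ideal_chains_def)
    then show ?thesis by (simp only: mult.assoc mult.commute[of "lookup a L"])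
  next
    case False
    then have "b \<in> ideal_chains I" using assms(2) by blast
    then have "(p * lookup a L) * lookup b M \<in> I"
      by (intro pmod.subspace_scale[OF I]) (simp add: ideal_chains_def)
    then show ?thesis .
  qed
  then have "single N (p * lookup a L * lookup b M) \<in> ideal_chains I"
    for N p L M
    using pmod.subspace_0[OF I] by (simp add: ideal_chains_def lookup_single when_def)
  then show ?thesis
    unfolding koszul_wedge_def by (intro ideal_chains_sum[OF I]) (simp add: ideal_chains_closed[OF I])
qed

lemma koszul_d_d: "koszul_d (koszul_d a) = 0"
proof (rule poly_mapping_eqI)
  fix M
  have "lookup (koszul_d a) = pdiff (lookup a)"
    by (rule ext) (rule lookup_koszul_d)
  then show "lookup (koszul_d (koszul_d a)) M = lookup 0 M"
    by (simp add: lookup_koszul_d mpoly.kdiff_kdiff)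
qed

lemma boundaryI: "y \<in> ideal_chains I \<Longrightarrow> koszul_d b + y \<in> koszul_boundaries I"
  by (auto simp: koszul_boundaries_def)

lemma boundaries_closed:
  assumes I: "pmod.subspace I"
  shows "0 \<in> koszul_boundaries I"
    "a \<in> koszul_boundaries I \<Longrightarrow> b \<in> koszul_boundaries I \<Longrightarrow> a + b \<in> koszul_boundaries I"
    "a \<in> koszul_boundaries I \<Longrightarrow> - a \<in> koszul_boundaries I"
    "a \<in> koszul_boundaries I \<Longrightarrow> koszul_d a \<in> ideal_chains I"
proof -
  show "0 \<in> koszul_boundaries I"
    using boundaryI[OF ideal_chains_closed(1)[OF I], of 0] by (simp add: additive.zero[OF koszul_d_additive])
next
  assume "a \<in> koszul_boundaries I" "b \<in> koszul_boundaries I"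
  then obtain a' y b' y' where "a = koszul_d a' + y" "b = koszul_d b' + y'"
    and y: "y \<in> ideal_chains I" "y' \<in> ideal_chains I"
    by (auto simp: koszul_boundaries_def)
  then have "a + b = koszul_d (a' + b') + (y + y')"
    by (simp add: additive.add[OF koszul_d_additive])
  then show "a + b \<in> koszul_boundaries I"
    using boundaryI[OF ideal_chains_closed(2)[OF I y]] by simp
next
  assume "a \<in> koszul_boundaries I"
  then obtain a' y where a: "a = koszul_d a' + y" and y: "y \<in> ideal_chains I"
    by (auto simp: koszul_boundaries_def)
  have "- a = koszul_d (- a') + - y"
    by (simp add: a additive.minus[OF koszul_d_additive])
  then show "- a \<in> koszul_boundaries I"
    using boundaryI[OF ideal_chains_closed(3)[OF I y]] by simp
  show "koszul_d a \<in> ideal_chains I"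
    by (simp add: a additive.add[OF koszul_d_additive] koszul_d_d ideal_chains_closed(4)[OF I y])
qed

lemma boundary_wedge_left:
  assumes I: "pmod.subspace I" and x: "x \<in> koszul_boundaries I" and b: "koszul_d b \<in> ideal_chains I"
  shows "koszul_wedge x b \<in> koszul_boundaries I"
proof -
  obtain c y where x': "x = koszul_d c + y" and y: "y \<in> ideal_chains I"
    using x by (auto simp: koszul_boundaries_def)
  have "koszul_wedge x b = koszul_d (koszul_wedge c b) +
      (- koszul_wedge (parity_twist c) (koszul_d b) + koszul_wedge y b)"
    by (simp add: x' leibniz additive.add[OF koszul_wedge_additive_left])
  then show ?thesis
    using boundaryI ideal_chains_closed[OF I] ideal_chains_wedge[OF I] b y by metis
qed

lemma boundary_wedge_right:
  assumes I: "pmod.subspace I" and x: "x \<in> koszul_boundaries I" and z: "koszul_d z \<in> ideal_chains I"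
  shows "koszul_wedge z x \<in> koszul_boundaries I"
proof -
  obtain c y where x': "x = koszul_d c + y" and y: "y \<in> ideal_chains I"
    using x by (auto simp: koszul_boundaries_def)
  have dz: "koszul_d (parity_twist z) \<in> ideal_chains I"
    unfolding koszul_d_parity_twist by (intro ideal_chains_closed[OF I] z)
  have "koszul_wedge z x = koszul_d (koszul_wedge (parity_twist z) c) +
      (- koszul_wedge (koszul_d (parity_twist z)) c + koszul_wedge z y)"
    by (simp add: x' leibniz additive.add[OF koszul_wedge_additive_right])
  then show ?thesis
    using boundaryI ideal_chains_closed[OF I] ideal_chains_wedge[OF I] dz y by metis
qed

lemma wedge_cycle:
  assumes I: "pmod.subspace I" and "koszul_d z \<in> ideal_chains I" "koszul_d w \<in> ideal_chains I"
  shows "koszul_d (koszul_wedge z w) \<in> ideal_chains I"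
  unfolding leibniz using assms by (intro ideal_chains_closed(2)[OF I] ideal_chains_wedge[OF I]) auto

text \<open>By the Leibniz rule the product of a cycle and a boundary is a boundary, so all products of
  representatives lie in one class.\<close>

lemma homology_mult_classes:
  assumes I: "pmod.subspace I" and z: "koszul_d z \<in> ideal_chains I" and w: "koszul_d w \<in> ideal_chains I"
  shows "homology_mult I (koszul_class I z) (koszul_class I w) = koszul_class I (koszul_wedge z w)"
proof (intro set_eqI iffI)
  fix c
  assume "c \<in> homology_mult I (koszul_class I z) (koszul_class I w)"
  then obtain a b where a: "a - z \<in> koszul_boundaries I" and b: "b - w \<in> koszul_boundaries I"
    and c: "c - koszul_wedge a b \<in> koszul_boundaries I"
    by (auto simp: homology_mult_def koszul_class_def)
  have "koszul_d (w + (b - w)) \<in> ideal_chains I"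
    unfolding additive.add[OF koszul_d_additive]
    by (intro ideal_chains_closed(2)[OF I] w boundaries_closed(4)[OF I] b)
  then have "koszul_wedge (a - z) b \<in> koszul_boundaries I"
    using boundary_wedge_left[OF I a, of b] by simp
  moreover have "koszul_wedge z (b - w) \<in> koszul_boundaries I"
    by (rule boundary_wedge_right[OF I b z])
  ultimately have "(c - koszul_wedge a b) + (koszul_wedge (a - z) b + koszul_wedge z (b - w))
      \<in> koszul_boundaries I"
    by (intro boundaries_closed(2)[OF I] c)
  then show "c \<in> koszul_class I (koszul_wedge z w)"
    by (simp add: koszul_class_def additive.diff[OF koszul_wedge_additive_left]
        additive.diff[OF koszul_wedge_additive_right])
next
  fix c
  assume c: "c \<in> koszul_class I (koszul_wedge z w)"
  have "z \<in> koszul_class I z" "w \<in> koszul_class I w"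
    by (simp_all add: koszul_class_def boundaries_closed(1)[OF I])
  then show "c \<in> homology_mult I (koszul_class I z) (koszul_class I w)"
    using c unfolding homology_mult_def by blast
qed

abbreviation wedge_list :: "('v::{finite,linorder}, 'k::comm_ring_1) kchain list \<Rightarrow> ('v, 'k) kchain" where
  "wedge_list zs \<equiv> foldr koszul_wedge zs (single {} 1)"

lemma homology_prod_eq_class:
  fixes I :: "('v::{finite,linorder}, 'k::comm_ring_1) mpoly set"
  assumes I: "pmod.subspace I" and "\<And>z. z \<in> set zs \<Longrightarrow> koszul_d z \<in> ideal_chains I"
  shows "homology_prod I zs = koszul_class I (wedge_list zs) \<and> koszul_d (wedge_list zs) \<in> ideal_chains I"
  using assms(2)
proof (induction zs)
  case Nil
  show ?case
    by (simp add: homology_prod_def koszul_d_single ideal_chains_closed(1)[OF I])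
next
  case (Cons z zs)
  then show ?case
    by (simp add: homology_prod_def homology_mult_classes[OF I] wedge_cycle[OF I])
qed

lemma koszul_class_eq_zero_iff:
  assumes I: "pmod.subspace I"
  shows "koszul_class I z = koszul_class I 0 \<longleftrightarrow> z \<in> koszul_boundaries I"
proof
  assume "koszul_class I z = koszul_class I 0"
  moreover have "z \<in> koszul_class I z"
    by (simp add: koszul_class_def boundaries_closed(1)[OF I])
  ultimately show "z \<in> koszul_boundaries I" by (simp add: koszul_class_def)
next
  assume z: "z \<in> koszul_boundaries I"
  have "w - z \<in> koszul_boundaries I \<longleftrightarrow> w \<in> koszul_boundaries I" for w
    using boundaries_closed(2)[OF I _ z, of "w - z"]
      boundaries_closed(2)[OF I _ boundaries_closed(3)[OF I z], of w] by auto
  then show "koszul_class I z = koszul_class I 0" by (simp add: koszul_class_def)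
qed

section \<open>Linear cycles\<close>

text \<open>All generators have degree 2, so linear means that the coefficient is a variable.\<close>

lemma linear_cycle_edge_monomials:
  assumes "E \<noteq> {}" "simple_graph E"
  shows "linear_cycle (edge_monomials E) k z \<longleftrightarrow> z \<in> koszul_cycles (edge_ideal E) k \<and>
    (\<exists>m L. z = single L (monomial m) \<and> mdeg m = 1)"
proof -
  have two: "mdeg g = 2" if "g \<in> edge_monomials E" for g :: "'a monom"
    using that by (auto simp: edge_monomials_def)
  obtain e where "e \<in> E" using assms(1) by blast
  then obtain a b where "{a, b} \<in> E" "a \<noteq> b"
    using assms(2) by (auto simp: simple_graph_def card_2_iff)
  then have "mono_var a + mono_var b \<in> edge_monomials E"
    by (auto simp: edge_monomials_def)
  then have "(LEAST d. \<exists>g\<in>edge_monomials E. mdeg g = d) = 2"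
    using two by (intro Least_equality) auto
  then show ?thesis by (simp add: linear_cycle_def One_nat_def)
qed

lemma single_in_cycles:
  fixes E :: "'v::{finite,linorder} set set"
  assumes "simple_graph E" "\<And>l. l \<in> L \<Longrightarrow> {y, l} \<in> E"
  shows "(single L (monomial (mono_var y)) :: ('v, 'k::comm_ring_1) kchain)
    \<in> koszul_cycles (edge_ideal E) (card L)"
proof -
  let ?I = "edge_ideal E :: ('v, 'k) mpoly set"
  have I: "pmod.subspace ?I" by (rule subspace_monomial_ideal)
  have "signed n (monomial (mono_var i) * monomial (mono_var y)) \<in> ?I" if "i \<in> L" for i n
  proof -
    have "i \<noteq> y" "{i, y} \<in> E"
      using assms that by (force simp: simple_graph_def insert_commute)+
    then have "mono_var i + mono_var y \<in> multiples (edge_monomials E)"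
      by (intro multiples_base) (auto simp: edge_monomials_def)
    then have "monomial (mono_var i) * monomial (mono_var y) \<in> ?I"
      by (simp add: mult_single monomial_ideal_iff)
    then show ?thesis
      by (auto simp: signed_def intro: pmod.subspace_neg[OF I])
  qed
  then have "single N (signed n (monomial (mono_var i) * monomial (mono_var y))) \<in> ideal_chains ?I"
    if "i \<in> L" for i n N
    using that pmod.subspace_0[OF I] by (simp add: ideal_chains_def lookup_single when_def)
  then have "koszul_d (single L (monomial (mono_var y))) \<in> ideal_chains ?I"
    unfolding koszul_d_single by (intro ideal_chains_sum[OF I])
  then show ?thesis
    by (auto simp: koszul_cycles_def in_keys_iff lookup_single when_def)
qed

text \<open>The product is again a signed monomial times some \<open>e\<^sub>L\<close>, and it vanishes unless the index sets are
  disjoint.\<close>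

lemma wedge_linear_cycles:
  fixes zs :: "('v::{finite,linorder}, 'k::comm_ring_1) kchain list"
  assumes "list_all2 (\<lambda>k z. z \<in> koszul_cycles I k \<and> (\<exists>m L. z = single L (monomial m) \<and> mdeg m = 1)) ks zs"
  shows "wedge_list zs = 0 \<or> (\<exists>L n m. wedge_list zs = single L (signed n (monomial m)) \<and>
    card L = sum_list ks \<and> mdeg m = length zs)"
  using assms
proof (induction rule: list_all2_induct)
  case Nil
  show ?case
    by (intro disjI2 exI[of _ "{}"] exI[of _ 0] exI[of _ "0 :: nat"]) simp
next
  case (Cons k ks z zs)
  then obtain m L where z: "z = single L (monomial m)" "mdeg m = 1" by blast
  have "monomial m \<noteq> (0 :: ('v, 'k) mpoly)"
    by (metis lookup_single_eq lookup_zero zero_neq_one)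
  then have k: "card L = k"
    using Cons.hyps(1) by (simp add: koszul_cycles_def z)
  show ?case
  proof (cases "wedge_list zs = 0")
    case True
    then show ?thesis
      by (simp add: additive.zero[OF koszul_wedge_additive_right])
  next
    case False
    then obtain M n m' where w: "wedge_list zs = single M (signed n (monomial m'))"
      "card M = sum_list ks" "mdeg m' = length zs"
      using Cons.IH by blast
    show ?thesis
    proof (cases "L \<inter> M = {}")
      case True
      then have "wedge_list (z # zs) = single (L \<union> M) (signed (inversions L M + n) (monomial (m + m')))"
        by (simp add: w(1) z(1) koszul_wedge_single signed_signed)
          (simp add: signed_def mult_single)
      moreover have "card (L \<union> M) = sum_list (k # ks)"
        using True k w(2) by (simp add: card_Un_disjoint)
      moreover have "mdeg (m + m') = length (z # zs)"
        using z(2) w(3) by simp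
      ultimately show ?thesis by blast
    next
      case False
      then show ?thesis by (simp add: w(1) z(1) koszul_wedge_single)
    qed
  qed
qed

definition bouquet_cycles :: "'v::{finite,linorder} bouquet list \<Rightarrow> ('v, 'k::comm_ring_1) kchain list" where
  "bouquet_cycles bs = map (\<lambda>(y, x, L). single L (monomial (mono_var y))) bs"

lemma wedge_bouquet_cycles:
  fixes bs :: "'v::{finite,linorder} bouquet list"
  assumes "bouquet_family E bs"
  shows "\<exists>n. wedge_list (bouquet_cycles bs :: ('v, 'k::comm_ring_1) kchain list) =
    single (leaves bs) (signed n (monomial (centre_monomial bs)))"
  using assms
proof (induction bs)
  case Nil
  show ?case by (intro exI[of _ 0]) (simp add: bouquet_cycles_def)
next
  case (Cons b bs)
  obtain y x L where b: "b = (y, x, L)" by (cases b)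
  have L: "L \<inter> leaves bs = {}" and fam: "bouquet_family E bs"
    using Cons.prems unfolding b bouquet_family.simps by blast+
  from Cons.IH[OF fam] obtain n where n: "wedge_list (bouquet_cycles bs :: ('v, 'k) kchain list) =
      single (leaves bs) (signed n (monomial (centre_monomial bs)))"
    by (elim exE)
  have "wedge_list (bouquet_cycles (b # bs) :: ('v, 'k) kchain list) =
      single (leaves (b # bs)) (signed (inversions L (leaves bs) + n) (monomial (centre_monomial (b # bs))))"
    using n L by (simp add: b bouquet_cycles_def koszul_wedge_single)
      (simp add: signed_def mult_single)
  then show ?case by blast
qed

lemma bouquet_cycles_linear:
  assumes E: "E \<noteq> {}" "simple_graph E" and "bouquet_family E bs"
  shows "list_all2 (linear_cycle (edge_monomials E)) (map (\<lambda>(y, x, L). card L) bs) (bouquet_cycles bs)"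
  using assms(3)
proof (induction bs)
  case (Cons b bs)
  obtain y x L where b: "b = (y, x, L)" by (cases b)
  have "linear_cycle (edge_monomials E) (card L) (single L (monomial (mono_var y)))"
    unfolding linear_cycle_edge_monomials[OF E]
    using Cons.prems mdeg_mono_var by (auto simp: b intro!: single_in_cycles[OF E(2)])
  then show ?case
    using Cons by (simp add: b bouquet_cycles_def)
qed (simp add: bouquet_cycles_def)

lemma bouquet_product_nonzero:
  fixes E :: "'v::{finite,linorder} set set" and I :: "('v, 'k::comm_ring_1) mpoly set"
  assumes E: "E \<noteq> {}" "simple_graph E" and bs: "bouquet_family E bs" and I: "I = edge_ideal E"
  shows "homology_prod I (bouquet_cycles bs) \<noteq> koszul_class I 0"
    and "wedge_list (bouquet_cycles bs) \<notin> koszul_boundaries I"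
    and "koszul_d (wedge_list (bouquet_cycles bs)) \<in> ideal_chains I"
proof -
  have sub: "pmod.subspace I" by (simp add: I subspace_monomial_ideal)
  obtain n where n: "wedge_list (bouquet_cycles bs) =
      (single (leaves bs) (signed n (monomial (centre_monomial bs))) :: ('v, 'k) kchain)"
    using wedge_bouquet_cycles[OF bs] by blast
  have "koszul_d z \<in> ideal_chains I" if "z \<in> set (bouquet_cycles bs)" for z :: "('v, 'k) kchain"
    using bouquet_cycles_linear[OF E bs, where 'b = 'k] that
    by (auto simp: list_all2_conv_all_nth in_set_conv_nth linear_cycle_def koszul_cycles_def I)
  note prod = homology_prod_eq_class[OF sub this]
  then show "koszul_d (wedge_list (bouquet_cycles bs)) \<in> ideal_chains I" by blast
  have "lookup (wedge_list (bouquet_cycles bs)) =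
      (chain_single (leaves bs) (signed n (monomial (centre_monomial bs))) :: 'v set \<Rightarrow> ('v, 'k) mpoly)"
    by (rule ext) (simp add: n chain_single_def lookup_single when_def)
  then show nb: "wedge_list (bouquet_cycles bs) \<notin> koszul_boundaries I"
    using bouquet_class_nonzero[OF E(2) bs] by (auto simp: koszul_boundaries_iff I)
  show "homology_prod I (bouquet_cycles bs) \<noteq> koszul_class I 0"
    using prod nb koszul_class_eq_zero_iff[OF sub] by auto
qed

lemma bouquet_family_bounds:
  fixes bs :: "'v::finite bouquet list"
  assumes "bouquet_family E bs"
  shows "leaf_count bs = card (leaves bs)" "length bs \<le> leaf_count bs"
proof -
  have "leaf_count bs = card (leaves bs) \<and> length bs \<le> leaf_count bs"
    using assms
  proof (induction bs)
    case (Cons b bs)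
    obtain y x L where b: "b = (y, x, L)" by (cases b)
    have "x \<in> L" "L \<inter> leaves bs = {}" "bouquet_family E bs"
      using Cons.prems unfolding b bouquet_family.simps by blast+
    moreover from this have "0 < card L" by (simp add: card_gt_0_iff) blast
    ultimately show ?case
      using Cons.IH by (simp add: b card_Un_disjoint)
  qed simp
  then show "leaf_count bs = card (leaves bs)" "length bs \<le> leaf_count bs" by auto
qed

text \<open>The product is a cycle of homological degree \<open>\<Sum> k\<^sub>i\<close> whose coefficients have degree \<open>j\<close>, the number
  of factors, so that a nonzero class requires a basis element of total degree \<open>\<Sum> k\<^sub>i + j\<close>.\<close>

lemma nonzero_product_in_resolution:
  fixes E :: "'v::{finite,linorder} set set" and I :: "('v, 'k::field) mpoly set"
  assumes E: "E \<noteq> {}" "simple_graph E" and I: "I = edge_ideal E"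
    and min: "minimal_graded_free_resolution I B s d \<epsilon>"
    and lin: "list_all2 (linear_cycle (edge_monomials E)) ks zs"
    and nz: "homology_prod I zs \<noteq> koszul_class I 0"
  shows "\<exists>k\<in>B (sum_list ks). s (sum_list ks) k = sum_list ks + length zs"
proof (rule ccontr)
  assume none: "\<not> ?thesis"
  have sub: "pmod.subspace I" by (simp add: I subspace_monomial_ideal)
  have lin': "list_all2 (\<lambda>k z. z \<in> koszul_cycles I k \<and>
      (\<exists>m L. z = single L (monomial m) \<and> mdeg m = 1)) ks zs"
    using lin by (rule list_all2_mono) (simp add: linear_cycle_edge_monomials[OF E] I)
  have "koszul_d z \<in> ideal_chains I" if "z \<in> set zs" for z
    using lin that by (auto simp: list_all2_conv_all_nth in_set_conv_nth linear_cycle_def koszul_cycles_def I)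
  note prod = homology_prod_eq_class[OF sub this]
  have nb: "wedge_list zs \<notin> koszul_boundaries I"
    using nz prod koszul_class_eq_zero_iff[OF sub] by auto
  then have "wedge_list zs \<noteq> 0"
    using boundaries_closed(1)[OF sub] by metis
  then obtain L n m where w: "wedge_list zs = single L (signed n (monomial m))"
    and L: "card L = sum_list ks" and m: "mdeg m = length zs"
    using wedge_linear_cycles[OF lin'] by blast
  have "\<exists>v. \<forall>M. lookup (wedge_list zs) M - pdiff v M \<in> I"
  proof (rule koszul_boundary_of_betti_zero[OF _ min, where i = "sum_list ks" and n = "sum_list ks + length zs"])
    show "graded_ideal I" by (simp add: I graded_monomial_ideal)
    show "in_degree (sum_list ks) (lookup (wedge_list zs))"
      using L by (auto simp: in_degree_def w lookup_single when_def)
    show "pdiff (lookup (wedge_list zs)) M \<in> I" for M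
      using prod by (simp add: ideal_chains_def lookup_koszul_d)
    show "mdeg m' + sum_list ks = sum_list ks + length zs"
      if "lookup (lookup (wedge_list zs) M) m' \<noteq> 0" for M m'
      using that m by (auto simp: w lookup_single when_def signed_def split: if_splits)
  qed (use none in blast)
  then show False using nb by (simp add: koszul_boundaries_iff)
qed

lemma is_maximum_Max: "finite A \<Longrightarrow> A \<noteq> {} \<Longrightarrow> is_maximum A (Max A)"
  by (simp add: is_maximum_def)

text \<open>Both sets are described by the minimal resolution: the lengths are the differences between degree
  and homological degree of basis elements, the sums are the homological degrees that occur.\<close>

theorem corollary2p13:
  fixes E :: "'v::{finite,linorder} set set"
    and I :: "('v, 'k::field) mpoly set"
  assumes "forest_1dim E"
    and "I = edge_ideal E"
  shows "is_maximum
           {length zs | zs :: ('v, 'k) kchain list.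
              (\<forall>z\<in>set zs. \<exists>k. linear_cycle (edge_monomials E) k z) \<and>
              homology_prod I zs \<noteq> koszul_class I 0}
           (regularity I) \<and>
         is_maximum
           {sum_list ks | (ks :: nat list) (zs :: ('v, 'k) kchain list).
              list_all2 (linear_cycle (edge_monomials E)) ks zs \<and>
              homology_prod I zs \<noteq> koszul_class I 0}
           (projective_dimension I)"
proof -
  have E: "E \<noteq> {}" "simple_graph E" and acyclic: "\<nexists>vs. graph_cycle E vs"
    using assms(1) by (auto simp: forest_1dim_def)
  obtain B s d \<epsilon> where min: "minimal_graded_free_resolution I B s d \<epsilon>"
    and B: "\<And>i k. k \<in> B i \<Longrightarrow> (i, s i k) \<in> bouquet_degrees E"
    using resolved_within_forest[OF E(2) acyclic, of "TYPE('k)"]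
    by (auto simp: resolved_within_def assms(2))
  have graded: "graded_ideal I" and sub: "pmod.subspace I"
    by (simp_all add: assms(2) graded_monomial_ideal subspace_monomial_ideal)
  have fin: "finite (B i)" for i
    using min by (simp add: minimal_graded_free_resolution_def)
  let ?n = "card (UNIV :: 'v set)"
  have bound: "i \<le> ?n" "j \<le> 2 * ?n" if "(i, j) \<in> bouquet_degrees E" for i j
  proof -
    from that obtain bs where bs: "bouquet_family E bs" "i = leaf_count bs" "j = leaf_count bs + length bs"
      by (auto simp: bouquet_degrees_def)
    have "card (leaves bs) \<le> ?n" by (rule card_mono) auto
    then show "i \<le> ?n" "j \<le> 2 * ?n"
      using bouquet_family_bounds[OF bs(1)] bs by auto
  qed

  \<comment> \<open>The pairs \<open>(ks, zs)\<close> over which the second maximum is taken; they serve for the first as well.\<close>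
  define prods where "prods = {(ks, zs :: ('v, 'k) kchain list).
    list_all2 (linear_cycle (edge_monomials E)) ks zs \<and> homology_prod I zs \<noteq> koszul_class I 0}"
  have upper: "\<exists>k\<in>B (sum_list ks). s (sum_list ks) k = sum_list ks + length zs"
    if "(ks, zs) \<in> prods" for ks zs
    using nonzero_product_in_resolution[OF E assms(2) min] that by (simp add: prods_def)
  have lower: "\<exists>bs. (map (\<lambda>(y, x, L). card L) bs, bouquet_cycles bs) \<in> prods \<and> bouquet_family E bs \<and>
      leaf_count bs = i \<and> s i k = i + length bs" if k: "k \<in> B i" for i k
  proof -
    obtain bs where bs: "bouquet_family E bs" "i = leaf_count bs" "s i k = leaf_count bs + length bs"
      using B[OF k] by (auto simp: bouquet_degrees_def)
    then have "(map (\<lambda>(y, x, L). card L) bs, bouquet_cycles bs) \<in> prods"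
      using bouquet_product_nonzero(1)[OF E bs(1) assms(2)] bouquet_cycles_linear[OF E bs(1)]
      by (simp add: prods_def)
    then show ?thesis using bs by auto
  qed

  have lengths: "{length zs | zs :: ('v, 'k) kchain list.
      (\<forall>z\<in>set zs. \<exists>k. linear_cycle (edge_monomials E) k z) \<and> homology_prod I zs \<noteq> koszul_class I 0} =
    {j. \<exists>i. \<exists>k\<in>B i. s i k = i + j}" (is "?lengths = ?J")
  proof (intro set_eqI iffI)
    fix j
    assume "j \<in> ?lengths"
    then obtain zs :: "('v, 'k) kchain list" where zs: "j = length zs"
      "\<forall>z\<in>set zs. \<exists>k. linear_cycle (edge_monomials E) k z" "homology_prod I zs \<noteq> koszul_class I 0" by blast
    then obtain deg where "\<And>z. z \<in> set zs \<Longrightarrow> linear_cycle (edge_monomials E) (deg z) z" by metis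
    then have "(map deg zs, zs) \<in> prods"
      using zs by (simp add: prods_def list_all2_conv_all_nth)
    then show "j \<in> ?J" using upper zs(1) by blast
  next
    fix j
    assume "j \<in> ?J"
    then obtain i k where k: "k \<in> B i" "s i k = i + j" by blast
    then obtain bs where bs: "(map (\<lambda>(y, x, L). card L) bs, bouquet_cycles bs) \<in> prods" "j = length bs"
      using lower[OF k(1)] by auto
    let ?zs = "bouquet_cycles bs :: ('v, 'k) kchain list"
    have "\<forall>z\<in>set ?zs. \<exists>k. linear_cycle (edge_monomials E) k z"
    proof -
      have "list_all2 (linear_cycle (edge_monomials E)) (map (\<lambda>(y, x, L). card L) bs) ?zs"
        using bs(1) unfolding prods_def by blast
      then show ?thesis
        by (metis list_all2_conv_all_nth in_set_conv_nth)
    qed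
    moreover have "homology_prod I ?zs \<noteq> koszul_class I 0"
      using bs(1) unfolding prods_def by blast
    moreover have "j = length ?zs"
      by (simp add: bs(2) bouquet_cycles_def)
    ultimately show "j \<in> ?lengths" by blast
  qed
  have sums: "{sum_list ks | (ks :: nat list) (zs :: ('v, 'k) kchain list).
      list_all2 (linear_cycle (edge_monomials E)) ks zs \<and> homology_prod I zs \<noteq> koszul_class I 0} =
    {i. B i \<noteq> {}}" (is "?sums = ?S")
  proof (intro set_eqI iffI)
    fix i
    assume "i \<in> ?sums"
    then show "i \<in> ?S" using upper by (auto simp: prods_def)
  next
    fix i
    assume "i \<in> ?S"
    then obtain k where "k \<in> B i" by blast
    then obtain bs where "(map (\<lambda>(y, x, L). card L) bs, bouquet_cycles bs) \<in> prods" "leaf_count bs = i"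
      using lower by blast
    then show "i \<in> ?sums"
      unfolding leaf_count_def prods_def by blast
  qed

  have "([], []) \<in> prods"
    using bouquet_product_nonzero(1)[OF E _ assms(2), of "[]"] by (simp add: prods_def bouquet_cycles_def)
  from upper[OF this] have B0: "B 0 \<noteq> {}" "0 \<in> ?J" by auto

  have "?J \<subseteq> {..2 * ?n}"
    using B bound(2) by fastforce
  then have finJ: "finite ?J" by (rule finite_subset) simp
  have "?J \<noteq> {}" using B0(2) by blast
  moreover have "regularity I = Max ?J"
    unfolding regularity_def graded_betti_eq[OF graded min] using fin
    by (intro arg_cong[where f = Max]) auto
  ultimately have reg: "is_maximum ?J (regularity I)"
    using is_maximum_Max[OF finJ] by simp

  have "?S \<subseteq> {..?n}"
    using B bound(1) by fastforce
  then have finS: "finite ?S" by (rule finite_subset) simp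
  define p where "p = Max ?S"
  have p: "is_maximum ?S p"
    unfolding p_def using B0(1) by (intro is_maximum_Max finS) blast
  have "projective_dimension I = p"
    unfolding projective_dimension_def
  proof (rule Least_equality)
    have "B i = {}" if "p < i" for i
      using p that by (force simp: is_maximum_def)
    then show "has_projective_resolution I p"
      unfolding has_projective_resolution_def using minimal_resolution[OF min]
      by (intro exI[of _ "\<lambda>i. free_on (B i)"] exI[of _ d] exI[of _ \<epsilon>])
        (auto simp: direct_summand_free_on free_on_empty fmod.subspace_0[OF subspace_free_on])
  next
    fix q
    assume q: "has_projective_resolution I q"
    show "p \<le> q"
    proof (rule ccontr)
      assume "\<not> p \<le> q"
      then have "q < p" by simp
      obtain k where "k \<in> B p" using p by (auto simp: is_maximum_def)
      then obtain bs where bs: "bouquet_family E bs" "leaf_count bs = p"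
        using lower by blast
      let ?w = "wedge_list (bouquet_cycles bs) :: ('v, 'k) kchain"
      obtain n where n: "?w = single (leaves bs) (signed n (monomial (centre_monomial bs)))"
        using wedge_bouquet_cycles[OF bs(1)] by blast
      have "\<exists>v. \<forall>M. lookup ?w M - pdiff v M \<in> I"
      proof (rule koszul_boundary_of_projective_resolution[OF sub q \<open>q < p\<close>])
        show "in_degree p (lookup ?w)"
          using bouquet_family_bounds(1)[OF bs(1)] bs(2)
          by (auto simp: in_degree_def n lookup_single when_def)
        show "pdiff (lookup ?w) M \<in> I" for M
          using bouquet_product_nonzero(3)[OF E bs(1) assms(2)]
          by (simp add: ideal_chains_def lookup_koszul_d)
      qed
      then show False
        using bouquet_product_nonzero(2)[OF E bs(1) assms(2)] by (simp add: koszul_boundaries_iff)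
    qed
  qed
  then show ?thesis
    using reg p unfolding lengths sums by simp
qed

end
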